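(* Let $k\ge 0$ be an integer and let $\mathcal{C}$ be a hereditary class of members of $\Gamma_k$ (considered up to isomorphism) which contains only finitely many indecomposable members. Then $\mathcal{C}$ is algebraic, i.e. its generating series $\mathcal{H}_{\mathcal{C}}(x)=\sum_{n\ge 0}\varphi_{\mathcal{C}}(n)x^n$ is algebraic.
   Context: An ordered binary structure of type $k$ is a tuple $\mathcal{R}=(E,\le,\rho_1,\dots,\rho_k)$ where $\le$ is a linear order on the set $E$ and $\rho_1,\dots,\rho_k$ are binary relations on $E$. $\Gamma_k$ denotes the class of finite ordered binary structures of type $k$ in which every $\rho_i$ is reflexive. For $A\subseteq E$, the restriction $\mathcal{R}_{\restriction A}$ is the structure on $A$ induced by all relations. $\mathcal{R}$ embeds in $\mathcal{R}'$ if $\mathcal{R}$ is isomorphic to a restriction of $\mathcal{R}'$; a class is hereditary if it is closed under isomorphism and under embedding into its members. A subset $A\subseteq E$ is an interval of $\mathcal{R}$ if for every relation $\rho$ among $\le,\rho_1,\dots,\rho_k$, every $a,a'\in A$ and every $x\notin A$: $x\rho a\Leftrightarrow x\rho a'$ and $a\rho x\Leftrightarrow a'\rho x$. $\mathcal{R}$ is indecomposable if its only intervals are $\emptyset$, the singletons and $E$. The profile $\varphi_{\mathcal{C}}(n)$ is the number of members of $\mathcal{C}$ with $n$ elements, counted up to isomorphism. A power series with integer coefficients is algebraic if it is a root of a nonzero polynomial $Q(x,y)$ with rational coefficients. *)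

theory Defs
  imports "HOL-Computational_Algebra.Computational_Algebra"
begin

record 'a obs =
  elems :: "'a set"
  ord :: "'a rel"
  rels :: "'a rel list"

text \<open>
  The relations are required to live on the underlying set, so that a structure is determined
  by its data on \<open>elems R\<close>; linear_order_on already includes this for the order.
\<close>

definition ordered_binary_structure :: "nat \<Rightarrow> 'a obs \<Rightarrow> bool" where
  "ordered_binary_structure k R \<longleftrightarrow>
     linear_order_on (elems R) (ord R) \<and>
     length (rels R) = k \<and>
     (\<forall>\<rho>\<in>set (rels R). \<rho> \<subseteq> elems R \<times> elems R)"

definition Gamma :: "nat \<Rightarrow> 'a obs set" where
  "Gamma k = {R. ordered_binary_structure k R \<and> finite (elems R) \<and>
                 (\<forall>\<rho>\<in>set (rels R). refl_on (elems R) \<rho>)}"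

definition all_rels :: "'a obs \<Rightarrow> 'a rel list" where
  "all_rels R = ord R # rels R"

definition restriction :: "'a obs \<Rightarrow> 'a set \<Rightarrow> 'a obs" where
  "restriction R A = \<lparr>elems = A, ord = Restr (ord R) A, rels = map (\<lambda>\<rho>. Restr \<rho> A) (rels R)\<rparr>"

definition isomorphic :: "'a obs \<Rightarrow> 'b obs \<Rightarrow> bool" where
  "isomorphic R S \<longleftrightarrow>
     (\<exists>f. bij_betw f (elems R) (elems S) \<and>
          list_all2 (\<lambda>\<rho> \<sigma>. \<forall>x\<in>elems R. \<forall>y\<in>elems R. (x, y) \<in> \<rho> \<longleftrightarrow> (f x, f y) \<in> \<sigma>)
            (all_rels R) (all_rels S))"

definition embeds :: "'a obs \<Rightarrow> 'b obs \<Rightarrow> bool" where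
  "embeds R S \<longleftrightarrow> (\<exists>A\<subseteq>elems S. isomorphic R (restriction S A))"

definition interval_of :: "'a obs \<Rightarrow> 'a set \<Rightarrow> bool" where
  "interval_of R A \<longleftrightarrow> A \<subseteq> elems R \<and>
     (\<forall>\<rho>\<in>set (all_rels R). \<forall>a\<in>A. \<forall>a'\<in>A. \<forall>x\<in>elems R - A.
        ((x, a) \<in> \<rho> \<longleftrightarrow> (x, a') \<in> \<rho>) \<and> ((a, x) \<in> \<rho> \<longleftrightarrow> (a', x) \<in> \<rho>))"

definition indecomposable :: "'a obs \<Rightarrow> bool" where
  "indecomposable R \<longleftrightarrow>
     (\<forall>A. interval_of R A \<longrightarrow> A = {} \<or> (\<exists>x. A = {x}) \<or> A = elems R)"

text \<open>
  A class of finite structures is modelled as an isomorphism-closed set of structures whose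
  underlying sets are finite subsets of a fixed infinite type (\<open>nat\<close> below); every finite
  structure has an isomorphic copy there.
\<close>

definition hereditary :: "nat \<Rightarrow> 'a obs set \<Rightarrow> bool" where
  "hereditary k C \<longleftrightarrow>
     (\<forall>R\<in>C. \<forall>S. ordered_binary_structure k S \<and> isomorphic S R \<longrightarrow> S \<in> C) \<and>
     (\<forall>R\<in>C. \<forall>S. ordered_binary_structure k S \<and> embeds S R \<longrightarrow> S \<in> C)"

definition iso_classes :: "'a obs set \<Rightarrow> 'a obs set set" where
  "iso_classes C = C // {(R, S). R \<in> C \<and> S \<in> C \<and> isomorphic R S}"

text \<open>
  For \<open>C \<subseteq> Gamma k\<close> there are only finitely many isomorphism classes of each size, so
  \<open>card\<close> is the true count.
\<close>

definition profile :: "nat obs set \<Rightarrow> nat \<Rightarrow> nat" where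
  "profile C n = card (iso_classes {R \<in> C. card (elems R) = n})"

definition generating_series :: "nat obs set \<Rightarrow> int fps" where
  "generating_series C = Abs_fps (\<lambda>n. int (profile C n))"

text \<open>
  A bivariate polynomial \<open>Q(x, y)\<close> is a polynomial in \<open>y\<close> over the polynomials in \<open>x\<close>.
\<close>

definition algebraic_series :: "int fps \<Rightarrow> bool" where
  "algebraic_series H \<longleftrightarrow>
     (\<exists>Q :: rat poly poly. Q \<noteq> 0 \<and>
        poly (map_poly fps_of_poly Q) (Abs_fps (\<lambda>n. rat_of_int (fps_nth H n))) = 0)"

end

theory Submission
  imports Defs "HOL-Library.Ramsey" "HOL-Library.Product_Lexorder"
begin

text \<open>
  Since a finite linear order has no automorphisms, an isomorphism class is a canonical structure on
  an initial segment of \<open>nat\<close>, i.e. a colouring of the pairs \<open>i < j < n\<close>. By substitution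
  decomposition every structure with at least two points is an inflation \<open>\<sigma>[A\<^sub>1, \<dots>, A\<^sub>m]\<close> of an
  indecomposable \<open>\<sigma>\<close>; this is unique if \<open>m \<ge> 3\<close>, and also for \<open>m = 2\<close> once \<open>A\<^sub>1\<close> is required not
  to be an inflation of \<open>\<sigma>\<close>. With finitely many \<open>\<sigma>\<close>, a minimal bad sequence argument shows that
  the class is well-quasi-ordered by embeddability, so hereditary subclasses \<open>D\<close> can be treated by
  Noetherian induction, and the tuples \<open>(A\<^sub>1, \<dots>, A\<^sub>m)\<close> with \<open>\<sigma>[A\<^sub>1, \<dots>, A\<^sub>m] \<in> D\<close> form a finite
  union of boxes \<open>E\<^sub>1 \<times> \<dots> \<times> E\<^sub>m\<close> of hereditary \<open>E\<^sub>i \<subseteq> D\<close>. Each \<open>E\<^sub>i\<close> is either \<open>D\<close> or has an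
  algebraic series by induction, so inclusion-exclusion gives a polynomial equation for the series
  \<open>h\<close> of \<open>D\<close> over the algebraic series. It is nontrivial because modulo \<open>x\<close> it has the form
  \<open>Y + O(Y\<^sup>2)\<close>.
\<close>

section \<open>Algebraic power series\<close>

text \<open>The obstacle is the two-point quotient. Irreducibility of the first component makes the
  decomposition unique, but a substructure of an irreducible structure may be reducible, so the
  irreducible members of a hereditary class need not form a hereditary class and the induction
  hypothesis does not give their series. The induction therefore carries the series of the reducible
  members along with that of the class. The equation for the reducible part is linear in its own
  series and is solved with a denominator of constant term 1. Nontriviality of the final equation
  rests on constant terms. The empty structure is set aside, so every factor of a box vanishes at x
  = 0, and a product of at least two such factors has no term Y modulo x. The coefficients are
  algebraic series, so closure under ring operations and under roots is required. It comes from
  letting series act on a finite dimensional space over the rational functions, where powers of a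
  series must become dependent.\<close>

definition alg_fps :: "'a::field fps \<Rightarrow> bool" where
  "alg_fps f \<longleftrightarrow> (\<exists>Q. Q \<noteq> 0 \<and> poly (map_poly fps_of_poly Q) f = 0)"

text \<open>Gaussian elimination without division: the remaining entries become 2-by-2 minors with
  the pivot \<open>a j0 i0\<close>, so the whole computation stays inside the domain.\<close>

lemma homogeneous_system_solution:
  fixes a :: "'j \<Rightarrow> 'i \<Rightarrow> 'r::idom"
  assumes "finite I" "finite J" "card I < card J"
  shows "\<exists>u. (\<exists>j\<in>J. u j \<noteq> 0) \<and> (\<forall>i\<in>I. (\<Sum>j\<in>J. u j * a j i) = 0)"
  using assms
proof (induction I arbitrary: J a rule: finite_induct)
  case empty
  then have "J \<noteq> {}" by auto
  then show ?case by (intro exI[of _ "\<lambda>_. 1"]) auto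
next
  case (insert i0 I)
  show ?case
  proof (cases "\<forall>j\<in>J. a j i0 = 0")
    case True
    have "card I < card J" using insert.prems insert.hyps by auto
    from insert.IH[OF insert.prems(1) this, of a] obtain u where
      "\<exists>j\<in>J. u j \<noteq> 0" "\<forall>i\<in>I. (\<Sum>j\<in>J. u j * a j i) = 0" by blast
    with True show ?thesis by (intro exI[of _ u]) auto
  next
    case False
    then obtain j0 where j0: "j0 \<in> J" "a j0 i0 \<noteq> 0" by blast
    define J' where "J' = J - {j0}"
    have J': "finite J'" "j0 \<notin> J'" "J = insert j0 J'" using j0 insert.prems by (auto simp: J'_def)
    have "card I < card J'" using J' insert.prems insert.hyps by simp
    from insert.IH[OF J'(1) this, of "\<lambda>j i. a j0 i0 * a j i - a j i0 * a j0 i"] obtain u where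
      u: "\<exists>j\<in>J'. u j \<noteq> 0"
         "\<forall>i\<in>I. (\<Sum>j\<in>J'. u j * (a j0 i0 * a j i - a j i0 * a j0 i)) = 0" by blast
    \<comment> \<open>\<open>w j0\<close> is the value forced by equation \<open>i0\<close>; the
      other unknowns carry the factor \<open>a j0 i0\<close> that would otherwise be divided
      out.\<close>
    define w where "w j = (if j = j0 then - (\<Sum>j\<in>J'. u j * a j i0) else a j0 i0 * u j)" for j
    have sumw: "(\<Sum>j\<in>J. w j * a j i) =
        (\<Sum>j\<in>J'. u j * (a j0 i0 * a j i - a j i0 * a j0 i))" for i
    proof -
      have "(\<Sum>j\<in>J. w j * a j i) = w j0 * a j0 i + (\<Sum>j\<in>J'. w j * a j i)"
        using J' by simp
      also have "(\<Sum>j\<in>J'. w j * a j i) = (\<Sum>j\<in>J'. a j0 i0 * u j * a j i)"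
        using J' by (intro sum.cong) (auto simp: w_def)
      finally show ?thesis
        by (simp add: w_def[of j0] sum_distrib_right sum_distrib_left sum_subtractf right_diff_distrib
            mult_ac)
    qed
    have "\<exists>j\<in>J. w j \<noteq> 0" using u(1) J' j0 by (auto simp: w_def)
    moreover have "(\<Sum>j\<in>J. w j * a j i) = 0" if "i \<in> insert i0 I" for i
      using that u(2) unfolding sumw by (auto simp: algebra_simps)
    ultimately show ?thesis by blast
  qed
qed

text \<open>The span over the field of rational functions, with denominators cleared.\<close>

definition rspan :: "'a::field fps set \<Rightarrow> 'a fps set" where
  "rspan B = {v. \<exists>d c. d \<noteq> 0 \<and> fps_of_poly d * v = (\<Sum>b\<in>B. fps_of_poly (c b) * b)}"

text \<open>The substitute for a finite field extension: the series that act on one fixed space.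
  They visibly form a ring, whereas closure under sums and products is invisible on defining
  equations.\<close>

definition multipliers :: "'a::field fps set \<Rightarrow> 'a fps set" where
  "multipliers B = {e. \<forall>v\<in>rspan B. e * v \<in> rspan B}"

lemma fps_of_poly_eq_0 [simp]: "fps_of_poly p = 0 \<longleftrightarrow> p = 0"
  using fps_of_poly_eq_iff[of p 0] by simp

lemma rspan_0: "0 \<in> rspan B"
  unfolding rspan_def by (auto intro!: exI[of _ 1] exI[of _ "\<lambda>_. 0"])

lemma rspan_base: "finite B \<Longrightarrow> b \<in> B \<Longrightarrow> b \<in> rspan B"
  unfolding rspan_def
  by (auto intro!: exI[of _ 1] exI[of _ "\<lambda>x. if x = b then 1 else 0"]
      simp: if_distrib[of fps_of_poly] if_distrib[of "\<lambda>x. x * _"] cong: if_cong)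

lemma rspan_add:
  assumes "v \<in> rspan B" "w \<in> rspan B" shows "v + w \<in> rspan B"
proof -
  from assms obtain d c d' c' where dc: "d \<noteq> 0" "fps_of_poly d * v = (\<Sum>b\<in>B. fps_of_poly (c b) * b)"
    "d' \<noteq> 0" "fps_of_poly d' * w = (\<Sum>b\<in>B. fps_of_poly (c' b) * b)"
    unfolding rspan_def by auto
  have "fps_of_poly (d * d') * (v + w) =
      fps_of_poly d' * (fps_of_poly d * v) + fps_of_poly d * (fps_of_poly d' * w)"
    by (simp add: fps_of_poly_mult algebra_simps)
  also have "\<dots> = (\<Sum>b\<in>B. fps_of_poly (d' * c b + d * c' b) * b)"
    unfolding dc by (simp add: sum_distrib_left sum.distrib fps_of_poly_mult fps_of_poly_add algebra_simps)
  finally show ?thesis using dc unfolding rspan_def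
    by (auto intro!: exI[of _ "d * d'"] exI[of _ "\<lambda>b. d' * c b + d * c' b"])
qed

lemma rspan_scale:
  assumes "v \<in> rspan B" shows "fps_of_poly r * v \<in> rspan B"
proof -
  from assms obtain d c where dc: "d \<noteq> 0" "fps_of_poly d * v = (\<Sum>b\<in>B. fps_of_poly (c b) * b)"
    unfolding rspan_def by auto
  have "fps_of_poly d * (fps_of_poly r * v) = fps_of_poly r * (fps_of_poly d * v)"
    by (simp add: algebra_simps)
  also have "\<dots> = (\<Sum>b\<in>B. fps_of_poly (r * c b) * b)"
    unfolding dc by (simp add: sum_distrib_left fps_of_poly_mult algebra_simps)
  finally show ?thesis using dc unfolding rspan_def
    by (auto intro!: exI[of _ d] exI[of _ "\<lambda>b. r * c b"])
qed

text \<open>A nonzero polynomial factor is absorbed into the denominator. Later proofs show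
  membership only after multiplying by such a factor.\<close>

lemma rspan_cancel:
  assumes "fps_of_poly r * v \<in> rspan B" "r \<noteq> 0" shows "v \<in> rspan B"
proof -
  from assms obtain d c where "d \<noteq> 0"
    "fps_of_poly d * (fps_of_poly r * v) = (\<Sum>b\<in>B. fps_of_poly (c b) * b)"
    unfolding rspan_def by auto
  with assms(2) show ?thesis unfolding rspan_def
    by (auto intro!: exI[of _ "d * r"] exI[of _ c] simp: fps_of_poly_mult mult.assoc)
qed

lemma rspan_sum: "(\<And>i. i \<in> I \<Longrightarrow> f i \<in> rspan B) \<Longrightarrow> sum f I \<in> rspan B"
  by (induction I rule: infinite_finite_induct) (auto intro: rspan_0 rspan_add)

lemma rspan_mult_into:
  assumes "v \<in> rspan B" "\<And>b. b \<in> B \<Longrightarrow> e * b \<in> rspan B'"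
  shows "e * v \<in> rspan B'"
proof -
  from assms(1) obtain d c where dc: "d \<noteq> 0" "fps_of_poly d * v = (\<Sum>b\<in>B. fps_of_poly (c b) * b)"
    unfolding rspan_def by auto
  have "fps_of_poly d * (e * v) = e * (fps_of_poly d * v)" by (simp add: algebra_simps)
  also have "\<dots> = (\<Sum>b\<in>B. fps_of_poly (c b) * (e * b))"
    unfolding dc by (simp add: sum_distrib_left algebra_simps)
  also have "\<dots> \<in> rspan B'" by (intro rspan_sum rspan_scale assms)
  finally show ?thesis using rspan_cancel dc by blast
qed

lemma multipliersI: "(\<And>b. b \<in> B \<Longrightarrow> e * b \<in> rspan B) \<Longrightarrow> e \<in> multipliers B"
  unfolding multipliers_def using rspan_mult_into by blast

lemma multipliers_of_poly: "fps_of_poly r \<in> multipliers B"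
  unfolding multipliers_def using rspan_scale by blast

lemma multipliers_add: "e \<in> multipliers B \<Longrightarrow> f \<in> multipliers B \<Longrightarrow> e + f \<in> multipliers B"
  unfolding multipliers_def by (auto simp: distrib_right intro: rspan_add)

lemma multipliers_mult: "e \<in> multipliers B \<Longrightarrow> f \<in> multipliers B \<Longrightarrow> e * f \<in> multipliers B"
  unfolding multipliers_def by (auto simp: mult.assoc)

lemma multipliers_uminus: "e \<in> multipliers B \<Longrightarrow> - e \<in> multipliers B"
  using multipliers_mult[OF multipliers_of_poly[of "-1"], of e B]
  by (simp add: fps_of_poly_uminus)

lemma multipliers_power_rspan:
  "1 \<in> rspan B \<Longrightarrow> e \<in> multipliers B \<Longrightarrow> e ^ n \<in> rspan B"
  by (induction n) (auto simp: multipliers_def)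

lemma multipliers_poly:
  assumes "e \<in> multipliers B"
  shows "poly (map_poly fps_of_poly Q) e \<in> multipliers B"
proof (induction Q)
  case 0
  then show ?case using multipliers_of_poly[of 0] by simp
next
  case (pCons a Q)
  then show ?case using assms
    by (auto simp: map_poly_pCons intro!: multipliers_add multipliers_mult multipliers_of_poly)
qed

text \<open>There are more vectors than generators. The linear system is solved for the numerators,
  and multiplying its solution by the nonzero denominators \<open>d i\<close> keeps the dependence
  nontrivial.\<close>

lemma rspan_dependent:
  assumes "finite B" "\<And>i. i \<le> card B \<Longrightarrow> v i \<in> rspan B"
  shows "\<exists>u. (\<exists>i\<le>card B. u i \<noteq> 0) \<and> (\<Sum>i\<le>card B. fps_of_poly (u i) * v i) = 0"
proof -
  let ?J = "{..card B}"
  have "\<forall>i\<in>?J. \<exists>d c. d \<noteq> 0 \<and> fps_of_poly d * v i = (\<Sum>b\<in>B. fps_of_poly (c b) * b)"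
    using assms(2) unfolding rspan_def by auto
  then obtain d c where dc: "\<And>i. i \<in> ?J \<Longrightarrow> d i \<noteq> 0"
    "\<And>i. i \<in> ?J \<Longrightarrow> fps_of_poly (d i) * v i = (\<Sum>b\<in>B. fps_of_poly (c i b) * b)"
    by metis
  obtain w where w: "\<exists>j\<in>?J. w j \<noteq> 0" "\<forall>b\<in>B. (\<Sum>j\<in>?J. w j * c j b) = 0"
    using homogeneous_system_solution[of B ?J c] assms(1) by auto
  have "(\<Sum>i\<in>?J. fps_of_poly (w i * d i) * v i) = (\<Sum>i\<in>?J. fps_of_poly (w i) * (\<Sum>b\<in>B. fps_of_poly (c i b) * b))"
    by (intro sum.cong) (auto simp: fps_of_poly_mult mult.assoc dc)
  also have "\<dots> = (\<Sum>b\<in>B. fps_of_poly (\<Sum>i\<in>?J. w i * c i b) * b)"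
    unfolding sum_distrib_left
    by (subst sum.swap) (simp add: fps_of_poly_sum fps_of_poly_mult sum_distrib_right mult.assoc)
  also have "\<dots> = 0" using w(2) by simp
  finally have "(\<Sum>i\<in>?J. fps_of_poly (w i * d i) * v i) = 0" .
  moreover have "\<exists>i\<le>card B. w i * d i \<noteq> 0" using w(1) dc(1) by auto
  ultimately show ?thesis by (intro exI[of _ "\<lambda>i. w i * d i"]) auto
qed

text \<open>Since \<open>1\<close> lies in the span, so do all powers of \<open>e\<close>; a
  dependence among the first \<open>card B + 1\<close> of them is a polynomial equation. It takes
  the place of the characteristic polynomial of multiplication by \<open>e\<close>.\<close>

lemma alg_fps_multiplier:
  assumes "finite B" "1 \<in> rspan B" "e \<in> multipliers B"
  shows "alg_fps e"
proof -
  obtain u where u: "\<exists>i\<le>card B. u i \<noteq> 0" "(\<Sum>i\<le>card B. fps_of_poly (u i) * e ^ i) = 0"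
    using rspan_dependent[of B "\<lambda>i. e ^ i"] multipliers_power_rspan assms by blast
  define Q where "Q = (\<Sum>i\<le>card B. monom (u i) i)"
  have cQ: "coeff Q i = (if i \<le> card B then u i else 0)" for i
    unfolding Q_def by (simp add: coeff_sum)
  have "map_poly fps_of_poly Q = (\<Sum>i\<le>card B. monom (fps_of_poly (u i)) i)"
    by (rule poly_eqI) (simp add: coeff_map_poly cQ coeff_sum)
  then have "poly (map_poly fps_of_poly Q) e = 0"
    using u(2) by (simp add: poly_sum poly_monom)
  moreover have "Q \<noteq> 0" using u(1) cQ by (metis coeff_0)
  ultimately show ?thesis unfolding alg_fps_def by blast
qed

text \<open>Adjoins a root of an equation whose leading coefficient is a polynomial while the other
  coefficients are only multipliers. The new generators are \<open>b * g ^ l\<close> with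
  \<open>l < m\<close>; multiplication by \<open>g\<close> leaves them only at
  \<open>l = m - 1\<close>, where the equation lowers the degree.\<close>

lemma multipliers_extend:
  assumes B: "finite B" "1 \<in> rspan B" and "m > 0" "d \<noteq> 0"
    and c: "\<And>j. j < m \<Longrightarrow> c j \<in> multipliers B"
    and g: "fps_of_poly d * g ^ m = (\<Sum>j<m. c j * g ^ j)"
  shows "\<exists>B'. finite B' \<and> 1 \<in> rspan B' \<and> multipliers B \<subseteq> multipliers B' \<and> g \<in> multipliers B'"
proof -
  define B' where "B' = (\<lambda>(b, l). b * g ^ l) ` (B \<times> {..<m})"
  have fin: "finite B'" unfolding B'_def using B by auto
  have lift: "v * g ^ l \<in> rspan B'" if "v \<in> rspan B" "l < m" for v l
  proof -
    have "g ^ l * v \<in> rspan B'"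
      using that by (intro rspan_mult_into[OF that(1)] rspan_base fin)
        (auto simp: B'_def mult.commute intro!: image_eqI[of _ _ "(_, l)"])
    then show ?thesis by (simp add: mult.commute)
  qed
  have "multipliers B \<subseteq> multipliers B'"
  proof
    fix e assume e: "e \<in> multipliers B"
    show "e \<in> multipliers B'"
    proof (rule multipliersI)
      fix b' assume "b' \<in> B'"
      then obtain b l where b: "b \<in> B" "l < m" "b' = b * g ^ l" by (auto simp: B'_def)
      have "e * b \<in> rspan B" using e rspan_base[OF B(1) b(1)] by (auto simp: multipliers_def)
      from lift[OF this b(2)] show "e * b' \<in> rspan B'" by (simp add: b mult.assoc)
    qed
  qed
  moreover have "g \<in> multipliers B'"
  proof (rule multipliersI)
    fix b' assume "b' \<in> B'"
    then obtain b l where b: "b \<in> B" "l < m" "b' = b * g ^ l" by (auto simp: B'_def)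
    note bB = rspan_base[OF B(1) b(1)]
    show "g * b' \<in> rspan B'"
    proof (cases "Suc l < m")
      case True
      from lift[OF bB this] show ?thesis by (simp add: b algebra_simps)
    next
      case False
      then have l: "m = Suc l" using b by simp
      have "fps_of_poly d * (g * b') = b * (fps_of_poly d * g ^ m)" by (simp add: b l algebra_simps)
      also have "\<dots> = (\<Sum>j<m. (c j * b) * g ^ j)"
        unfolding g by (simp add: sum_distrib_left algebra_simps)
      also have "\<dots> \<in> rspan B'"
        using c bB by (intro rspan_sum lift) (auto simp: multipliers_def)
      finally show ?thesis using rspan_cancel assms by blast
    qed
  qed
  moreover have "1 \<in> rspan B'" using lift[OF B(2), of 0] assms by simp
  ultimately show ?thesis using fin by blast
qed

lemma poly_split_top:
  fixes q :: "'b::idom poly"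
  shows "poly q g = 0 \<longleftrightarrow> lead_coeff q * g ^ degree q = (\<Sum>j<degree q. - coeff q j * g ^ j)"
proof -
  have "poly q g = (\<Sum>j<degree q. coeff q j * g ^ j) + lead_coeff q * g ^ degree q"
    by (simp add: poly_altdef lessThan_Suc_atMost[symmetric])
  then show ?thesis by (simp add: sum_negf eq_neg_iff_add_eq_0 add.commute)
qed

lemma degree_map_poly_fps_of_poly: "degree (map_poly fps_of_poly Q) = degree Q"
  by (rule degree_map_poly) auto

text \<open>The series are adjoined one at a time, starting from the span of \<open>1\<close>. A
  single space on which all of them act is what makes their sums and products algebraic.\<close>

lemma alg_fps_finite_multipliers:
  assumes "finite E" "\<And>e. e \<in> E \<Longrightarrow> alg_fps e"
  shows "\<exists>B. finite B \<and> 1 \<in> rspan B \<and> E \<subseteq> multipliers B"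
  using assms
proof (induction E rule: finite_induct)
  case empty
  have "(1::'a fps) \<in> rspan {1}" by (rule rspan_base) auto
  then show ?case by (intro exI[of _ "{1}"]) auto
next
  case (insert e E)
  then obtain B where B: "finite B" "1 \<in> rspan B" "E \<subseteq> multipliers B" by blast
  obtain Q where Q: "Q \<noteq> 0" "poly (map_poly fps_of_poly Q) e = 0"
    using insert.prems unfolding alg_fps_def by blast
  have deg: "degree Q > 0"
  proof (rule ccontr)
    assume "\<not> ?thesis"
    then obtain a where "Q = [:a:]" using degree_eq_zeroE by blast
    with Q show False by (auto simp: map_poly_pCons)
  qed
  have "fps_of_poly (lead_coeff Q) * e ^ degree Q = (\<Sum>j<degree Q. fps_of_poly (- coeff Q j) * e ^ j)"
    using Q(2) unfolding poly_split_top
    by (simp add: degree_map_poly_fps_of_poly coeff_map_poly fps_of_poly_uminus)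
  from multipliers_extend[OF B(1,2) deg _ _ this] obtain B' where
    "finite B'" "1 \<in> rspan B'" "multipliers B \<subseteq> multipliers B'" "e \<in> multipliers B'"
    using Q multipliers_of_poly by auto
  with B show ?case by blast
qed

section \<open>Closure of the algebraic series under ring operations and roots\<close>

lemma alg_fps_of_poly: "alg_fps (fps_of_poly p)"
  unfolding alg_fps_def by (intro exI[of _ "[:-p, 1:]"]) (simp add: map_poly_pCons fps_of_poly_uminus)

lemma alg_fps_0 [simp]: "alg_fps 0" and alg_fps_1 [simp]: "alg_fps 1"
  using alg_fps_of_poly[of 0] alg_fps_of_poly[of 1] by simp_all

lemma alg_fps_add: "alg_fps f \<Longrightarrow> alg_fps g \<Longrightarrow> alg_fps (f + g)"
  and alg_fps_mult: "alg_fps f \<Longrightarrow> alg_fps g \<Longrightarrow> alg_fps (f * g)"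
  using alg_fps_finite_multipliers[of "{f, g}"]
  by (auto intro: alg_fps_multiplier multipliers_add multipliers_mult)

lemma alg_fps_uminus: "alg_fps f \<Longrightarrow> alg_fps (- f)"
  using alg_fps_mult[OF alg_fps_of_poly[of "-1"], of f] by (simp add: fps_of_poly_uminus)

lemma alg_fps_diff: "alg_fps f \<Longrightarrow> alg_fps g \<Longrightarrow> alg_fps (f - g)"
  using alg_fps_add[of f "- g"] alg_fps_uminus[of g] by simp

lemma alg_fps_sum: "(\<And>i. i \<in> I \<Longrightarrow> alg_fps (f i)) \<Longrightarrow> alg_fps (sum f I)"
  by (induction I rule: infinite_finite_induct) (auto intro: alg_fps_add)

text \<open>\<open>multipliers_extend\<close> wants a polynomial leading coefficient. After powers
  of \<open>c\<close> are cancelled from an equation for \<open>c\<close>, its constant coefficient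
  is, up to sign, \<open>c\<close> times a polynomial expression in \<open>c\<close>. That
  expression is the cofactor, and it acts wherever \<open>c\<close> acts.\<close>

lemma root_nonzero_cofactor:
  assumes "Q \<noteq> 0" "poly (map_poly fps_of_poly Q) c = 0" "c \<noteq> 0"
  shows "\<exists>c' d. d \<noteq> 0 \<and> c * c' = fps_of_poly d \<and> (\<forall>B. c \<in> multipliers B \<longrightarrow> c' \<in> multipliers B)"
  using assms
proof (induction Q)
  case (pCons a Q)
  have eq: "fps_of_poly a + c * poly (map_poly fps_of_poly Q) c = 0"
    using pCons.prems by (simp add: map_poly_pCons)
  show ?case
  proof (cases "a = 0")
    case True
    then have "poly (map_poly fps_of_poly Q) c = 0" "Q \<noteq> 0" using eq pCons.prems by auto
    then show ?thesis using pCons.IH pCons.prems(3) by blast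
  next
    case False
    let ?c' = "- poly (map_poly fps_of_poly Q) c"
    have "c * ?c' = fps_of_poly a" using eq unfolding add_eq_0_iff2 by simp
    moreover have "c \<in> multipliers B \<Longrightarrow> ?c' \<in> multipliers B" for B
      by (intro multipliers_uminus multipliers_poly)
    ultimately show ?thesis using False by blast
  qed
qed simp

text \<open>Algebraic over algebraic is algebraic. Multiplying by the cofactor of the leading
  coefficient turns that coefficient into a polynomial and leaves the others among the
  multipliers.\<close>

theorem alg_fps_root:
  assumes "q \<noteq> 0" "\<And>i. alg_fps (coeff q i)" "poly q g = 0"
  shows "alg_fps g"
proof -
  have deg: "degree q > 0"
  proof (rule ccontr)
    assume "\<not> ?thesis"
    then obtain a where "q = [:a:]" using degree_eq_zeroE by blast
    with assms show False by auto
  qed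
  obtain B where B: "finite B" "1 \<in> rspan B" "coeff q ` {..degree q} \<subseteq> multipliers B"
    using alg_fps_finite_multipliers[of "coeff q ` {..degree q}"] assms by auto
  let ?c = "lead_coeff q"
  obtain c' d where c': "d \<noteq> 0" "?c * c' = fps_of_poly d" "c' \<in> multipliers B"
  proof -
    obtain Q where "Q \<noteq> 0" "poly (map_poly fps_of_poly Q) ?c = 0"
      using assms(2)[of "degree q"] unfolding alg_fps_def by blast
    moreover have "?c \<noteq> 0" "?c \<in> multipliers B" using assms(1) B(3) by auto
    ultimately show ?thesis using root_nonzero_cofactor that by blast
  qed
  have "fps_of_poly d * g ^ degree q = c' * (?c * g ^ degree q)"
    unfolding c'(2)[symmetric] by (simp add: algebra_simps)
  also have "\<dots> = (\<Sum>j<degree q. - (c' * coeff q j) * g ^ j)"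
    using assms(3) unfolding poly_split_top by (simp add: sum_distrib_left mult.assoc)
  finally have eq: "fps_of_poly d * g ^ degree q = (\<Sum>j<degree q. - (c' * coeff q j) * g ^ j)" .
  have mult: "- (c' * coeff q j) \<in> multipliers B" if "j < degree q" for j
    using that c'(3) B(3) by (intro multipliers_uminus multipliers_mult) auto
  obtain B' where "finite B'" "1 \<in> rspan B'" "g \<in> multipliers B'"
    using multipliers_extend[OF B(1,2) deg c'(1) mult eq] by blast
  then show ?thesis by (rule alg_fps_multiplier)
qed

section \<open>Well-quasi-orders\<close>

definition bad_seq :: "('a \<Rightarrow> 'a \<Rightarrow> bool) \<Rightarrow> 'a set \<Rightarrow> (nat \<Rightarrow> 'a) \<Rightarrow> bool" where
  "bad_seq P S f \<longleftrightarrow> (\<forall>i. f i \<in> S) \<and> (\<forall>i j. i < j \<longrightarrow> \<not> P (f i) (f j))"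

definition wqo_on :: "('a \<Rightarrow> 'a \<Rightarrow> bool) \<Rightarrow> 'a set \<Rightarrow> bool" where
  "wqo_on P S \<longleftrightarrow> (\<forall>f. \<not> bad_seq P S f)"

lemma wqo_onI:
  assumes "\<And>f::nat \<Rightarrow> 'a. (\<And>i. f i \<in> S) \<Longrightarrow> \<exists>i j. i < j \<and> P (f i) (f j)"
  shows "wqo_on P S"
  unfolding wqo_on_def
proof
  fix f :: "nat \<Rightarrow> 'a"
  show "\<not> bad_seq P S f" using assms[of f] by (auto simp: bad_seq_def)
qed

lemma wqo_onD:
  fixes f :: "nat \<Rightarrow> 'a"
  assumes "wqo_on P S" "\<And>i. f i \<in> S"
  shows "\<exists>i j. i < j \<and> P (f i) (f j)"
  using assms(1)[unfolded wqo_on_def, THEN spec[of _ f]] assms(2) by (auto simp: bad_seq_def)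

lemma wqo_on_subset: "wqo_on P S \<Longrightarrow> T \<subseteq> S \<Longrightarrow> wqo_on P T"
  unfolding wqo_on_def bad_seq_def by (meson subsetD)

text \<open>Ramsey's theorem for pairs, coloured by whether the earlier term is below the later one.
  A homogeneous set of the other colour would give a bad sequence.\<close>

lemma wqo_on_monotone_subsequence:
  fixes f :: "nat \<Rightarrow> 'a"
  assumes wqo: "wqo_on P S" and f: "\<And>i. f i \<in> S"
  shows "\<exists>\<phi> :: nat \<Rightarrow> nat. strict_mono \<phi> \<and> (\<forall>i j. i < j \<longrightarrow> P (f (\<phi> i)) (f (\<phi> j)))"
proof -
  \<comment> \<open>Ramsey colours unordered pairs; \<open>Min\<close> and \<open>Max\<close>
    restore the order of the two indices.\<close>
  define col where "col X = (if P (f (Min X)) (f (Max X)) then 0 else 1::nat)" for X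
  have "\<forall>x\<in>UNIV. \<forall>y\<in>UNIV. x \<noteq> y \<longrightarrow> col {x, y} < 2" by (simp add: col_def)
  from Ramsey2[OF infinite_UNIV_nat this] obtain Y t where Y: "infinite Y" "t < 2"
    "\<forall>x\<in>Y. \<forall>y\<in>Y. x \<noteq> y \<longrightarrow> col {x, y} = t" by blast
  define \<phi> where "\<phi> = enumerate Y"
  have mono: "strict_mono \<phi>" unfolding \<phi>_def
    by (simp add: Y(1) strict_mono_enumerate)
  have inY: "\<phi> i \<in> Y" for i unfolding \<phi>_def using Y(1) enumerate_in_set by blast
  have col: "col {\<phi> i, \<phi> j} = (if P (f (\<phi> i)) (f (\<phi> j)) then 0 else 1)" if "i < j" for i j
  proof -
    have "\<phi> i < \<phi> j" using mono that by (simp add: strict_monoD)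
    then show ?thesis by (simp add: col_def)
  qed
  have eq: "col {\<phi> i, \<phi> j} = t" if "i < j" for i j
    using Y(3) inY mono that by (metis less_irrefl strict_monoD)
  obtain i j where "i < j" "P (f (\<phi> i)) (f (\<phi> j))"
    using wqo_onD[of P S "\<lambda>i. f (\<phi> i)", OF wqo f] by (elim exE conjE)
  then have "t = 0" using col[of i j] eq[of i j] by simp
  then have "P (f (\<phi> i)) (f (\<phi> j))" if "i < j" for i j
    using col[OF that] eq[OF that] by (simp split: if_splits)
  with mono show ?thesis by auto
qed

text \<open>Dickson's lemma: pass to a subsequence with increasing heads, then find a good pair of
  tails. Fixed length is enough because the quotient fixes the number of components.\<close>

lemma wqo_on_lists:
  assumes "wqo_on P S"
  shows "wqo_on (list_all2 P) {xs. set xs \<subseteq> S \<and> length xs = m}"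
proof (induction m)
  case 0
  show ?case
  proof (rule wqo_onI)
    fix f :: "nat \<Rightarrow> 'a list"
    assume "\<And>i. f i \<in> {xs. set xs \<subseteq> S \<and> length xs = 0}"
    then have "f i = []" for i by auto
    then show "\<exists>i j. i < j \<and> list_all2 P (f i) (f j)" by (intro exI[of _ 0] exI[of _ 1]) simp
  qed
next
  case (Suc m)
  show ?case
  proof (rule wqo_onI)
    fix f :: "nat \<Rightarrow> 'a list"
    assume "\<And>i. f i \<in> {xs. set xs \<subseteq> S \<and> length xs = Suc m}"
    then have f: "set (f i) \<subseteq> S" "length (f i) = Suc m" for i by (auto simp: subset_eq)
    have split: "f i = hd (f i) # tl (f i)" for i using f(2)[of i] by (cases "f i") auto
    have hd: "hd (f i) \<in> S" for i using f[of i] by (cases "f i") auto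
    obtain \<phi> :: "nat \<Rightarrow> nat" where \<phi>: "strict_mono \<phi>" "\<forall>i j. i < j \<longrightarrow> P (hd (f (\<phi> i))) (hd (f (\<phi> j)))"
      using wqo_on_monotone_subsequence[of P S "\<lambda>i. hd (f i)", OF assms hd] by (elim exE conjE)
    have "tl (f (\<phi> i)) \<in> {xs. set xs \<subseteq> S \<and> length xs = m}" for i
      using f[of "\<phi> i"] by (cases "f (\<phi> i)") auto
    from wqo_onD[of "list_all2 P" _ "\<lambda>i. tl (f (\<phi> i))", OF Suc this] obtain i j where
      ij: "i < j" "list_all2 P (tl (f (\<phi> i))) (tl (f (\<phi> j)))" by (elim exE conjE)
    have "\<phi> i < \<phi> j" using \<phi>(1) ij(1) by (simp add: strict_monoD)
    moreover have "list_all2 P (f (\<phi> i)) (f (\<phi> j))"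
      using \<phi>(2) ij by (subst (1 2) split) simp
    ultimately show "\<exists>i j. i < j \<and> list_all2 P (f i) (f j)" by (intro exI conjI)
  qed
qed

section \<open>Minimal bad sequences\<close>

definition minimal_bad_seq :: "('a \<Rightarrow> nat) \<Rightarrow> ('a \<Rightarrow> 'a \<Rightarrow> bool) \<Rightarrow> 'a set \<Rightarrow> (nat \<Rightarrow> 'a) \<Rightarrow> bool" where
  "minimal_bad_seq sz P S f \<longleftrightarrow> bad_seq P S f \<and>
     (\<forall>n g. bad_seq P S g \<and> (\<forall>i<n. g i = f i) \<longrightarrow> sz (f n) \<le> sz (g n))"

lemma minimal_bad_seqD:
  "minimal_bad_seq sz P S f \<Longrightarrow> bad_seq P S g \<Longrightarrow> (\<And>i. i < n \<Longrightarrow> g i = f i) \<Longrightarrow> sz (f n) \<le> sz (g n)"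
  unfolding minimal_bad_seq_def by simp

text \<open>Nash-Williams' construction. Stage \<open>n\<close> keeps the first \<open>n\<close>
  terms of the current bad sequence and makes the term at position \<open>n\<close> as small as
  possible; the diagonal of the stages is the limit.\<close>

lemma minimal_bad_seq_exists:
  assumes "\<not> wqo_on P S"
  shows "\<exists>f. minimal_bad_seq sz P S f"
proof -
  let ?bad = "bad_seq P S"
  define ok where "ok n f \<longleftrightarrow> ?bad f \<and> (\<forall>g. ?bad g \<and> (\<forall>i<n. g i = f i) \<longrightarrow> sz (f n) \<le> sz (g n))" for n f
  have minimal: "\<exists>f. ok n f \<and> (\<forall>i<n. f i = f0 i)" if "?bad f0" for n f0
  proof -
    let ?Q = "\<lambda>f. ?bad f \<and> (\<forall>i<n. f i = f0 i)"
    have "?Q f0" using that by simp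
    from ex_has_least_nat[of ?Q, OF this, of "\<lambda>f. sz (f n)"]
    obtain f where f: "?Q f \<and> (\<forall>g. ?Q g \<longrightarrow> sz (f n) \<le> sz (g n))" by (rule exE)
    then show ?thesis unfolding ok_def by (intro exI[of _ f]) auto
  qed
  obtain f0 where "?bad f0" using assms unfolding wqo_on_def by auto
  define M where "M n g = (SOME f. ok n f \<and> (\<forall>i<n. f i = g i))" for n g
  have M: "ok n (M n g) \<and> (\<forall>i<n. M n g i = g i)" if "?bad g" for n g
    unfolding M_def using minimal[OF that] by (rule someI_ex)
  define F where "F = rec_nat (M 0 f0) (\<lambda>n g. M (Suc n) g)"
  have F_Suc: "F (Suc n) = M (Suc n) (F n)" for n by (simp add: F_def)
  have F1: "ok n (F n)" for n
  proof (induction n)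
    case 0
    show ?case using M[OF \<open>?bad f0\<close>] by (simp add: F_def)
  next
    case (Suc n)
    then show ?case using M[of "F n"] by (simp add: F_Suc ok_def)
  qed
  have F2: "F (Suc n) i = F n i" if "i \<le> n" for n i
    using M[of "F n" "Suc n"] F1[of n] that by (simp add: F_Suc ok_def)
  \<comment> \<open>Stages after \<open>n\<close> no longer change the positions up to
    \<open>n\<close>, so the diagonal agrees with \<open>F n\<close> there.\<close>
  have agree: "F (n + k) i = F n i" if "i \<le> n" for n k i
    using that by (induction k) (auto simp: F2)
  define f where "f n = F n n" for n
  have Ff: "F n i = f i" if "i \<le> n" for n i
    using agree[of i i "n - i"] that by (simp add: f_def)
  have "f n \<in> S" for n using F1[of n] by (auto simp: ok_def bad_seq_def f_def)
  moreover have "\<not> P (f i) (f j)" if "i < j" for i j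
  proof -
    have "\<not> P (F j i) (F j j)" using F1[of j] that by (simp add: ok_def bad_seq_def)
    then show ?thesis using that by (simp add: Ff)
  qed
  moreover have "sz (f n) \<le> sz (g n)" if "?bad g" "\<forall>i<n. g i = f i" for n g
  proof -
    have "\<forall>i<n. g i = F n i" using that(2) by (simp add: Ff)
    then show ?thesis
      using that(1) F1[of n, unfolded ok_def, THEN conjunct2, THEN spec[of _ g]] by (simp add: f_def)
  qed
  ultimately have "minimal_bad_seq sz P S f" by (simp add: minimal_bad_seq_def bad_seq_def)
  then show ?thesis by (rule exI[of _ f])
qed

text \<open>A bad sequence of parts, entered at a part with the least index \<open>n\<close>, can be
  appended to the first \<open>n\<close> terms of \<open>f\<close>. The result is again bad, but its
  term at \<open>n\<close> is a part of \<open>f n\<close> and hence smaller, against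
  minimality.\<close>

lemma wqo_on_parts_of_minimal_bad_seq:
  fixes parts :: "nat \<Rightarrow> 'a set"
  assumes min: "minimal_bad_seq sz P S f"
    and parts: "\<And>n x. x \<in> parts n \<Longrightarrow> x \<in> S \<and> sz x < sz (f n)"
    and above: "\<And>n x y. x \<in> parts n \<Longrightarrow> y \<in> S \<Longrightarrow> P y x \<Longrightarrow> P y (f n)"
  shows "wqo_on P (\<Union>n. parts n)"
proof (rule ccontr)
  assume "\<not> ?thesis"
  then obtain g where g: "bad_seq P (\<Union>n. parts n) g" unfolding wqo_on_def by auto
  have f: "f i \<in> S" "\<And>j. i < j \<Longrightarrow> \<not> P (f i) (f j)" for i
    using min by (auto simp: minimal_bad_seq_def bad_seq_def)
  have "\<forall>i. \<exists>n. g i \<in> parts n" using g by (auto simp: bad_seq_def)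
  then obtain \<nu> where \<nu>: "\<And>i. g i \<in> parts (\<nu> i)" by metis
  obtain i0 where i0: "\<And>i. \<nu> i0 \<le> \<nu> i" using ex_has_least_nat[of "\<lambda>_. True" 0 \<nu>] by blast
  define n where "n = \<nu> i0"
  define h where "h i = (if i < n then f i else g (i0 + (i - n)))" for i
  have "h i \<in> S" for i using f(1) parts[OF \<nu>] by (auto simp: h_def)
  moreover have "\<not> P (h i) (h j)" if "i < j" for i j
  proof -
    consider "j < n" | "i < n" "j \<ge> n" | "i \<ge> n" using that by linarith
    then show ?thesis
    proof cases
      case 1
      then show ?thesis using that f(2) by (simp add: h_def)
    next
      case 2
      let ?l = "i0 + (j - n)"
      \<comment> \<open>By leastness of \<open>n\<close> this part comes from a term of
        \<open>f\<close> after \<open>f i\<close>. If \<open>f i\<close> were below the part, it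
        would be below that term, against badness of \<open>f\<close>.\<close>
      have "i < \<nu> ?l" using 2 i0[of ?l] by (simp add: n_def)
      then have "\<not> P (f i) (f (\<nu> ?l))" by (rule f(2))
      then have "\<not> P (f i) (g ?l)" using above[OF \<nu> f(1)] by blast
      then show ?thesis using 2 by (simp add: h_def)
    next
      case 3
      then have "i0 + (i - n) < i0 + (j - n)" using that by linarith
      then show ?thesis using 3 that g by (simp add: h_def bad_seq_def)
    qed
  qed
  ultimately have "bad_seq P S h" by (simp add: bad_seq_def)
  then have "sz (f n) \<le> sz (h n)" by (rule minimal_bad_seqD[OF min]) (simp add: h_def)
  then show False using parts[OF \<nu>[of i0]] by (simp add: h_def n_def)
qed

section \<open>Hereditary subsets, finite bases and boxes\<close>

definition down_closed :: "('a \<Rightarrow> 'a \<Rightarrow> bool) \<Rightarrow> 'a set \<Rightarrow> 'a set \<Rightarrow> bool" where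
  "down_closed P C D \<longleftrightarrow> D \<subseteq> C \<and> (\<forall>x\<in>D. \<forall>y\<in>C. P y x \<longrightarrow> y \<in> D)"

lemma down_closed_self: "down_closed P C C"
  and down_closed_Int: "down_closed P C D \<Longrightarrow> down_closed P C E \<Longrightarrow> down_closed P C (D \<inter> E)"
  by (auto simp: down_closed_def)

text \<open>Otherwise elements not above any earlier choice could be picked forever, which gives a
  bad sequence. Applied to the complement of a down-closed set, this yields finitely many
  obstructions.\<close>

lemma wqo_on_finite_basis:
  assumes "wqo_on P S" "U \<subseteq> S"
  obtains B where "finite B" "B \<subseteq> U" "\<And>u. u \<in> U \<Longrightarrow> \<exists>b\<in>B. P b u"
proof (rule ccontr)
  assume *: "\<not> thesis"
  note finish = that
  have "\<exists>u. u \<in> U \<and> (\<forall>b\<in>B. \<not> P b u)" if "finite B" "B \<subseteq> U" for B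
    using * finish[OF that] by blast
  then obtain nxt where nxt: "\<And>B. finite B \<Longrightarrow> B \<subseteq> U \<Longrightarrow> nxt B \<in> U"
    "\<And>B b. finite B \<Longrightarrow> B \<subseteq> U \<Longrightarrow> b \<in> B \<Longrightarrow> \<not> P b (nxt B)" by metis
  define F where "F n = rec_nat {} (\<lambda>_ B. insert (nxt B) B) n" for n :: nat
  have F_Suc: "F (Suc n) = insert (nxt (F n)) (F n)" for n by (simp add: F_def)
  have F: "finite (F n) \<and> F n \<subseteq> U" for n
  proof (induction n)
    case 0
    then show ?case by (simp add: F_def)
  next
    case (Suc n)
    then show ?case using nxt(1) by (auto simp: F_Suc)
  qed
  have in_F: "nxt (F i) \<in> F j" if "i < j" for i j
    using that by (induction j) (auto simp: F_Suc less_Suc_eq)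
  have "nxt (F i) \<in> S" for i using nxt(1)[of "F i"] F[of i] assms(2) by auto
  from wqo_onD[of P S "\<lambda>i. nxt (F i)", OF assms(1) this]
  obtain i j where "i < j" "P (nxt (F i)) (nxt (F j))" by (elim exE conjE)
  then show False using nxt(2)[of "F j" "nxt (F i)"] F[of j] in_F by simp
qed

text \<open>Along a strictly descending chain choose \<open>x i\<close> in \<open>D i\<close> but
  not in \<open>D (Suc i)\<close>. If \<open>x i\<close> is below \<open>x j\<close> with
  \<open>i < j\<close>, down-closure puts \<open>x i\<close> back into the set that it has
  left.\<close>

lemma wf_down_closed_psubset:
  assumes "wqo_on P C"
  shows "wf {(D, E). down_closed P C D \<and> down_closed P C E \<and> D \<subset> E}"
  unfolding wf_iff_no_infinite_down_chain
proof
  assume "\<exists>D. \<forall>i. (D (Suc i), D i) \<in> {(D, E). down_closed P C D \<and> down_closed P C E \<and> D \<subset> E}"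
  then obtain D :: "nat \<Rightarrow> 'a set" where D: "\<And>i. down_closed P C (D i)" "\<And>i. D (Suc i) \<subset> D i"
    by blast
  have anti: "D j \<subseteq> D i" if "i \<le> j" for i j
    using lift_Suc_antimono_le[of D i j] D(2) that by blast
  have "\<forall>i. \<exists>x. x \<in> D i - D (Suc i)" using D(2) by blast
  then obtain x where x: "\<And>i. x i \<in> D i - D (Suc i)" by metis
  have xC: "x i \<in> C" for i using x D(1) by (auto simp: down_closed_def)
  obtain i j where ij: "i < j" "P (x i) (x j)" using wqo_onD[of P C x, OF assms xC] by (elim exE conjE)
  have "x j \<in> D (Suc i)" using x[of j] anti[of "Suc i" j] ij by auto
  then have "x i \<in> D (Suc i)" using D(1)[of "Suc i"] ij(2) xC by (auto simp: down_closed_def)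
  then show False using x by blast
qed

lemma in_listset_iff: "xs \<in> listset Ds \<longleftrightarrow> list_all2 (\<in>) xs Ds"
  by (induction Ds arbitrary: xs) (auto simp: set_Cons_def list_all2_Cons2)

lemma listset_Int:
  "length Ds = length Es \<Longrightarrow> listset Ds \<inter> listset Es = listset (map2 (\<inter>) Ds Es)"
  by (auto simp: in_listset_iff list_all2_conv_all_nth)

definition boxes :: "'a set set \<Rightarrow> nat \<Rightarrow> 'a list set set" where
  "boxes H m = {listset Ds | Ds. length Ds = m \<and> set Ds \<subseteq> H}"

lemma boxes_Int:
  assumes "\<And>D E. D \<in> H \<Longrightarrow> E \<in> H \<Longrightarrow> D \<inter> E \<in> H" "X \<in> boxes H m" "Y \<in> boxes H m"
  shows "X \<inter> Y \<in> boxes H m"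
proof -
  obtain Ds Es where *: "X = listset Ds" "length Ds = m" "set Ds \<subseteq> H"
    "Y = listset Es" "length Es = m" "set Es \<subseteq> H" using assms by (auto simp: boxes_def)
  have "set (map2 (\<inter>) Ds Es) \<subseteq> H"
    using * assms(1) by (auto simp: set_zip subset_iff)
  then show ?thesis using * by (auto simp: boxes_def listset_Int intro!: exI[of _ "map2 (\<inter>) Ds Es"])
qed

text \<open>Intersections are distributed over unions. The member \<open>T\<close> stands for the
  whole space and covers the empty intersection.\<close>

lemma finite_Inter_of_finite_Unions:
  assumes F: "\<And>X Y. X \<in> F \<Longrightarrow> Y \<in> F \<Longrightarrow> X \<inter> Y \<in> F" "T \<in> F"
    and I: "finite I" "\<And>i. i \<in> I \<Longrightarrow> \<exists>G. finite G \<and> G \<subseteq> F \<and> X i = \<Union>G"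
  shows "\<exists>G. finite G \<and> G \<subseteq> F \<and> T \<inter> (\<Inter>i\<in>I. X i) = \<Union>G"
  using I
proof (induction I rule: finite_induct)
  case empty
  then show ?case using F by (intro exI[of _ "{T}"]) auto
next
  case (insert i I)
  obtain G where G: "finite G" "G \<subseteq> F" "T \<inter> (\<Inter>i\<in>I. X i) = \<Union>G"
    using insert.IH[OF insert.prems] by auto
  obtain G' where G': "finite G'" "G' \<subseteq> F" "X i = \<Union>G'" using insert.prems[of i] by auto
  let ?G = "(\<lambda>(A, B). A \<inter> B) ` (G \<times> G')"
  have "T \<inter> (\<Inter>i\<in>insert i I. X i) = \<Union>G \<inter> \<Union>G'" using G(3) G'(3) by auto
  also have "\<dots> = \<Union>?G" by auto
  finally have eq: "T \<inter> (\<Inter>i\<in>insert i I. X i) = \<Union>?G" .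
  have "?G \<subseteq> F" using G(2) G'(2) F(1) by (auto simp: subset_iff)
  moreover have "finite ?G" using G(1) G'(1) by simp
  ultimately show ?case using eq by blast
qed

text \<open>The complement is generated by finitely many tuples \<open>b\<close>, and avoiding \<open>b\<close> means
  avoiding one of its entries.\<close>

lemma down_closed_tuples_finite_Union_boxes:
  assumes wqo: "wqo_on P C"
    and trans: "\<And>x y z. x \<in> C \<Longrightarrow> y \<in> C \<Longrightarrow> z \<in> C \<Longrightarrow> P x y \<Longrightarrow> P y z \<Longrightarrow> P x z"
    and X: "down_closed (list_all2 P) {xs. set xs \<subseteq> C \<and> length xs = m} X"
  shows "\<exists>G. finite G \<and> G \<subseteq> boxes {D. down_closed P C D} m \<and> X = \<Union>G"
proof -
  let ?L = "{xs. set xs \<subseteq> C \<and> length xs = m}" and ?H = "{D. down_closed P C D}"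
  obtain B where B: "finite B" "B \<subseteq> ?L - X" "\<And>u. u \<in> ?L - X \<Longrightarrow> \<exists>b\<in>B. list_all2 P b u"
    using wqo_on_finite_basis[OF wqo_on_lists[OF wqo, of m], of "?L - X"] by blast
  define avoid where "avoid b = {xs \<in> ?L. \<not> list_all2 P b xs}" for b
  have top: "listset (replicate m C) = ?L"
    by (auto simp: in_listset_iff list_all2_conv_all_nth subset_code(1) all_set_conv_all_nth)
  have "X = ?L \<inter> (\<Inter>b\<in>B. avoid b)"
  proof (intro set_eqI iffI)
    fix xs assume xs: "xs \<in> X"
    then have "xs \<in> ?L" using X by (auto simp: down_closed_def)
    moreover have "\<not> list_all2 P b xs" if "b \<in> B" for b
      using X B(2) that xs unfolding down_closed_def by blast
    ultimately show "xs \<in> ?L \<inter> (\<Inter>b\<in>B. avoid b)" by (auto simp: avoid_def)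
  next
    fix xs assume "xs \<in> ?L \<inter> (\<Inter>b\<in>B. avoid b)"
    then show "xs \<in> X" using B(3)[of xs] by (auto simp: avoid_def)
  qed
  also have "\<exists>G. finite G \<and> G \<subseteq> boxes ?H m \<and> ?L \<inter> (\<Inter>b\<in>B. avoid b) = \<Union>G"
  proof (rule finite_Inter_of_finite_Unions)
    show "X \<inter> Y \<in> boxes ?H m" if "X \<in> boxes ?H m" "Y \<in> boxes ?H m" for X Y
      using that by (intro boxes_Int) (auto intro: down_closed_Int)
    show "?L \<in> boxes ?H m" unfolding boxes_def top[symmetric]
      by (auto intro!: exI[of _ "replicate m C"] simp: down_closed_self)
    show "finite B" by fact
    fix b assume b: "b \<in> B"
    define side where "side p = listset ((replicate m C)[p := {y\<in>C. \<not> P (b ! p) y}])" for p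
    have bC: "set b \<subseteq> C" and len: "length b = m" using b B(2) by auto
    have nthC: "b ! p \<in> C" if "p < m" for p using bC len that nth_mem[of p b] by auto
    have side: "xs \<in> side p \<longleftrightarrow> xs \<in> ?L \<and> \<not> P (b ! p) (xs ! p)" if "p < m" for xs p
    proof -
      have nth: "(replicate m C)[p := {y\<in>C. \<not> P (b ! p) y}] ! i =
          (if i = p then {y\<in>C. \<not> P (b ! p) y} else C)" if "i < m" for i
        using that by (simp add: nth_list_update)
      have "xs \<in> side p \<longleftrightarrow> length xs = m \<and> (\<forall>i<m. xs ! i \<in> (if i = p then {y\<in>C. \<not> P (b ! p) y} else C))"
        unfolding side_def in_listset_iff list_all2_conv_all_nth
        by (simp only: length_list_update length_replicate nth cong: imp_cong conj_cong)
      moreover have "xs \<in> ?L \<longleftrightarrow> length xs = m \<and> (\<forall>i<m. xs ! i \<in> C)"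
        unfolding top[symmetric] in_listset_iff list_all2_conv_all_nth by (simp cong: conj_cong)
      moreover have "(\<forall>i<m. xs ! i \<in> (if i = p then {y\<in>C. \<not> P (b ! p) y} else C)) \<longleftrightarrow>
          (\<forall>i<m. xs ! i \<in> C) \<and> \<not> P (b ! p) (xs ! p)"
        using that by auto
      ultimately show ?thesis by argo
    qed
    have "avoid b = \<Union>(side ` {..<m})"
      using len by (auto simp: avoid_def side list_all2_conv_all_nth)
    moreover have "side p \<in> boxes ?H m" if "p < m" for p
    proof -
      \<comment> \<open>Transitivity enters here: if \<open>b ! p\<close> is not below
        \<open>y\<close>, it is not below anything smaller either.\<close>
      have "down_closed P C {y\<in>C. \<not> P (b ! p) y}"
        using trans[OF nthC[OF that]] unfolding down_closed_def by blast
      then have "set ((replicate m C)[p := {y\<in>C. \<not> P (b ! p) y}]) \<subseteq> ?H"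
        by (intro set_update_subsetI) (auto simp: down_closed_self)
      then show ?thesis unfolding side_def boxes_def
        by (auto intro!: exI[of _ "(replicate m C)[p := {y\<in>C. \<not> P (b ! p) y}]"])
    qed
    ultimately show "\<exists>G. finite G \<and> G \<subseteq> boxes ?H m \<and> avoid b = \<Union>G"
      by (intro exI[of _ "side ` {..<m}"]) auto
  qed
  finally show ?thesis .
qed

section \<open>Canonical structures\<close>

type_synonym 'c cstr = "nat \<times> (nat \<Rightarrow> nat \<Rightarrow> 'c)"

definition enum :: "'a::linorder set \<Rightarrow> nat \<Rightarrow> 'a" where
  "enum S i = sorted_list_of_set S ! i"

text \<open>The element type is arbitrary because components are taken from sets of numbers, while
  inflations live on lexicographically ordered pairs.\<close>

definition canon :: "'a::linorder set \<Rightarrow> ('a \<Rightarrow> 'a \<Rightarrow> 'c) \<Rightarrow> 'c cstr" where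
  "canon S c = (card S, \<lambda>i j. if i < j \<and> j < card S then c (enum S i) (enum S j) else undefined)"

text \<open>A fixed value off the relevant pairs makes equality in HOL coincide with sameness of
  structures, so that isomorphism can become equality.\<close>

definition well_formed :: "'c cstr \<Rightarrow> bool" where
  "well_formed A \<longleftrightarrow> (\<forall>i j. \<not> (i < j \<and> j < fst A) \<longrightarrow> snd A i j = undefined)"

lemma fst_canon [simp]: "fst (canon S c) = card S"
  by (simp add: canon_def)

lemma snd_canon: "i < j \<Longrightarrow> j < card S \<Longrightarrow> snd (canon S c) i j = c (enum S i) (enum S j)"
  by (simp add: canon_def)

lemma well_formed_canon [simp]: "well_formed (canon S c)"
  by (auto simp: canon_def well_formed_def)

lemma well_formed_eqI:
  assumes "well_formed A" "well_formed B" "fst A = fst B"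
    and "\<And>i j. i < j \<Longrightarrow> j < fst A \<Longrightarrow> snd A i j = snd B i j"
  shows "A = B"
proof (rule prod_eqI)
  show "snd A = snd B"
  proof (intro ext)
    fix i j show "snd A i j = snd B i j"
      using assms by (cases "i < j \<and> j < fst A") (auto simp: well_formed_def)
  qed
qed fact

lemma enum_strict_mono: "finite S \<Longrightarrow> i < j \<Longrightarrow> j < card S \<Longrightarrow> enum S i < enum S j"
  unfolding enum_def using strict_sorted_list_of_set[of S]
  by (auto simp: sorted_wrt_iff_nth_less)

lemma enum_in: "finite S \<Longrightarrow> i < card S \<Longrightarrow> enum S i \<in> S"
  unfolding enum_def by (metis length_sorted_list_of_set nth_mem set_sorted_list_of_set)

lemma enum_strict_mono_on: "finite S \<Longrightarrow> strict_mono_on {..<card S} (enum S)"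
  by (auto simp: strict_mono_on_def enum_strict_mono)

lemma enum_image: "finite S \<Longrightarrow> enum S ` {..<card S} = S"
  unfolding enum_def
  by (metis length_sorted_list_of_set list.set_map map_nth set_sorted_list_of_set set_upt atLeast0LessThan)

lemma enum_surj: "finite S \<Longrightarrow> x \<in> S \<Longrightarrow> \<exists>i<card S. enum S i = x"
  by (subst (asm) (2) enum_image[symmetric]) auto

lemma strict_mono_on_less:
  fixes f :: "'a::linorder \<Rightarrow> 'b::linorder"
  shows "strict_mono_on S f \<Longrightarrow> x \<in> S \<Longrightarrow> y \<in> S \<Longrightarrow> f x < f y \<longleftrightarrow> x < y"
  by (metis less_irrefl less_trans linorder_cases strict_mono_onD)

lemma strict_mono_on_lessThan_ge:
  fixes f :: "nat \<Rightarrow> nat"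
  assumes "strict_mono_on {..<n} f" "i < n"
  shows "i \<le> f i"
  using assms(2)
proof (induction i)
  case (Suc i)
  then have "i \<le> f i" "f i < f (Suc i)" using assms(1) by (auto simp: strict_mono_on_def)
  then show ?case by simp
qed simp

text \<open>Rigidity of finite linear orders: strictness pushes \<open>f i\<close> up to at least
  \<open>i\<close> from the bottom and, read from the top end, down to at most
  \<open>i\<close>.\<close>

lemma strict_mono_on_lessThan_id:
  fixes f :: "nat \<Rightarrow> nat"
  assumes f: "strict_mono_on {..<n} f" "f ` {..<n} \<subseteq> {..<n}" and "i < n"
  shows "f i = i"
proof -
  have "f (n - Suc k) \<le> n - Suc k" if "k < n" for k
    using that
  proof (induction k)
    case 0
    then have "f (n - Suc 0) \<in> {..<n}" using f(2) by (auto simp: image_subset_iff)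
    then show ?case by simp
  next
    case (Suc k)
    then have "f (n - Suc (Suc k)) < f (n - Suc k)"
      using f(1) by (auto simp: strict_mono_on_def)
    then show ?case using Suc by simp
  qed
  from this[of "n - Suc i"] strict_mono_on_lessThan_ge[OF f(1) \<open>i < n\<close>] \<open>i < n\<close>
  show ?thesis by simp
qed

text \<open>Following \<open>f\<close> by the inverse of \<open>g\<close> gives a strictly
  increasing self-map of an initial segment, hence the identity.\<close>

lemma strict_mono_on_bij_unique:
  fixes f g :: "nat \<Rightarrow> 'b::linorder"
  assumes f: "strict_mono_on {..<n} f" "f ` {..<n} = T"
    and g: "strict_mono_on {..<n} g" "g ` {..<n} = T" and "i < n"
  shows "f i = g i"
proof -
  have inj: "inj_on g {..<n}" using g(1) strict_mono_on_imp_inj_on by blast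
  define h where "h i = the_inv_into {..<n} g (f i)" for i
  have h: "h i < n" "g (h i) = f i" if "i < n" for i
  proof -
    have "f i \<in> g ` {..<n}" using f(2) g(2) that by blast
    then show "h i < n" "g (h i) = f i"
      unfolding h_def using the_inv_into_into[OF inj, of "f i" "{..<n}"] f_the_inv_into_f[OF inj] by auto
  qed
  have "strict_mono_on {..<n} h"
  proof (rule strict_mono_onI)
    fix r s assume rs: "r \<in> {..<n}" "s \<in> {..<n}" "r < s"
    then have "g (h r) < g (h s)" using h f(1) by (simp add: strict_mono_on_def)
    then show "h r < h s"
      using strict_mono_on_less[OF g(1), of "h r" "h s"] h(1)[of r] h(1)[of s] rs by simp
  qed
  moreover have "h ` {..<n} \<subseteq> {..<n}" using h(1) by auto
  ultimately have "h i = i" by (rule strict_mono_on_lessThan_id[OF _ _ \<open>i < n\<close>])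
  then show ?thesis using h(2)[OF \<open>i < n\<close>] by simp
qed

lemma strict_mono_on_compose:
  "strict_mono_on S f \<Longrightarrow> f ` S \<subseteq> T \<Longrightarrow> strict_mono_on T g \<Longrightarrow> strict_mono_on S (\<lambda>x. g (f x))"
  by (auto simp: strict_mono_on_def image_subset_iff)

lemma enum_image_strict_mono:
  assumes "finite S" "strict_mono_on S f" "f ` S = T" "i < card S"
  shows "enum T i = f (enum S i)"
proof -
  have inj: "inj_on f S" using assms(2) strict_mono_on_imp_inj_on by blast
  then have c: "card T = card S" using assms(3) card_image by blast
  have "finite T" using assms by auto
  show ?thesis
  proof (rule strict_mono_on_bij_unique[of "card S" _ T])
    show "strict_mono_on {..<card S} (enum T)" "enum T ` {..<card S} = T"
      using enum_strict_mono_on[OF \<open>finite T\<close>] enum_image[OF \<open>finite T\<close>] c by auto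
    show "strict_mono_on {..<card S} (\<lambda>i. f (enum S i))"
      using strict_mono_on_compose[OF enum_strict_mono_on[OF assms(1)] _ assms(2)]
        enum_image[OF assms(1)] by simp
    show "(\<lambda>i. f (enum S i)) ` {..<card S} = T"
      using enum_image[OF assms(1)] assms(3) by (metis image_image)
  qed fact
qed

lemma canon_eqI:
  assumes "finite S" "strict_mono_on S f" "f ` S = T"
    and col: "\<And>x y. x \<in> S \<Longrightarrow> y \<in> S \<Longrightarrow> x < y \<Longrightarrow> c x y = d (f x) (f y)"
  shows "canon S c = canon T d"
proof -
  have "inj_on f S" using assms(2) strict_mono_on_imp_inj_on by blast
  then have c: "card T = card S" using assms(3) card_image by blast
  show ?thesis
  proof (rule well_formed_eqI)
    fix i j assume "i < j" "j < fst (canon S c)"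
    then show "snd (canon S c) i j = snd (canon T d) i j"
      using c assms by (simp add: snd_canon enum_image_strict_mono col enum_in enum_strict_mono)
  qed (use c in auto)
qed

lemma enum_lessThan: "i < n \<Longrightarrow> enum {..<n} i = i"
  using enum_image_strict_mono[of "{..<n}" "\<lambda>i. i" "{..<n}" i]
    strict_mono_on_lessThan_id[of n "enum {..<n}" i]
  by (metis card_lessThan enum_image enum_strict_mono_on finite_lessThan order_refl)

lemma canon_lessThan: "well_formed A \<Longrightarrow> canon {..<fst A} (snd A) = A"
  by (rule well_formed_eqI) (auto simp: snd_canon enum_lessThan)

lemma snd_canon_lessThan: "i < j \<Longrightarrow> j < n \<Longrightarrow> snd (canon {..<n} c) i j = c i j"
  by (simp add: snd_canon enum_lessThan)

section \<open>Embeddings of canonical structures\<close>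

definition cemb :: "'c cstr \<Rightarrow> 'c cstr \<Rightarrow> bool" where
  "cemb A B \<longleftrightarrow> (\<exists>f. strict_mono_on {..<fst A} f \<and> f ` {..<fst A} \<subseteq> {..<fst B} \<and>
     (\<forall>i j. i < j \<and> j < fst A \<longrightarrow> snd A i j = snd B (f i) (f j)))"

lemma cemb_trans:
  assumes "cemb A B" "cemb B C" shows "cemb A C"
proof -
  obtain f where f: "strict_mono_on {..<fst A} f" "f ` {..<fst A} \<subseteq> {..<fst B}"
     "\<And>i j. i < j \<and> j < fst A \<Longrightarrow> snd A i j = snd B (f i) (f j)" using assms(1) unfolding cemb_def by auto
  obtain g where g: "strict_mono_on {..<fst B} g" "g ` {..<fst B} \<subseteq> {..<fst C}"
     "\<And>i j. i < j \<and> j < fst B \<Longrightarrow> snd B i j = snd C (g i) (g j)" using assms(2) unfolding cemb_def by auto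
  have "strict_mono_on {..<fst A} (\<lambda>x. g (f x))" by (rule strict_mono_on_compose[OF f(1,2) g(1)])
  moreover have "(\<lambda>x. g (f x)) ` {..<fst A} \<subseteq> {..<fst C}" using f(2) g(2) by blast
  moreover have "snd A i j = snd C (g (f i)) (g (f j))" if "i < j \<and> j < fst A" for i j
  proof -
    have "f i < f j \<and> f j < fst B" using f(1,2) that by (auto simp: strict_mono_on_def)
    then show ?thesis using f(3)[OF that] g(3) by simp
  qed
  ultimately show ?thesis unfolding cemb_def by (intro exI[of _ "\<lambda>x. g (f x)"]) simp
qed

text \<open>Such an embedding is a strictly increasing self-map, hence the identity. So distinct
  structures of one size are incomparable.\<close>

lemma cemb_same_size_eq:
  assumes "cemb A B" "well_formed A" "well_formed B" "fst A = fst B"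
  shows "A = B"
proof -
  obtain f where f: "strict_mono_on {..<fst A} f" "f ` {..<fst A} \<subseteq> {..<fst A}"
     "\<And>i j. i < j \<and> j < fst A \<Longrightarrow> snd A i j = snd B (f i) (f j)"
    using assms unfolding cemb_def by auto
  have "f i = i" if "i < fst A" for i using strict_mono_on_lessThan_id[OF f(1,2) that] .
  then show ?thesis using f(3) assms by (intro well_formed_eqI) auto
qed

lemma cemb_canonI:
  fixes S :: "'a::linorder set" and T :: "'b::linorder set"
  assumes S: "finite S" and T: "finite T" and f: "strict_mono_on S f" "f ` S \<subseteq> T"
    and col: "\<And>x y. x \<in> S \<Longrightarrow> y \<in> S \<Longrightarrow> x < y \<Longrightarrow> c x y = d (f x) (f y)"
  shows "cemb (canon S c) (canon T d)"
proof -
  \<comment> \<open>The map \<open>f\<close>, read on positions instead of elements.\<close>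
  let ?g = "\<lambda>i. the_inv_into {..<card T} (enum T) (f (enum S i))"
  have inj: "inj_on (enum T) {..<card T}"
    using enum_strict_mono_on[OF T] strict_mono_on_imp_inj_on by blast
  have g: "?g i < card T" "enum T (?g i) = f (enum S i)" if "i < card S" for i
  proof -
    have "f (enum S i) \<in> enum T ` {..<card T}"
      using f(2) enum_in[OF S that] enum_image[OF T] by blast
    then show "?g i < card T" "enum T (?g i) = f (enum S i)"
      using the_inv_into_into[OF inj, of "f (enum S i)" "{..<card T}"] f_the_inv_into_f[OF inj] by auto
  qed
  have mono: "?g i < ?g j" if "i < j" "j < card S" for i j
  proof -
    have "f (enum S i) < f (enum S j)"
      using that f(1) enum_strict_mono[OF S that] enum_in[OF S] by (auto simp: strict_mono_on_def)
    then have "enum T (?g i) < enum T (?g j)" using g that by simp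
    then show ?thesis
      using strict_mono_on_less[OF enum_strict_mono_on[OF T], of "?g i" "?g j"] g(1)[of i] g(1)[of j] that
      by simp
  qed
  show ?thesis unfolding cemb_def fst_canon
  proof (intro exI[of _ ?g] conjI allI impI)
    show "strict_mono_on {..<card S} ?g" using mono by (auto simp: strict_mono_on_def)
    show "?g ` {..<card S} \<subseteq> {..<card T}" using g by auto
    fix i j assume ij: "i < j \<and> j < card S"
    then have "snd (canon S c) i j = d (f (enum S i)) (f (enum S j))"
      by (simp add: snd_canon col enum_in enum_strict_mono S)
    also have "\<dots> = snd (canon T d) (?g i) (?g j)"
      using ij g mono by (simp add: snd_canon)
    finally show "snd (canon S c) i j = snd (canon T d) (?g i) (?g j)" .
  qed
qed

subsection \<open>Inflations\<close>

text \<open>A point is a pair of block index and position in the block. Under the lexicographic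
  order the blocks become consecutive segments.\<close>

definition infl_carrier :: "'c cstr list \<Rightarrow> (nat \<times> nat) set" where
  "infl_carrier As = (SIGMA p:{..<length As}. {..<fst (As ! p)})"

definition infl_col :: "'c cstr \<Rightarrow> 'c cstr list \<Rightarrow> nat \<times> nat \<Rightarrow> nat \<times> nat \<Rightarrow> 'c" where
  "infl_col \<sigma> As = (\<lambda>(p, i) (q, j). if p = q then snd (As ! p) i j else snd \<sigma> p q)"

definition infl :: "'c cstr \<Rightarrow> 'c cstr list \<Rightarrow> 'c cstr" where
  "infl \<sigma> As = canon (infl_carrier As) (infl_col \<sigma> As)"

lemma finite_infl_carrier [simp]: "finite (infl_carrier As)"
  by (auto simp: infl_carrier_def)

lemma well_formed_infl [simp]: "well_formed (infl \<sigma> As)"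
  by (simp add: infl_def)

lemma fst_infl: "fst (infl \<sigma> As) = sum_list (map fst As)"
proof -
  have "card (infl_carrier As) = (\<Sum>p<length As. fst (As ! p))"
    unfolding infl_carrier_def by (subst card_SigmaI) auto
  then show ?thesis by (simp add: infl_def sum_list_sum_nth atLeast0LessThan)
qed

lemma cemb_canonI_lessThan:
  assumes "well_formed A" "finite T" "strict_mono_on {..<fst A} f" "f ` {..<fst A} \<subseteq> T"
    and "\<And>i j. i < j \<Longrightarrow> j < fst A \<Longrightarrow> snd A i j = d (f i) (f j)"
  shows "cemb A (canon T d)"
  using cemb_canonI[of "{..<fst A}" T f "snd A" d] assms by (simp add: canon_lessThan)

lemma cemb_component:
  assumes "well_formed (As ! p)" "p < length As"
  shows "cemb (As ! p) (infl \<sigma> As)"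
  unfolding infl_def
  by (rule cemb_canonI_lessThan[of _ _ "\<lambda>i. (p, i)"])
    (use assms in \<open>auto simp: strict_mono_on_def infl_carrier_def infl_col_def\<close>)

lemma cemb_quotient:
  assumes "well_formed \<sigma>" "fst \<sigma> = length As" "\<forall>A\<in>set As. fst A > 0"
  shows "cemb \<sigma> (infl \<sigma> As)"
  unfolding infl_def
  \<comment> \<open>The first point of each block represents it; it exists because the blocks are
    nonempty.\<close>
  by (rule cemb_canonI_lessThan[of _ _ "\<lambda>p. (p, 0)"])
    (use assms in \<open>auto simp: strict_mono_on_def infl_carrier_def infl_col_def\<close>)

lemma cemb_infl_mono:
  assumes "list_all2 cemb As Bs"
  shows "cemb (infl \<sigma> As) (infl \<sigma> Bs)"
proof -
  have len: "length As = length Bs" using assms list_all2_lengthD by blast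
  have "\<forall>p. \<exists>f. p < length As \<longrightarrow> strict_mono_on {..<fst (As ! p)} f \<and>
      f ` {..<fst (As ! p)} \<subseteq> {..<fst (Bs ! p)} \<and>
      (\<forall>i j. i < j \<and> j < fst (As ! p) \<longrightarrow> snd (As ! p) i j = snd (Bs ! p) (f i) (f j))"
    using assms unfolding list_all2_conv_all_nth cemb_def by simp
  then obtain F where F: "\<forall>p. p < length As \<longrightarrow> strict_mono_on {..<fst (As ! p)} (F p) \<and>
      F p ` {..<fst (As ! p)} \<subseteq> {..<fst (Bs ! p)} \<and>
      (\<forall>i j. i < j \<and> j < fst (As ! p) \<longrightarrow> snd (As ! p) i j = snd (Bs ! p) (F p i) (F p j))"
    by (rule choice[THEN exE])
  show ?thesis unfolding infl_def
  proof (rule cemb_canonI[of _ _ "\<lambda>(p, i). (p, F p i)"])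
    show "strict_mono_on (infl_carrier As) (\<lambda>(p, i). (p, F p i))"
      using F by (fastforce simp: strict_mono_on_def infl_carrier_def)
    show "(\<lambda>(p, i). (p, F p i)) ` infl_carrier As \<subseteq> infl_carrier Bs"
      using F len by (fastforce simp: infl_carrier_def)
    show "infl_col \<sigma> As x y = infl_col \<sigma> Bs ((\<lambda>(p, i). (p, F p i)) x) ((\<lambda>(p, i). (p, F p i)) y)"
      if "x \<in> infl_carrier As" "y \<in> infl_carrier As" "x < y" for x y
      using that F by (cases x; cases y) (auto simp: infl_carrier_def infl_col_def)
  qed auto
qed

subsection \<open>Quotients\<close>

text \<open>A congruence, given by its projection \<open>q\<close> onto the quotient. Monotonicity
  makes the fibres segments, so \<open>q\<close> is known once it is known where it jumps.\<close>

definition quot :: "'c cstr \<Rightarrow> 'c cstr \<Rightarrow> (nat \<Rightarrow> nat) \<Rightarrow> bool" where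
  "quot R \<sigma> q \<longleftrightarrow> mono_on {..<fst R} q \<and> q ` {..<fst R} = {..<fst \<sigma>} \<and>
     (\<forall>i j. i < j \<and> j < fst R \<and> q i < q j \<longrightarrow> snd R i j = snd \<sigma> (q i) (q j))"

definition block :: "'c cstr \<Rightarrow> (nat \<Rightarrow> nat) \<Rightarrow> nat \<Rightarrow> nat set" where
  "block R q p = {i. i < fst R \<and> q i = p}"

definition comps :: "'c cstr \<Rightarrow> 'c cstr \<Rightarrow> (nat \<Rightarrow> nat) \<Rightarrow> 'c cstr list" where
  "comps R \<sigma> q = map (\<lambda>p. canon (block R q p) (snd R)) [0..<fst \<sigma>]"

lemma finite_block [simp]: "finite (block R q p)"
  by (simp add: block_def)

lemma length_comps [simp]: "length (comps R \<sigma> q) = fst \<sigma>"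
  by (simp add: comps_def)

lemma nth_comps [simp]: "p < fst \<sigma> \<Longrightarrow> comps R \<sigma> q ! p = canon (block R q p) (snd R)"
  by (simp add: comps_def)

lemma quot_mono: "quot R \<sigma> q \<Longrightarrow> i \<le> j \<Longrightarrow> j < fst R \<Longrightarrow> q i \<le> q j"
  unfolding quot_def by (auto simp: mono_on_def)

lemma quot_less: "quot R \<sigma> q \<Longrightarrow> q i < q j \<Longrightarrow> i < fst R \<Longrightarrow> i < j"
  by (meson leD leI quot_mono)

lemma quot_col: "quot R \<sigma> q \<Longrightarrow> j < fst R \<Longrightarrow> i < fst R \<Longrightarrow> q i < q j \<Longrightarrow> snd R i j = snd \<sigma> (q i) (q j)"
  using quot_less[of R \<sigma> q i j] unfolding quot_def by simp

lemma quot_bound: "quot R \<sigma> q \<Longrightarrow> i < fst R \<Longrightarrow> q i < fst \<sigma>"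
  unfolding quot_def by blast

lemma quot_surj: "quot R \<sigma> q \<Longrightarrow> p < fst \<sigma> \<Longrightarrow> \<exists>i<fst R. q i = p"
  unfolding quot_def by (metis imageE lessThan_iff)

lemma comps_nonempty:
  assumes "quot R \<sigma> q" "A \<in> set (comps R \<sigma> q)"
  shows "fst A > 0" "well_formed A"
proof -
  obtain p where p: "p < fst \<sigma>" "A = canon (block R q p) (snd R)"
    using assms(2) by (auto simp: comps_def)
  obtain i where "i < fst R" "q i = p" using quot_surj[OF assms(1) p(1)] by blast
  then have "i \<in> block R q p" by (simp add: block_def)
  then have "card (block R q p) > 0" using card_gt_0_iff finite_block by blast
  then show "fst A > 0" "well_formed A" using p by auto
qed

lemma infl_comps:
  assumes wf: "well_formed R" and q: "quot R \<sigma> q"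
  shows "infl \<sigma> (comps R \<sigma> q) = R"
proof -
  let ?e = "\<lambda>(p, i). enum (block R q p) i"
  let ?S = "infl_carrier (comps R \<sigma> q)"
  have S: "(p, i) \<in> ?S \<longleftrightarrow> p < fst \<sigma> \<and> i < card (block R q p)" for p i
    by (auto simp: infl_carrier_def)
  have e: "?e (p, i) < fst R" "q (?e (p, i)) = p" if "(p, i) \<in> ?S" for p i
    using enum_in[of "block R q p" i] that by (auto simp: S block_def)
  have "canon ?S (infl_col \<sigma> (comps R \<sigma> q)) = canon {..<fst R} (snd R)"
  proof (rule canon_eqI[of _ ?e])
    show "strict_mono_on ?S ?e"
    proof (rule strict_mono_onI)
      fix x y assume xy: "x \<in> ?S" "y \<in> ?S" "x < y"
      obtain p i p' j where p: "x = (p, i)" "y = (p', j)" by (cases x, cases y)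
      show "?e x < ?e y"
      proof (cases "p = p'")
        case True
        then show ?thesis using xy p by (simp add: S enum_strict_mono)
      next
        case False
        then have "p < p'" using xy(3) p by auto
        then show ?thesis using quot_less[OF q, of "?e x" "?e y"] e xy p by auto
      qed
    qed
    show "?e ` ?S = {..<fst R}"
    proof (intro equalityI subsetI)
      fix k assume "k \<in> {..<fst R}"
      then have k: "k \<in> block R q (q k)" "q k < fst \<sigma>" using quot_bound[OF q] by (auto simp: block_def)
      obtain i where "i < card (block R q (q k))" "enum (block R q (q k)) i = k"
        using enum_surj[OF finite_block k(1)] by blast
      then show "k \<in> ?e ` ?S" using k(2) by (intro image_eqI[of _ _ "(q k, i)"]) (auto simp: S)
    qed (use e in auto)
    fix x y assume xy: "x \<in> ?S" "y \<in> ?S" "x < y"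
    obtain p i p' j where p: "x = (p, i)" "y = (p', j)" by (cases x, cases y)
    show "infl_col \<sigma> (comps R \<sigma> q) x y = snd R (?e x) (?e y)"
    proof (cases "p = p'")
      case True
      then show ?thesis using xy p by (simp add: S infl_col_def snd_canon)
    next
      case False
      then have "p < p'" using xy(3) p by auto
      then show ?thesis using quot_col[OF q, of "?e y" "?e x"] e xy p by (simp add: infl_col_def)
    qed
  qed simp
  then show ?thesis by (simp add: infl_def canon_lessThan[OF wf])
qed

text \<open>With \<open>infl_comps\<close>, this identifies inflations by nonempty components with
  quotients, so that uniqueness can be proved for the projections.\<close>

lemma quot_infl:
  assumes len: "fst \<sigma> = length As" and As: "\<forall>A\<in>set As. fst A > 0 \<and> well_formed A"
  obtains q where "quot (infl \<sigma> As) \<sigma> q" "comps (infl \<sigma> As) \<sigma> q = As"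
proof -
  let ?S = "infl_carrier As" and ?R = "infl \<sigma> As"
  let ?e = "enum ?S"
  \<comment> \<open>The block index of the \<open>i\<close>-th pair in lexicographic order.\<close>
  define q where "q i = fst (?e i)" for i
  have n: "fst ?R = card ?S" by (simp add: infl_def)
  have S: "(p, i) \<in> ?S \<longleftrightarrow> p < length As \<and> i < fst (As ! p)" for p i
    by (auto simp: infl_carrier_def)
  have e: "?e i \<in> ?S" if "i < fst ?R" for i using that enum_in[of ?S i] n by simp
  have less: "?e i < ?e j" if "i < j" "j < fst ?R" for i j using enum_strict_mono[of ?S i j] that n by simp
  have col: "snd ?R i j = infl_col \<sigma> As (?e i) (?e j)" if "i < j" "j < fst ?R" for i j
    using that n by (simp add: infl_def snd_canon)
  have mono: "q i \<le> q j" if "i \<le> j" "j < fst ?R" for i j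
    using less[of i j] that by (cases "i = j") (auto simp: q_def less_prod_def)
  have quot: "quot ?R \<sigma> q" unfolding quot_def
  proof (intro conjI allI impI)
    show "mono_on {..<fst ?R} q" using mono by (auto simp: mono_on_def)
    show "q ` {..<fst ?R} = {..<fst \<sigma>}"
    proof (intro equalityI subsetI)
      fix p assume "p \<in> q ` {..<fst ?R}"
      then show "p \<in> {..<fst \<sigma>}" using e len by (force simp: q_def infl_carrier_def)
    next
      fix p assume p: "p \<in> {..<fst \<sigma>}"
      then have "(p, 0) \<in> ?S" using As len by (auto simp: S)
      then obtain i where "i < card ?S" "?e i = (p, 0)" using enum_surj[of ?S] by force
      then show "p \<in> q ` {..<fst ?R}" using n by (intro image_eqI[of _ _ i]) (auto simp: q_def)
    qed
    fix i j assume ij: "i < j \<and> j < fst ?R \<and> q i < q j"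
    then show "snd ?R i j = snd \<sigma> (q i) (q j)"
      using col[of i j] by (auto simp: q_def infl_col_def split: prod.splits)
  qed
  have "comps ?R \<sigma> q ! p = As ! p" if p: "p < length As" for p
  proof -
    let ?B = "block ?R q p"
    have B: "i \<in> ?B \<longleftrightarrow> i < fst ?R \<and> (\<exists>k. ?e i = (p, k))" for i
      by (cases "?e i") (auto simp: block_def q_def)
    have "canon ?B (snd ?R) = canon {..<fst (As ! p)} (snd (As ! p))"
    proof (rule canon_eqI[of _ "\<lambda>i. snd (?e i)"])
      show "strict_mono_on ?B (\<lambda>i. snd (?e i))"
      proof (rule strict_mono_onI)
        fix r s assume "r \<in> ?B" "s \<in> ?B" "r < s"
        then show "snd (?e r) < snd (?e s)" using less[of r s] by (auto simp: B)
      qed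
      show "(\<lambda>i. snd (?e i)) ` ?B = {..<fst (As ! p)}"
      proof (intro equalityI subsetI)
        fix k assume "k \<in> (\<lambda>i. snd (?e i)) ` ?B"
        then obtain i where "i < fst ?R" "?e i = (p, k)" by (auto simp: B)
        then show "k \<in> {..<fst (As ! p)}" using e[of i] by (simp add: S)
      next
        fix k assume "k \<in> {..<fst (As ! p)}"
        then have "(p, k) \<in> ?S" using p by (simp add: S)
        then obtain i where "i < card ?S" "?e i = (p, k)" using enum_surj[of ?S] by force
        then show "k \<in> (\<lambda>i. snd (?e i)) ` ?B" using n by (intro image_eqI[of _ _ i]) (auto simp: B)
      qed
      fix x y assume "x \<in> ?B" "y \<in> ?B" "x < y"
      then show "snd ?R x y = snd (As ! p) (snd (?e x)) (snd (?e y))"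
        using col[of x y] by (auto simp: B infl_col_def)
    qed simp
    also have "\<dots> = As ! p" using As p by (intro canon_lessThan) auto
    finally show ?thesis using p len by simp
  qed
  then have "comps ?R \<sigma> q = As" using len by (intro nth_equalityI) auto
  with quot show ?thesis by (rule that)
qed

subsection \<open>Indecomposable structures\<close>

text \<open>Intervals are in particular order intervals, so segments suffice.\<close>

definition segment_interval :: "'c cstr \<Rightarrow> nat \<Rightarrow> nat \<Rightarrow> bool" where
  "segment_interval \<sigma> a b \<longleftrightarrow>
     (\<forall>x y. x < a \<and> a \<le> y \<and> y \<le> b \<longrightarrow> snd \<sigma> x y = snd \<sigma> x a) \<and>
     (\<forall>x y. b < x \<and> x < fst \<sigma> \<and> a \<le> y \<and> y \<le> b \<longrightarrow> snd \<sigma> y x = snd \<sigma> a x)"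

lemma segment_intervalD:
  assumes "segment_interval \<sigma> a b"
  shows "x < a \<Longrightarrow> a \<le> y \<Longrightarrow> y \<le> b \<Longrightarrow> snd \<sigma> x y = snd \<sigma> x a"
    and "b < x \<Longrightarrow> x < fst \<sigma> \<Longrightarrow> a \<le> y \<Longrightarrow> y \<le> b \<Longrightarrow> snd \<sigma> y x = snd \<sigma> a x"
  using assms unfolding segment_interval_def by blast+

text \<open>Every structure with at most two points qualifies, also the empty one; hence the
  separate bound on the size wherever a quotient is sought.\<close>

definition cindec :: "'c cstr \<Rightarrow> bool" where
  "cindec \<sigma> \<longleftrightarrow> (\<forall>a b. a \<le> b \<and> b < fst \<sigma> \<and> segment_interval \<sigma> a b \<longrightarrow> a = b \<or> (a = 0 \<and> Suc b = fst \<sigma>))"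

lemma cindecD:
  "cindec \<sigma> \<Longrightarrow> a < b \<Longrightarrow> b < fst \<sigma> \<Longrightarrow> segment_interval \<sigma> a b \<Longrightarrow> a = 0 \<and> Suc b = fst \<sigma>"
  unfolding cindec_def by (drule spec[of _ a], drule spec[of _ b]) simp

text \<open>\<open>r\<close> contracts the segment to \<open>a\<close> and shifts what follows;
  \<open>s\<close> is its section with representative \<open>a\<close>. Replacing \<open>p\<close>
  by \<open>s (r p)\<close> moves only the points of the segment after \<open>a\<close>.\<close>

lemma quot_collapse:
  assumes q: "quot R \<sigma> q" and ab: "a < b" "b < fst \<sigma>" and int: "segment_interval \<sigma> a b"
  defines "r \<equiv> \<lambda>p. if p \<le> a then p else if p \<le> b then a else p - (b - a)"
    and "s \<equiv> \<lambda>u. if u \<le> a then u else u + (b - a)"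
  shows "quot R (canon {..<fst \<sigma> - (b - a)} (\<lambda>u v. snd \<sigma> (s u) (s v))) (\<lambda>i. r (q i))"
proof -
  let ?m = "fst \<sigma> - (b - a)"
  have r_mono: "r p \<le> r p'" if "p \<le> p'" for p p' using that ab by (auto simp: r_def)
  have r_bound: "r p < ?m" if "p < fst \<sigma>" for p using that ab by (auto simp: r_def)
  have rs: "r (s u) = u" for u using ab by (auto simp: r_def s_def)
  have s_bound: "s u < fst \<sigma>" if "u < ?m" for u using that ab by (auto simp: s_def split: if_splits)
  have sr: "s (r p) = (if a < p \<and> p \<le> b then a else p)" for p using ab by (auto simp: r_def s_def)
  have col: "snd \<sigma> p p' = snd \<sigma> (s (r p)) (s (r p'))"
    if pp: "p < p'" "p' < fst \<sigma>" "r p < r p'" for p p'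
  proof -
    \<comment> \<open>At most one of the two points is moved, since \<open>r p < r p'\<close>
      excludes two points of the segment; the other one then lies outside, and the interval property
      applies.\<close>
    consider "a < p" "p \<le> b" "b < p'" | "p < a" "a < p'" "p' \<le> b" |
      "\<not> (a < p \<and> p \<le> b)" "\<not> (a < p' \<and> p' \<le> b)"
      using pp ab by (auto simp: r_def split: if_splits)
    then show ?thesis
    proof cases
      case 1
      then show ?thesis using segment_intervalD(2)[OF int, of p' p] pp by (simp add: sr)
    next
      case 2
      then show ?thesis using segment_intervalD(1)[OF int, of p p'] pp by (simp add: sr)
    next
      case 3
      then have "s (r p) = p" "s (r p') = p'" by (auto simp: sr)
      then show ?thesis by simp
    qed
  qed
  show ?thesis unfolding quot_def
  proof (intro conjI allI impI)
    show "mono_on {..<fst R} (\<lambda>i. r (q i))"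
      using quot_mono[OF q] r_mono by (auto simp: mono_on_def)
    show "(\<lambda>i. r (q i)) ` {..<fst R} = {..<fst (canon {..<?m} (\<lambda>u v. snd \<sigma> (s u) (s v)))}"
    proof (intro equalityI subsetI)
      fix u assume "u \<in> {..<fst (canon {..<?m} (\<lambda>u v. snd \<sigma> (s u) (s v)))}"
      then have "s u < fst \<sigma>" using s_bound by simp
      then obtain i where "i < fst R" "q i = s u" using quot_surj[OF q] by blast
      then show "u \<in> (\<lambda>i. r (q i)) ` {..<fst R}" using rs by (intro image_eqI[of _ _ i]) auto
    qed (use r_bound quot_bound[OF q] in auto)
    fix i j assume ij: "i < j \<and> j < fst R \<and> r (q i) < r (q j)"
    have "q i < q j" using ij r_mono[of "q j" "q i"] by (meson leD leI)
    then have "snd R i j = snd \<sigma> (q i) (q j)" using quot_col[OF q] ij by simp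
    also have "\<dots> = snd \<sigma> (s (r (q i))) (s (r (q j)))"
      using col \<open>q i < q j\<close> quot_bound[OF q] ij by simp
    finally show "snd R i j = snd (canon {..<?m} (\<lambda>u v. snd \<sigma> (s u) (s v))) (r (q i)) (r (q j))"
      using ij r_bound quot_bound[OF q] by (simp add: snd_canon_lessThan)
  qed
qed

lemma quot_collapse_exists:
  assumes "quot R \<sigma> q" "a < b" "b < fst \<sigma>" "segment_interval \<sigma> a b"
  shows "\<exists>\<tau> q'. quot R \<tau> q' \<and> well_formed \<tau> \<and> fst \<tau> = fst \<sigma> - (b - a)"
  by (intro exI conjI, rule quot_collapse[OF assms]) simp_all

text \<open>Among the quotients with at least two points, \<open>R\<close> itself being one, take a
  smallest. A nontrivial interval in it could be collapsed, and since it omits a point the result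
  would still have two points.\<close>

lemma indecomposable_quotient_exists:
  assumes "well_formed R" "2 \<le> fst R"
  obtains \<sigma> q where "well_formed \<sigma>" "2 \<le> fst \<sigma>" "cindec \<sigma>" "quot R \<sigma> q"
proof -
  let ?Q = "\<lambda>\<sigma>. well_formed \<sigma> \<and> 2 \<le> fst \<sigma> \<and> (\<exists>q. quot R \<sigma> q)"
  have "quot R R (\<lambda>i. i)" by (auto simp: quot_def mono_on_def)
  then have "?Q R" using assms by blast
  from ex_has_least_nat[of ?Q, OF this, of fst] obtain \<sigma> where
    \<sigma>: "?Q \<sigma>" "\<And>\<tau>. ?Q \<tau> \<Longrightarrow> fst \<sigma> \<le> fst \<tau>" by blast
  then obtain q where q: "quot R \<sigma> q" by blast
  have "cindec \<sigma>"
  proof (rule ccontr)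
    assume "\<not> cindec \<sigma>"
    then obtain a b where ab: "a \<le> b" "b < fst \<sigma>" "segment_interval \<sigma> a b" "a \<noteq> b"
      "\<not> (a = 0 \<and> Suc b = fst \<sigma>)" unfolding cindec_def by blast
    then have "a < b" by simp
    from quot_collapse_exists[OF q this ab(2,3)] obtain \<tau> q' where
      \<tau>: "quot R \<tau> q'" "well_formed \<tau>" "fst \<tau> = fst \<sigma> - (b - a)" by (elim exE conjE)
    then have "?Q \<tau>" using ab by auto
    then have "fst \<sigma> \<le> fst \<tau>" by (rule \<sigma>(2))
    with \<tau>(3) have "fst \<sigma> \<le> fst \<sigma> - (b - a)" by simp
    then show False using ab by auto
  qed
  then show ?thesis using \<sigma>(1) q that by blast
qed

subsection \<open>Uniqueness of quotients\<close>

text \<open>A block of the second quotient projects to an interval of \<open>\<sigma>\<close>; it cannot project onto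
  everything, since then \<open>\<sigma>\<close> minus its first or last point would be an interval.\<close>

lemma blocks_within_blocks:
  assumes q: "quot R \<sigma> q" and q': "quot R \<tau> q'" and indec: "cindec \<sigma>"
    and m: "3 \<le> fst \<sigma>" "2 \<le> fst \<tau>"
    and ij: "i < fst R" "j < fst R" "q' i = q' j"
  shows "q i = q j"
proof (rule ccontr)
  assume neq: "q i \<noteq> q j"
  define p where "p = q' i"
  define B where "B = {x. x < fst R \<and> q' x = p}"
  define P where "P = q ` B"
  have fin: "finite P" "finite B" by (auto simp: P_def B_def)
  have inP: "q i \<in> P" "q j \<in> P" using ij by (auto simp: P_def B_def p_def)
  define a where "a = Min P"
  define b where "b = Max P"
  have "P \<noteq> {}" using inP by blast
  have bounds: "a \<le> y" "y \<le> b" if "y \<in> P" for y using fin that by (auto simp: a_def b_def)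
  have ab: "a < b" using bounds[OF inP(1)] bounds[OF inP(2)] neq by linarith
  have abP: "a \<in> P" "b \<in> P" using fin \<open>P \<noteq> {}\<close> by (auto simp: a_def b_def)
  obtain ia ib where ia: "ia \<in> B" "q ia = a" and ib: "ib \<in> B" "q ib = b" using abP by (auto simp: P_def)
  have bm: "b < fst \<sigma>" using ib quot_bound[OF q] by (auto simp: B_def)
  \<comment> \<open>\<open>P\<close> has no gaps: a point of \<open>R\<close> that projects strictly
    between \<open>a\<close> and \<open>b\<close> lies between two points of \<open>B\<close>, which
    is a segment.\<close>
  have onto: "\<exists>x\<in>B. q x = y" if y: "a \<le> y" "y \<le> b" for y
  proof (cases "y = a \<or> y = b")
    case True
    then show ?thesis using ia ib by blast
  next
    case False
    then have y': "a < y" "y < b" using y by auto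
    obtain x where x: "x < fst R" "q x = y" using quot_surj[OF q, of y] y bm by auto
    have "ia < x" using quot_less[OF q, of ia x] ia x y' by (auto simp: B_def)
    have "x < ib" using quot_less[OF q, of x ib] ib x y' by auto
    have "q' ia \<le> q' x" "q' x \<le> q' ib"
      using quot_mono[OF q', of ia x] quot_mono[OF q', of x ib] \<open>ia < x\<close> \<open>x < ib\<close> x ib by (auto simp: B_def)
    then have "x \<in> B" using ia ib x by (auto simp: B_def)
    then show ?thesis using x by blast
  qed
  \<comment> \<open>Seen from a point outside \<open>B\<close>, the whole block is one point of
    \<tau>, so the colour does not depend on \<open>y\<close>.\<close>
  have left: "snd \<sigma> x y = snd \<tau> (q' k) p"
    if k: "k < fst R" "q k = x" "q' k \<noteq> p" and xy: "x < y" "a \<le> y" "y \<le> b" for x y k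
  proof -
    obtain l where l: "l \<in> B" "q l = y" using onto xy by blast
    have kl: "k < l" using quot_less[OF q, of k l] k l xy by auto
    have "q' k < q' l" using quot_mono[OF q', of k l] kl l k by (auto simp: B_def)
    then have "snd R k l = snd \<tau> (q' k) p" using quot_col[OF q', of l k] l k by (simp add: B_def)
    moreover have "snd R k l = snd \<sigma> x y" using quot_col[OF q, of l k] l k xy by (simp add: B_def)
    ultimately show ?thesis by simp
  qed
  have right: "snd \<sigma> y x = snd \<tau> p (q' k)"
    if k: "k < fst R" "q k = x" "q' k \<noteq> p" and xy: "y < x" "a \<le> y" "y \<le> b" for x y k
  proof -
    obtain l where l: "l \<in> B" "q l = y" using onto xy by blast
    have kl: "l < k" using quot_less[OF q, of l k] k l xy by (auto simp: B_def)
    have "q' l < q' k" using quot_mono[OF q', of l k] kl l k by (auto simp: B_def)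
    then have "snd R l k = snd \<tau> p (q' k)" using quot_col[OF q', of k l] l k by (simp add: B_def)
    moreover have "snd R l k = snd \<sigma> y x" using quot_col[OF q, of k l] l k xy by (simp add: B_def)
    ultimately show ?thesis by simp
  qed
  have "segment_interval \<sigma> a b" unfolding segment_interval_def
  proof (intro conjI allI impI)
    fix x y assume xy: "x < a \<and> a \<le> y \<and> y \<le> b"
    obtain k where k: "k < fst R" "q k = x" using quot_surj[OF q, of x] xy ab bm by auto
    have "q' k \<noteq> p" using bounds(1)[of x] k xy by (auto simp: P_def B_def)
    then show "snd \<sigma> x y = snd \<sigma> x a" using left[OF k] xy ab by auto
  next
    fix x y assume xy: "b < x \<and> x < fst \<sigma> \<and> a \<le> y \<and> y \<le> b"
    obtain k where k: "k < fst R" "q k = x" using quot_surj[OF q, of x] xy by auto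
    have "q' k \<noteq> p" using bounds(2)[of x] k xy by (auto simp: P_def B_def)
    then show "snd \<sigma> y x = snd \<sigma> a x" using right[OF k] xy ab by auto
  qed
  from cindecD[OF indec ab bm this] have full: "a = 0" "Suc b = fst \<sigma>" by auto
  have n: "0 < fst R" using ij by simp
  show False
  \<comment> \<open>\<open>q'\<close> has at least two blocks, so \<open>B\<close> misses the first
    or the last point of \<open>R\<close> although it projects onto everything. Removing the
    projection of the missed point from \<sigma> leaves an interval, and it has two points because
    \<sigma> has three.\<close>
  proof (cases "p = 0")
    case False
    have "q 0 = 0" using quot_mono[OF q, of 0 ia] ia full by (simp add: B_def)
    have "q' 0 \<noteq> p"
    proof -
      obtain x where "x < fst R" "q' x = 0" using quot_surj[OF q', of 0] m by auto
      then have "q' 0 = 0" using quot_mono[OF q', of 0 x] by simp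
      then show ?thesis using False by simp
    qed
    have "segment_interval \<sigma> 1 b" unfolding segment_interval_def
      using left[OF n \<open>q 0 = 0\<close> \<open>q' 0 \<noteq> p\<close>] full m by auto
    from cindecD[OF indec _ bm this] show False using m full by auto
  next
    case True
    let ?l = "fst R - 1"
    have l: "?l < fst R" using n by simp
    have "ib < fst R" using ib by (simp add: B_def)
    then have "ib \<le> ?l" by simp
    from quot_mono[OF q this l] have "q ?l = b" using quot_bound[OF q l] ib full by simp
    have "q' ?l \<noteq> p"
    proof -
      obtain x where "x < fst R" "q' x = 1" using quot_surj[OF q', of 1] m by auto
      then have "1 \<le> q' ?l" using quot_mono[OF q', of x ?l] l by simp
      then show ?thesis using True by simp
    qed
    have "segment_interval \<sigma> 0 (b - 1)" unfolding segment_interval_def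
    proof (intro conjI allI impI)
      fix x y assume "b - 1 < x \<and> x < fst \<sigma> \<and> 0 \<le> y \<and> y \<le> b - 1"
      then have "x = b" "y < b" using full ab by auto
      then show "snd \<sigma> y x = snd \<sigma> 0 x" using right[OF l \<open>q ?l = b\<close> \<open>q' ?l \<noteq> p\<close>] full ab by auto
    qed auto
    moreover have "0 < b - 1" "b - 1 < fst \<sigma>" using full m by linarith+
    ultimately show False using cindecD[OF indec, of 0 "b - 1"] full m by linarith
  qed
qed

text \<open>A monotone surjection cannot skip a value. Two projections that start at
  \<open>0\<close> and advance at the same places therefore coincide.\<close>

lemma quot_Suc:
  assumes q: "quot R \<sigma> q" and i: "Suc i < fst R"
  shows "q (Suc i) = q i \<or> q (Suc i) = Suc (q i)"
proof (rule ccontr)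
  assume "\<not> ?thesis"
  moreover have "q i \<le> q (Suc i)" using quot_mono[OF q, of i "Suc i"] i by simp
  ultimately have "Suc (q i) < q (Suc i)" by auto
  moreover obtain x where x: "x < fst R" "q x = Suc (q i)"
    using quot_surj[OF q, of "Suc (q i)"] quot_bound[OF q i] calculation by auto
  ultimately have "i < x" "x < Suc i" using quot_less[OF q, of i x] quot_less[OF q, of x "Suc i"] i by auto
  then show False by simp
qed

lemma quot_0: assumes q: "quot R \<sigma> q" and n: "0 < fst R" shows "q 0 = 0"
proof -
  have "q 0 < fst \<sigma>" using quot_bound[OF q n] .
  then obtain x where "x < fst R" "q x = 0" using quot_surj[OF q, of 0] by auto
  then show ?thesis using quot_mono[OF q, of 0 x] by simp
qed

text \<open>The size bounds are asymmetric: containment of blocks first gives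
  \<open>fst \<sigma> \<le> fst \<tau>\<close>, so \<tau> has three points as well and the roles can
  be exchanged. Then both projections have the same fibres.\<close>

lemma infl_unique:
  assumes eq: "infl \<sigma> As = infl \<tau> Bs"
    and \<sigma>: "well_formed \<sigma>" "cindec \<sigma>" "3 \<le> fst \<sigma>" "fst \<sigma> = length As"
      "\<forall>A\<in>set As. fst A > 0 \<and> well_formed A"
    and \<tau>: "well_formed \<tau>" "cindec \<tau>" "2 \<le> fst \<tau>" "fst \<tau> = length Bs"
      "\<forall>A\<in>set Bs. fst A > 0 \<and> well_formed A"
  shows "\<sigma> = \<tau> \<and> As = Bs"
proof -
  define R where "R = infl \<sigma> As"
  obtain q where q: "quot R \<sigma> q" "comps R \<sigma> q = As" using quot_infl[OF \<sigma>(4,5)] unfolding R_def by blast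
  obtain q' where q': "quot R \<tau> q'" "comps R \<tau> q' = Bs"
    using quot_infl[OF \<tau>(4,5)] unfolding R_def eq by blast
  have K1: "q i = q j" if "i < fst R" "j < fst R" "q' i = q' j" for i j
    using blocks_within_blocks[OF q(1) q'(1) \<sigma>(2,3) \<tau>(3) that] .
  let ?N = "{..<fst R}"
  \<comment> \<open>\<open>q\<close> factors through \<open>q'\<close>, hence takes at most as many
    values.\<close>
  define g where "g p = q (SOME i. i < fst R \<and> q' i = p)" for p
  have "g (q' i) = q i" if "i < fst R" for i
  proof -
    have "(SOME k. k < fst R \<and> q' k = q' i) < fst R \<and> q' (SOME k. k < fst R \<and> q' k = q' i) = q' i"
      by (rule someI[of "\<lambda>k. k < fst R \<and> q' k = q' i" i]) (simp add: that)
    then show ?thesis unfolding g_def using K1 that by blast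
  qed
  then have "q ` ?N = g ` q' ` ?N" by (simp add: image_image)
  then have "card (q ` ?N) \<le> card (q' ` ?N)" by (simp add: card_image_le)
  then have "fst \<sigma> \<le> fst \<tau>" using q(1) q'(1) unfolding quot_def by simp
  then have "3 \<le> fst \<tau>" using \<sigma>(3) by simp
  have K2: "q' i = q' j" if "i < fst R" "j < fst R" "q i = q j" for i j
    using blocks_within_blocks[OF q'(1) q(1) \<tau>(2) \<open>3 \<le> fst \<tau>\<close> _ that] \<sigma>(3) by simp
  have qq: "q i = q' i" if "i < fst R" for i
    using that
  proof (induction i)
    case 0
    then show ?case using quot_0[OF q(1)] quot_0[OF q'(1)] by simp
  next
    case (Suc i)
    then have IH: "q i = q' i" and i: "i < fst R" by auto
    show ?case
    proof (cases "q (Suc i) = q i")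
      case True
      from K2[OF Suc.prems i this] show ?thesis using True IH by simp
    next
      case False
      then have "q' (Suc i) \<noteq> q' i" using K1[OF Suc.prems i] by blast
      then show ?thesis
        using False IH quot_Suc[OF q(1) Suc.prems] quot_Suc[OF q'(1) Suc.prems] by simp
    qed
  qed
  then have "q ` ?N = q' ` ?N" by simp
  then have m: "fst \<sigma> = fst \<tau>" using q(1) q'(1) unfolding quot_def by simp
  have "\<sigma> = \<tau>"
  proof (rule well_formed_eqI[OF \<sigma>(1) \<tau>(1) m])
    fix a b assume ab: "a < b" "b < fst \<sigma>"
    obtain i where i: "i < fst R" "q i = a" using quot_surj[OF q(1), of a] ab by auto
    obtain j where j: "j < fst R" "q j = b" using quot_surj[OF q(1), of b] ab by auto
    show "snd \<sigma> a b = snd \<tau> a b"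
      using quot_col[OF q(1), of j i] quot_col[OF q'(1), of j i] qq i j ab by simp
  qed
  moreover have "As = Bs"
  proof -
    have "block R q p = block R q' p" for p using qq by (auto simp: block_def)
    then show ?thesis using q(2) q'(2) m by (simp add: comps_def)
  qed
  ultimately show ?thesis by simp
qed

subsection \<open>Two-element quotients\<close>

definition cut :: "'c cstr \<Rightarrow> 'c cstr \<Rightarrow> nat \<Rightarrow> bool" where
  "cut \<sigma> R t \<longleftrightarrow> 0 < t \<and> t < fst R \<and> (\<forall>i j. i < t \<and> t \<le> j \<and> j < fst R \<longrightarrow> snd R i j = snd \<sigma> 0 1)"

lemma infl_cut:
  assumes "well_formed R" "fst \<sigma> = 2" "cut \<sigma> R t"
  shows "infl \<sigma> [canon {..<t} (snd R), canon {t..<fst R} (snd R)] = R"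
proof -
  let ?q = "\<lambda>i. if i < t then 0 else 1::nat"
  have t: "0 < t" "t < fst R" "\<And>i j. i < t \<Longrightarrow> t \<le> j \<Longrightarrow> j < fst R \<Longrightarrow> snd R i j = snd \<sigma> 0 1"
    using assms(3) by (auto simp: cut_def)
  have q: "quot R \<sigma> ?q" unfolding quot_def
  proof (intro conjI allI impI)
    have "0 \<in> ?q ` {..<fst R}" by (rule image_eqI[of _ _ 0]) (use t(1,2) in auto)
    moreover have "1 \<in> ?q ` {..<fst R}" by (rule image_eqI[of _ _ t]) (use t(2) in auto)
    ultimately have "?q ` {..<fst R} = {0, 1}" by auto
    then show "?q ` {..<fst R} = {..<fst \<sigma>}"
      by (simp only: assms(2) numeral_2_eq_2 lessThan_Suc lessThan_0 One_nat_def insert_commute)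
    show "mono_on {..<fst R} ?q" by (auto simp: mono_on_def)
    fix i j assume ij: "i < j \<and> j < fst R \<and> ?q i < ?q j"
    then have "i < t" "t \<le> j" by (auto split: if_splits)
    then show "snd R i j = snd \<sigma> (?q i) (?q j)" using t(3) ij by simp
  qed
  have "block R ?q 0 = {..<t}" "block R ?q 1 = {t..<fst R}"
    using t(1,2) by (auto simp: block_def split: if_splits)
  then have "comps R \<sigma> ?q = [canon {..<t} (snd R), canon {t..<fst R} (snd R)]"
    using assms(2) by (simp add: comps_def numeral_2_eq_2)
  then show ?thesis using infl_comps[OF assms(1) q] by simp
qed

text \<open>Both components can be recovered from the position of the cut, so comparing
  decompositions reduces to comparing numbers.\<close>

lemma cut_infl:
  assumes \<sigma>: "fst \<sigma> = 2" and A: "fst A > 0" "well_formed A" and B: "fst B > 0" "well_formed B"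
  defines "R \<equiv> infl \<sigma> [A, B]"
  shows "cut \<sigma> R (fst A)" "A = canon {..<fst A} (snd R)" "B = canon {fst A..<fst R} (snd R)"
proof -
  obtain q where q: "quot R \<sigma> q" "comps R \<sigma> q = [A, B]"
    using quot_infl[of \<sigma> "[A, B]"] assms by auto
  let ?S = "block R q 0"
  have A': "A = canon ?S (snd R)" and B': "B = canon (block R q 1) (snd R)"
    using nth_comps[of 0 \<sigma> R q] nth_comps[of 1 \<sigma> R q] q(2) \<sigma> by auto
  \<comment> \<open>The fibre over \<open>0\<close> is closed downwards, hence an initial segment,
    and its length is \<open>fst A\<close>.\<close>
  have "?S \<subseteq> {..<card ?S}"
  proof
    fix x assume x: "x \<in> ?S"
    have "{..x} \<subseteq> ?S"
    proof
      fix y assume "y \<in> {..x}"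
      then show "y \<in> ?S" using quot_mono[OF q(1), of y x] x by (auto simp: block_def)
    qed
    then have "card {..x} \<le> card ?S" by (intro card_mono) auto
    then show "x \<in> {..<card ?S}" by simp
  qed
  then have "?S = {..<card ?S}" by (intro card_subset_eq) auto
  moreover have "card ?S = fst A" by (subst A') simp
  ultimately have S: "?S = {..<fst A}" by simp
  have n: "fst R = fst A + fst B" by (simp add: R_def fst_infl)
  have q0: "q i = 0 \<longleftrightarrow> i < fst A" if "i < fst R" for i using S that unfolding block_def by blast
  have q1: "q i = 1" if "i < fst R" "fst A \<le> i" for i
    using q0[of i] quot_bound[OF q(1), of i] that \<sigma> by auto
  have "block R q 1 = {fst A..<fst R}" using q0 q1 unfolding block_def by force
  with B' show "B = canon {fst A..<fst R} (snd R)" by simp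
  show "A = canon {..<fst A} (snd R)" using A' S by simp
  show "cut \<sigma> R (fst A)" unfolding cut_def
  proof (intro conjI allI impI)
    fix i j assume ij: "i < fst A \<and> fst A \<le> j \<and> j < fst R"
    then have "q i = 0" "q j = 1" using q0[of i] q1[of j] by auto
    then show "snd R i j = snd \<sigma> 0 1" using quot_col[OF q(1), of j i] ij by simp
  qed (use A B n in auto)
qed

definition reducible :: "'c cstr \<Rightarrow> 'c cstr \<Rightarrow> bool" where
  "reducible \<sigma> R \<longleftrightarrow> (\<exists>A B. well_formed A \<and> fst A > 0 \<and> well_formed B \<and> fst B > 0 \<and> R = infl \<sigma> [A, B])"

lemma reducible_iff_cut:
  assumes "fst \<sigma> = 2" "well_formed R"
  shows "reducible \<sigma> R \<longleftrightarrow> (\<exists>t. cut \<sigma> R t)"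
proof
  show "reducible \<sigma> R \<Longrightarrow> \<exists>t. cut \<sigma> R t" using cut_infl(1)[OF assms(1)] unfolding reducible_def by blast
  assume "\<exists>t. cut \<sigma> R t"
  then obtain t where t: "cut \<sigma> R t" by blast
  then show "reducible \<sigma> R" unfolding reducible_def
    using infl_cut[OF assms(2,1) t]
    by (intro exI[of _ "canon {..<t} (snd R)"] exI[of _ "canon {t..<fst R} (snd R)"])
      (auto simp: cut_def)
qed

lemma cut_restrict:
  assumes "s < t" "t \<le> fst R"
  shows "cut \<sigma> (canon {..<t} (snd R)) s \<longleftrightarrow> 0 < s \<and> (\<forall>i j. i < s \<and> s \<le> j \<and> j < t \<longrightarrow> snd R i j = snd \<sigma> 0 1)"
  using assms by (auto simp: cut_def snd_canon_lessThan)

text \<open>Take the least cut \<open>t\<close>. A cut of the left part would also be a cut of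
  \<open>R\<close>, because its pairs that reach beyond \<open>t\<close> have the right colour by
  the cut at \<open>t\<close>.\<close>

lemma infl_two_exists:
  assumes "fst \<sigma> = 2" "reducible \<sigma> R"
  obtains A B where "well_formed A" "fst A > 0" "\<not> reducible \<sigma> A" "well_formed B" "fst B > 0"
    "R = infl \<sigma> [A, B]"
proof -
  have wf: "well_formed R" using assms(2) by (auto simp: reducible_def)
  have ex: "\<exists>t. cut \<sigma> R t" using assms reducible_iff_cut wf by blast
  define t where "t = (LEAST t. cut \<sigma> R t)"
  have t: "cut \<sigma> R t" using ex unfolding t_def by (rule LeastI_ex)
  have least: "t \<le> s" if "cut \<sigma> R s" for s using that unfolding t_def by (rule Least_le)
  have "\<not> reducible \<sigma> (canon {..<t} (snd R))"
  proof
    assume "reducible \<sigma> (canon {..<t} (snd R))"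
    then obtain s where s: "cut \<sigma> (canon {..<t} (snd R)) s" using reducible_iff_cut[OF assms(1)] by fastforce
    then have "s < t" by (simp add: cut_def)
    then have "cut \<sigma> R s" using s t unfolding cut_restrict[OF \<open>s < t\<close> less_imp_le[of t "fst R"]]
      by (auto simp: cut_def snd_canon_lessThan) (metis less_trans not_le order_less_le_trans)
    then show False using least \<open>s < t\<close> by fastforce
  qed
  then show ?thesis using infl_cut[OF wf assms(1) t] t
    by (intro that[of "canon {..<t} (snd R)" "canon {t..<fst R} (snd R)"]) (auto simp: cut_def)
qed

text \<open>Every cut separates the first point from the last, so the colour of these two determines
  the quotient.\<close>

lemma infl_two_quotient_unique:
  assumes "fst \<sigma> = 2" "fst \<tau> = 2" "well_formed \<sigma>" "well_formed \<tau>" "reducible \<sigma> R" "reducible \<tau> R"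
  shows "\<sigma> = \<tau>"
proof -
  have wf: "well_formed R" using assms(5) by (auto simp: reducible_def)
  obtain s t where "cut \<sigma> R s" "cut \<tau> R t" using assms reducible_iff_cut wf by blast
  then have "snd R 0 (fst R - 1) = snd \<sigma> 0 1" "snd R 0 (fst R - 1) = snd \<tau> 0 1" by (auto simp: cut_def)
  then have "snd \<sigma> 0 1 = snd \<tau> 0 1" by simp
  then show ?thesis using assms by (intro well_formed_eqI) (auto simp: less_2_cases_iff)
qed

text \<open>If the cuts differed, the smaller one would restrict to a cut of the first component
  that belongs to the larger one.\<close>

lemma infl_two_unique:
  assumes \<sigma>: "fst \<sigma> = 2" and eq: "infl \<sigma> [A, B] = infl \<sigma> [A', B']"
    and A: "fst A > 0" "well_formed A" "\<not> reducible \<sigma> A" and B: "fst B > 0" "well_formed B"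
    and A': "fst A' > 0" "well_formed A'" "\<not> reducible \<sigma> A'" and B': "fst B' > 0" "well_formed B'"
  shows "A = A' \<and> B = B'"
proof -
  define R where "R = infl \<sigma> [A, B]"
  note c = cut_infl[OF \<sigma> A(1,2) B, folded R_def] and c' = cut_infl[OF \<sigma> A'(1,2) B', folded eq R_def]
  have "\<not> fst A < fst A'"
  proof
    assume less: "fst A < fst A'"
    then have "cut \<sigma> (canon {..<fst A'} (snd R)) (fst A)"
      using c(1) c'(1) by (subst cut_restrict) (auto simp: cut_def)
    then have "reducible \<sigma> A'" using reducible_iff_cut[OF \<sigma> A'(2)] c'(2) by auto
    with A'(3) show False by blast
  qed
  moreover have "\<not> fst A' < fst A"
  proof
    assume less: "fst A' < fst A"
    then have "cut \<sigma> (canon {..<fst A} (snd R)) (fst A')"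
      using c(1) c'(1) by (subst cut_restrict) (auto simp: cut_def)
    then have "reducible \<sigma> A" using reducible_iff_cut[OF \<sigma> A(2)] c(2) by auto
    with A(3) show False by blast
  qed
  ultimately have "fst A = fst A'" by simp
  then show ?thesis using c(2,3) c'(2,3) by metis
qed

section \<open>Generating functions\<close>

text \<open>Guards the coefficients of \<open>gf\<close>: an infinite level would have
  \<open>card\<close> equal to 0 and break the sum and product rules.\<close>

definition finite_levels :: "('a \<Rightarrow> nat) \<Rightarrow> 'a set \<Rightarrow> bool" where
  "finite_levels w X \<longleftrightarrow> (\<forall>n. finite {x \<in> X. w x = n})"

definition gf :: "('a \<Rightarrow> nat) \<Rightarrow> 'a set \<Rightarrow> rat fps" where
  "gf w X = Abs_fps (\<lambda>n. of_nat (card {x \<in> X. w x = n}))"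

lemma gf_nth: "fps_nth (gf w X) n = of_nat (card {x \<in> X. w x = n})"
  by (simp add: gf_def)

lemma finite_levels_subset: "finite_levels w X \<Longrightarrow> Y \<subseteq> X \<Longrightarrow> finite_levels w Y"
  unfolding finite_levels_def by (auto intro: finite_subset[of "{x \<in> Y. w x = n}" "{x \<in> X. w x = n}" for n])

lemma gf_empty [simp]: "gf w {} = 0"
  by (simp add: fps_eq_iff gf_nth)

lemma gf_Un:
  assumes "finite_levels w X" "finite_levels w Y"
  shows "gf w (X \<union> Y) = gf w X + gf w Y - gf w (X \<inter> Y)"
proof (rule fps_ext)
  fix n
  let ?l = "\<lambda>X. {x \<in> X. w x = n}"
  have "card (?l X) + card (?l Y) = card (?l X \<union> ?l Y) + card (?l X \<inter> ?l Y)"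
    using assms by (intro card_Un_Int) (auto simp: finite_levels_def)
  also have "?l X \<union> ?l Y = ?l (X \<union> Y)" by auto
  also have "?l X \<inter> ?l Y = ?l (X \<inter> Y)" by auto
  finally have "(of_nat (card (?l X)) + of_nat (card (?l Y)) :: rat) =
      of_nat (card (?l (X \<union> Y))) + of_nat (card (?l (X \<inter> Y)))"
    unfolding of_nat_add[symmetric] by (rule arg_cong)
  then show "fps_nth (gf w (X \<union> Y)) n = fps_nth (gf w X + gf w Y - gf w (X \<inter> Y)) n"
    by (simp add: gf_nth)
qed

lemma gf_Un_disjoint:
  "finite_levels w X \<Longrightarrow> finite_levels w Y \<Longrightarrow> X \<inter> Y = {} \<Longrightarrow> gf w (X \<union> Y) = gf w X + gf w Y"
  by (simp add: gf_Un)

lemma gf_UN_disjoint: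
  assumes "finite I" "finite_levels w Y" "\<And>i. i \<in> I \<Longrightarrow> X i \<subseteq> Y"
    and "\<And>i j. i \<in> I \<Longrightarrow> j \<in> I \<Longrightarrow> i \<noteq> j \<Longrightarrow> X i \<inter> X j = {}"
  shows "gf w (\<Union>i\<in>I. X i) = (\<Sum>i\<in>I. gf w (X i))"
  using assms(1,3,4)
proof (induction I rule: finite_induct)
  case (insert i I)
  have "X i \<inter> (\<Union>i\<in>I. X i) = {}" using insert.hyps insert.prems(2)[of i] by fastforce
  moreover have "finite_levels w (X i)" "finite_levels w (\<Union>i\<in>I. X i)"
    using insert.prems(1) by (auto intro!: finite_levels_subset[OF assms(2)])
  ultimately have "gf w (X i \<union> (\<Union>i\<in>I. X i)) = gf w (X i) + gf w (\<Union>i\<in>I. X i)"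
    by (rule gf_Un_disjoint[rotated 2])
  then show ?case using insert by simp
qed simp

lemma gf_bij:
  assumes "inj_on f X" "\<And>x. x \<in> X \<Longrightarrow> w' (f x) = w x"
  shows "gf w' (f ` X) = gf w X"
proof (rule fps_ext)
  fix n
  have "{y \<in> f ` X. w' y = n} = f ` {x \<in> X. w x = n}" using assms(2) by auto
  moreover have "inj_on f {x \<in> X. w x = n}" using assms(1) by (rule inj_on_subset) auto
  ultimately show "fps_nth (gf w' (f ` X)) n = fps_nth (gf w X) n"
    by (simp add: gf_nth card_image)
qed

lemma level_Times:
  fixes w :: "'a \<Rightarrow> nat" and w' :: "'b \<Rightarrow> nat"
  shows
  "{z \<in> X \<times> Y. (case z of (x, y) \<Rightarrow> w x + w' y) = n} =
     (\<Union>i\<in>{0..n}. {x \<in> X. w x = i} \<times> {y \<in> Y. w' y = n - i})"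
  by auto

lemma gf_Times:
  fixes w :: "'a \<Rightarrow> nat" and w' :: "'b \<Rightarrow> nat"
  assumes "finite_levels w X" "finite_levels w' Y"
  shows "gf (\<lambda>(x, y). w x + w' y) (X \<times> Y) = gf w X * gf w' Y"
    and "finite_levels (\<lambda>(x, y). w x + w' y) (X \<times> Y)"
proof -
  show "finite_levels (\<lambda>(x, y). w x + w' y) (X \<times> Y)"
    unfolding finite_levels_def level_Times using assms by (auto simp: finite_levels_def)
  show "gf (\<lambda>(x, y). w x + w' y) (X \<times> Y) = gf w X * gf w' Y"
  proof (rule fps_ext)
    fix n
    have "card (\<Union>i\<in>{0..n}. {x \<in> X. w x = i} \<times> {y \<in> Y. w' y = n - i}) =
        (\<Sum>i=0..n. card ({x \<in> X. w x = i} \<times> {y \<in> Y. w' y = n - i}))"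
      using assms by (intro card_UN_disjoint) (auto simp: finite_levels_def)
    then show "fps_nth (gf (\<lambda>(x, y). w x + w' y) (X \<times> Y)) n = fps_nth (gf w X * gf w' Y) n"
      by (simp add: gf_nth level_Times fps_mult_nth card_cartesian_product)
  qed
qed

text \<open>A box becomes a product of series with one factor for each side; this is the reason for
  cutting sets of tuples into boxes.\<close>

lemma gf_listset:
  assumes "\<And>D. D \<in> set Ds \<Longrightarrow> finite_levels w D"
  shows "gf (\<lambda>xs. sum_list (map w xs)) (listset Ds) = prod_list (map (gf w) Ds) \<and>
    finite_levels (\<lambda>xs. sum_list (map w xs)) (listset Ds)"
  using assms
proof (induction Ds)
  case Nil
  have "{xs \<in> {[]}. sum_list (map w xs) = n} = (if n = 0 then {[]} else {})" for n by auto
  then show ?case by (auto simp: finite_levels_def fps_eq_iff gf_nth)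
next
  case (Cons D Ds)
  let ?w = "\<lambda>xs. sum_list (map w xs)" and ?f = "\<lambda>(x, xs). x # xs"
  have IH: "gf ?w (listset Ds) = prod_list (map (gf w) Ds)" "finite_levels ?w (listset Ds)"
    using Cons.IH Cons.prems by auto
  have D: "finite_levels w D" using Cons.prems by simp
  have im: "listset (D # Ds) = ?f ` (D \<times> listset Ds)" by (auto simp: set_Cons_def)
  have "gf ?w (?f ` (D \<times> listset Ds)) = gf (\<lambda>(x, xs). w x + ?w xs) (D \<times> listset Ds)"
    by (rule gf_bij) (auto simp: inj_on_def)
  also have "\<dots> = gf w D * gf ?w (listset Ds)" by (rule gf_Times(1)[OF D IH(2)])
  finally have "gf ?w (listset (D # Ds)) = prod_list (map (gf w) (D # Ds))"
    using im IH(1) by simp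
  moreover have "finite_levels ?w (listset (D # Ds))"
    unfolding finite_levels_def
  proof
    fix n
    have "{xs \<in> listset (D # Ds). ?w xs = n} =
        ?f ` {z \<in> D \<times> listset Ds. (case z of (x, xs) \<Rightarrow> w x + ?w xs) = n}"
      unfolding im by force
    moreover have "finite {z \<in> D \<times> listset Ds. (case z of (x, xs) \<Rightarrow> w x + ?w xs) = n}"
      using gf_Times(2)[OF D IH(2)] unfolding finite_levels_def by (rule spec)
    ultimately show "finite {xs \<in> listset (D # Ds). ?w xs = n}" by (simp only: finite_imageI)
  qed
  ultimately show ?case by simp
qed

text \<open>Inclusion-exclusion, one set at a time.\<close>

lemma gf_Union_in_subgroup:
  assumes F: "\<And>X Y. X \<in> F \<Longrightarrow> Y \<in> F \<Longrightarrow> X \<inter> Y \<in> F"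
    and lev: "\<And>X. X \<in> F \<Longrightarrow> finite_levels w X"
    and gfM: "\<And>X. X \<in> F \<Longrightarrow> gf w X \<in> M"
    and M: "0 \<in> M" "\<And>x y. x \<in> M \<Longrightarrow> y \<in> M \<Longrightarrow> x + y \<in> M" "\<And>x y. x \<in> M \<Longrightarrow> y \<in> M \<Longrightarrow> x - y \<in> M"
    and G: "finite G" "G \<subseteq> F"
  shows "gf w (\<Union>G) \<in> M"
proof -
  have "gf w (\<Union>G) \<in> M \<and> finite_levels w (\<Union>G)" if "card G \<le> n" "finite G" "G \<subseteq> F" for n G
    using that
  proof (induction n arbitrary: G)
    case 0
    then show ?case using M(1) by (simp add: finite_levels_def)
  next
    case (Suc n)
    show ?case
    proof (cases "G = {}")
      case True
      then show ?thesis using M(1) by (simp add: finite_levels_def)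
    next
      case False
      then obtain X where X: "X \<in> G" by blast
      define H where "H = G - {X}"
      have H: "finite H" "H \<subseteq> F" "card H \<le> n" "G = insert X H"
        using X Suc.prems by (auto simp: H_def)
      have XF: "X \<in> F" using X Suc.prems by auto
      have IH: "gf w (\<Union>H) \<in> M" "finite_levels w (\<Union>H)" using Suc.IH[OF H(3,1,2)] by auto
      let ?K = "(\<lambda>Y. X \<inter> Y) ` H"
      have K: "finite ?K" "?K \<subseteq> F" "card ?K \<le> n"
        using H F[OF XF] card_image_le[OF H(1), of "\<lambda>Y. X \<inter> Y"] by auto
      have "\<Union>?K = X \<inter> \<Union>H" by auto
      then have IK: "gf w (X \<inter> \<Union>H) \<in> M" using Suc.IH[OF K(3,1,2)] by simp
      have "gf w (X \<union> \<Union>H) = gf w X + gf w (\<Union>H) - gf w (X \<inter> \<Union>H)"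
        by (rule gf_Un[OF lev[OF XF] IH(2)])
      then have "gf w (\<Union>G) \<in> M" using M(2,3) gfM[OF XF] IH IK H(4) by simp
      moreover have "{x \<in> \<Union>G. w x = m} = {x \<in> X. w x = m} \<union> {x \<in> \<Union>H. w x = m}" for m
        using H(4) by auto
      then have "finite_levels w (\<Union>G)" using lev[OF XF] IH(2) unfolding finite_levels_def by simp
      ultimately show ?thesis by simp
    qed
  qed
  then show ?thesis using G by blast
qed

subsection \<open>Polynomial equations over the algebraic series\<close>

definition alg_poly :: "'a::field fps poly \<Rightarrow> bool" where
  "alg_poly p \<longleftrightarrow> (\<forall>i. alg_fps (coeff p i))"

lemma alg_poly_0 [simp]: "alg_poly 0" and alg_poly_1 [simp]: "alg_poly 1"
  by (simp_all add: alg_poly_def)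

lemma alg_poly_pCons: "alg_fps a \<Longrightarrow> alg_poly p \<Longrightarrow> alg_poly (pCons a p)"
  by (auto simp: alg_poly_def coeff_pCons split: nat.splits)

lemma alg_poly_add: "alg_poly p \<Longrightarrow> alg_poly q \<Longrightarrow> alg_poly (p + q)"
  and alg_poly_diff: "alg_poly p \<Longrightarrow> alg_poly q \<Longrightarrow> alg_poly (p - q)"
  by (simp_all add: alg_poly_def alg_fps_add alg_fps_diff)

lemma alg_poly_mult: "alg_poly p \<Longrightarrow> alg_poly q \<Longrightarrow> alg_poly (p * q)"
  by (simp add: alg_poly_def coeff_mult alg_fps_sum alg_fps_mult)

lemma alg_fps_poly: "alg_poly p \<Longrightarrow> alg_fps h \<Longrightarrow> alg_fps (poly p h)"
proof (induction p)
  case (pCons a p)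
  have "alg_fps a" using pCons.prems(1) unfolding alg_poly_def by (metis coeff_pCons_0)
  moreover have "alg_poly p" using pCons.prems(1) unfolding alg_poly_def by (metis coeff_pCons_Suc)
  ultimately show ?case using pCons by (simp add: alg_fps_add alg_fps_mult)
qed simp

text \<open>The ideals \<open>(x, Y)\<close> and \<open>(x, Y\<^sup>2)\<close> of the polynomials in \<open>Y\<close> over the algebraic series.\<close>

definition idealJ1 :: "'a::field fps poly set" where
  "idealJ1 = {p. alg_poly p \<and> fps_nth (coeff p 0) 0 = 0}"

definition idealJ :: "'a::field fps poly set" where
  "idealJ = {p. alg_poly p \<and> fps_nth (coeff p 0) 0 = 0 \<and> fps_nth (coeff p 1) 0 = 0}"

lemma coeff_mult_01:
  "coeff (p * q) 0 = coeff p 0 * coeff q 0"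
  "coeff (p * q) 1 = coeff p 0 * coeff q 1 + coeff p 1 * coeff q 0"
  by (simp_all add: coeff_mult)

lemma idealJ_mult: "p \<in> idealJ \<Longrightarrow> alg_poly q \<Longrightarrow> p * q \<in> idealJ"
  unfolding idealJ_def mem_Collect_eq coeff_mult_01 by (simp add: alg_poly_mult)

lemma idealJ1_mult: "p \<in> idealJ1 \<Longrightarrow> q \<in> idealJ1 \<Longrightarrow> p * q \<in> idealJ"
  unfolding idealJ_def idealJ1_def mem_Collect_eq coeff_mult_01 by (simp add: alg_poly_mult)

lemma idealJ_subset: "idealJ \<subseteq> idealJ1"
  by (auto simp: idealJ_def idealJ1_def)

lemma idealJ_add: "p \<in> idealJ \<Longrightarrow> q \<in> idealJ \<Longrightarrow> p + q \<in> idealJ"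
  and idealJ_diff: "p \<in> idealJ \<Longrightarrow> q \<in> idealJ \<Longrightarrow> p - q \<in> idealJ"
  by (simp_all add: idealJ_def alg_poly_add alg_poly_diff)

lemma idealJ_0: "0 \<in> idealJ"
  by (simp add: idealJ_def)

text \<open>The quotients of \<open>N(h)\<close> by \<open>D(h)\<close> with \<open>N\<close> in (x,
  Y^2) and \<open>D\<close> congruent to 1 modulo (x, Y), written without division. Denominators
  arise when the equation for the reducible structures is solved.\<close>

definition fractions :: "'a::field fps \<Rightarrow> 'a fps set" where
  "fractions h = {w. \<exists>D N. alg_poly D \<and> fps_nth (coeff D 0) 0 = 1 \<and> N \<in> idealJ \<and> w * poly D h = poly N h}"

lemma fractions_poly: "N \<in> idealJ \<Longrightarrow> poly N h \<in> fractions h"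
  unfolding fractions_def by (rule CollectI, rule exI[of _ 1], rule exI[of _ N]) simp

lemma fractions_add:
  assumes "v \<in> fractions h" "w \<in> fractions h"
  shows "v + w \<in> fractions h"
proof -
  obtain D N where v: "alg_poly D" "fps_nth (coeff D 0) 0 = 1" "N \<in> idealJ" "v * poly D h = poly N h"
    using assms(1) by (auto simp: fractions_def)
  obtain D' N' where w: "alg_poly D'" "fps_nth (coeff D' 0) 0 = 1" "N' \<in> idealJ" "w * poly D' h = poly N' h"
    using assms(2) by (auto simp: fractions_def)
  have "(v + w) * poly (D * D') h = (v * poly D h) * poly D' h + (w * poly D' h) * poly D h"
    by (simp add: algebra_simps)
  also have "\<dots> = poly (N * D' + N' * D) h" by (simp add: v w)
  finally have "(v + w) * poly (D * D') h = poly (N * D' + N' * D) h" .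
  moreover have "N * D' + N' * D \<in> idealJ" using v w by (intro idealJ_add idealJ_mult)
  moreover have "alg_poly (D * D')" using v w by (intro alg_poly_mult)
  moreover have "fps_nth (coeff (D * D') 0) 0 = 1" using v w by (simp add: coeff_mult_01)
  ultimately show ?thesis unfolding fractions_def by blast
qed

lemma fractions_sum: "(\<And>i. i \<in> I \<Longrightarrow> f i \<in> fractions h) \<Longrightarrow> sum f I \<in> fractions h"
  using fractions_poly[OF idealJ_0, of h]
  by (induction I rule: infinite_finite_induct) (auto intro: fractions_add)

text \<open>The polynomial \<open>Y * D - N\<close> annihilates \<open>h\<close>. Its coefficient at
  \<open>Y\<close> has constant term 1, of which \<open>D\<close> contributes 1 and \<open>N\<close>
  contributes 0, so it is nonzero.\<close>

lemma alg_fps_of_fractions_self: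
  assumes "h \<in> fractions h" shows "alg_fps h"
proof -
  obtain D N where D: "alg_poly D" "fps_nth (coeff D 0) 0 = 1" "N \<in> idealJ" "h * poly D h = poly N h"
    using assms by (auto simp: fractions_def)
  let ?q = "pCons 0 D - N"
  have "fps_nth (coeff ?q 1) 0 = 1" using D by (simp add: idealJ_def)
  then have "?q \<noteq> 0" by auto
  moreover have "alg_poly ?q" using D by (intro alg_poly_diff alg_poly_pCons) (auto simp: idealJ_def)
  moreover have "poly ?q h = 0" using D by simp
  ultimately show ?thesis using alg_fps_root[of ?q h] unfolding alg_poly_def by blast
qed

text \<open>As \<open>h\<close> vanishes at 0, the value \<open>D(h)\<close> has constant term 1;
  thus \<open>w\<close> satisfies a nonzero linear equation over the algebraic series.\<close>

lemma alg_fps_fractions: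
  assumes "w \<in> fractions h" "alg_fps h" "fps_nth h 0 = 0" shows "alg_fps w"
proof -
  obtain D N where D: "alg_poly D" "fps_nth (coeff D 0) 0 = 1" "N \<in> idealJ" "w * poly D h = poly N h"
    using assms by (auto simp: fractions_def)
  let ?q = "[:- poly N h, poly D h:]"
  have "fps_nth (poly D h) 0 = 1"
    using D(2) assms(3) by (cases D) simp_all
  then have "poly D h \<noteq> 0" by auto
  then have "?q \<noteq> 0" by simp
  moreover have "alg_fps (poly N h)" "alg_fps (poly D h)"
    using D assms by (auto intro: alg_fps_poly simp: idealJ_def)
  then have "alg_poly ?q" by (intro alg_poly_pCons alg_fps_uminus) auto
  moreover have "poly ?q w = 0" using D(4) by simp
  ultimately show ?thesis using alg_fps_root[of ?q w] unfolding alg_poly_def by blast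
qed

section \<open>Classes with finitely many indecomposable structures\<close>

lemma in_idealJ1_values_mult:
  assumes "a \<in> (\<lambda>p. poly p h) ` idealJ1" "b \<in> (\<lambda>p. poly p h) ` idealJ1"
  shows "a * b \<in> (\<lambda>p. poly p h) ` idealJ"
proof -
  obtain p q where "p \<in> idealJ1" "q \<in> idealJ1" "a = poly p h" "b = poly q h" using assms by auto
  then show ?thesis using idealJ1_mult[of p q] by (intro image_eqI[of _ _ "p * q"]) auto
qed

text \<open>The square of (x, Y) lies in (x, Y^2), and an inflation by a quotient with at least two
  points supplies the two factors.\<close>

lemma prod_list_idealJ_values:
  assumes "length fs \<ge> 2" "set fs \<subseteq> (\<lambda>p. poly p h) ` idealJ1"
  shows "prod_list fs \<in> (\<lambda>p. poly p h) ` idealJ"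
  using assms
proof (induction fs)
  case (Cons a fs)
  show ?case
  proof (cases "length fs \<ge> 2")
    case True
    then have "prod_list fs \<in> (\<lambda>p. poly p h) ` idealJ1" using Cons idealJ_subset by auto
    then show ?thesis using Cons.prems by (simp add: in_idealJ1_values_mult)
  next
    case False
    then obtain b where "fs = [b]" using Cons.prems by (cases fs; cases "tl fs") auto
    then show ?thesis using Cons.prems by (simp add: in_idealJ1_values_mult)
  qed
qed simp

lemma idealJ1_values:
  "alg_fps a \<Longrightarrow> fps_nth a 0 = 0 \<Longrightarrow> a \<in> (\<lambda>p. poly p h) ` idealJ1"
  "h \<in> (\<lambda>p. poly p h) ` idealJ1"
  by (rule image_eqI[of _ _ "[:a:]"]; simp add: idealJ1_def alg_poly_pCons)
    (rule image_eqI[of _ _ "[:0, 1:]"]; simp add: idealJ1_def alg_poly_pCons)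

text \<open>Some other component has points too. This is the descent in the minimal bad sequence
  argument.\<close>

lemma sum_list_pos_less:
  fixes As :: "'c cstr list"
  assumes "2 \<le> length As" "\<forall>A\<in>set As. fst A > 0" "A \<in> set As"
  shows "fst A < sum_list (map fst As)"
proof -
  obtain xs ys where As: "As = xs @ A # ys" using assms(3) split_list by fast
  have pos: "0 < sum_list (map fst zs)" if B: "B \<in> set zs" "set zs \<subseteq> set As" for B zs
  proof -
    have "fst B \<le> sum_list (map fst zs)" using B(1) by (intro member_le_sum_list) auto
    moreover have "0 < fst B" using B assms(2) by auto
    ultimately show ?thesis by simp
  qed
  have "xs \<noteq> [] \<or> ys \<noteq> []" using assms(1) As by auto
  then obtain B where "B \<in> set xs \<or> B \<in> set ys" by (metis list.set_intros(1) neq_Nil_conv)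
  then have "0 < sum_list (map fst xs) \<or> 0 < sum_list (map fst ys)"
  proof
    assume "B \<in> set xs"
    then have "0 < sum_list (map fst xs)" by (rule pos) (auto simp: As)
    then show ?thesis ..
  next
    assume "B \<in> set ys"
    then have "0 < sum_list (map fst ys)" by (rule pos) (auto simp: As)
    then show ?thesis ..
  qed
  then show ?thesis using As by auto
qed

lemma wqo_on_eq_finite:
  assumes "finite S" shows "wqo_on (=) S"
proof (rule wqo_onI)
  fix f :: "nat \<Rightarrow> 'a" assume f: "\<And>i. f i \<in> S"
  have "\<not> inj f"
  proof
    assume "inj f"
    moreover have "finite (range f)" using f assms by (auto intro: finite_subset[of _ S])
    ultimately show False using finite_imageD by blast
  qed
  then obtain i j where "f i = f j" "i \<noteq> j" by (auto simp: inj_def)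
  then show "\<exists>i j. i < j \<and> f i = f j" by (metis linorder_neqE_nat)
qed

definition inflation_of :: "'c cstr \<Rightarrow> 'c cstr \<Rightarrow> bool" where
  "inflation_of \<sigma> R \<longleftrightarrow> (\<exists>As. length As = fst \<sigma> \<and> (\<forall>A\<in>set As. fst A > 0 \<and> well_formed A) \<and> R = infl \<sigma> As)"

lemma inflation_of_two: "fst \<sigma> = 2 \<Longrightarrow> inflation_of \<sigma> R \<longleftrightarrow> reducible \<sigma> R"
proof
  assume "fst \<sigma> = 2" "inflation_of \<sigma> R"
  then obtain As where As: "length As = 2" "\<forall>A\<in>set As. fst A > 0 \<and> well_formed A" "R = infl \<sigma> As"
    by (auto simp: inflation_of_def)
  obtain A B where "As = [A, B]" using As(1) by (cases As; cases "tl As") auto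
  then have "well_formed A \<and> fst A > 0 \<and> well_formed B \<and> fst B > 0 \<and> R = infl \<sigma> [A, B]" using As by simp
  then show "reducible \<sigma> R" unfolding reducible_def by blast
next
  assume "fst \<sigma> = 2" "reducible \<sigma> R"
  then obtain A B where "well_formed A" "fst A > 0" "well_formed B" "fst B > 0" "R = infl \<sigma> [A, B]"
    by (auto simp: reducible_def)
  then show "inflation_of \<sigma> R" using \<open>fst \<sigma> = 2\<close> unfolding inflation_of_def by (intro exI[of _ "[A, B]"]) auto
qed

text \<open>The empty structure is left out so that all generating series vanish at 0; accordingly,
  heredity is asked for nonempty substructures.\<close>

locale finite_indecomposables =
  fixes C :: "'c cstr set"
  assumes wf: "R \<in> C \<Longrightarrow> well_formed R" and pos: "R \<in> C \<Longrightarrow> fst R > 0"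
    and down: "R \<in> C \<Longrightarrow> well_formed A \<Longrightarrow> fst A > 0 \<Longrightarrow> cemb A R \<Longrightarrow> A \<in> C"
    and fin: "finite {\<sigma> \<in> C. cindec \<sigma>}"
begin

definition simples :: "'c cstr set" where
  "simples = {\<sigma> \<in> C. cindec \<sigma> \<and> 2 \<le> fst \<sigma>}"

lemma finite_simples: "finite simples"
  using fin by (rule finite_subset[rotated]) (auto simp: simples_def)

lemma simplesD: "\<sigma> \<in> simples \<Longrightarrow> \<sigma> \<in> C \<and> well_formed \<sigma> \<and> cindec \<sigma> \<and> 2 \<le> fst \<sigma>"
  using wf by (auto simp: simples_def)

lemma infl_in_C:
  assumes "infl \<sigma> As \<in> C" "length As = fst \<sigma>" "\<forall>A\<in>set As. fst A > 0 \<and> well_formed A"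
  shows "set As \<subseteq> C"
proof
  fix A assume A: "A \<in> set As"
  then obtain p where "p < length As" "A = As ! p" by (metis in_set_conv_nth)
  then have "cemb A (infl \<sigma> As)" using cemb_component[of As p] A assms(3) by simp
  then show "A \<in> C" using down[OF assms(1)] A assms(3) by simp
qed

lemma decomposition:
  assumes "R \<in> C" "2 \<le> fst R"
  shows "\<exists>\<sigma>\<in>simples. inflation_of \<sigma> R"
proof -
  obtain \<sigma> q where \<sigma>: "well_formed \<sigma>" "2 \<le> fst \<sigma>" "cindec \<sigma>" "quot R \<sigma> q"
    using indecomposable_quotient_exists[OF wf[OF assms(1)] assms(2)] .
  let ?As = "comps R \<sigma> q"
  have As: "\<forall>A\<in>set ?As. fst A > 0 \<and> well_formed A" using comps_nonempty[OF \<sigma>(4)] by blast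
  have R: "infl \<sigma> ?As = R" by (rule infl_comps[OF wf[OF assms(1)] \<sigma>(4)])
  have "cemb \<sigma> (infl \<sigma> ?As)" by (rule cemb_quotient) (use \<sigma> As in auto)
  then have "\<sigma> \<in> C" using down[OF assms(1) \<sigma>(1)] \<sigma>(2) R by simp
  then have "\<sigma> \<in> simples" using \<sigma> by (simp add: simples_def)
  moreover have "inflation_of \<sigma> R"
    unfolding inflation_of_def using As R by (intro exI[of _ ?As]) simp
  ultimately show ?thesis by blast
qed

lemma cemb_point: "fst A = 1 \<Longrightarrow> fst B > 0 \<Longrightarrow> cemb A B"
  unfolding cemb_def by (rule exI[of _ "\<lambda>_. 0"]) (auto simp: strict_mono_on_def)

text \<open>The components of a minimal bad sequence are well-quasi-ordered. As there are finitely
  many possible quotients, a subsequence has a constant quotient; there two component tuples are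
  comparable, and inflation is monotone.\<close>

lemma wqo_on_cemb: "wqo_on cemb C"
proof (rule ccontr)
  assume "\<not> wqo_on cemb C"
  from minimal_bad_seq_exists[where sz = fst, OF this]
  obtain f where f: "minimal_bad_seq fst cemb C f" by (elim exE)
  then have fC: "f i \<in> C" and bad: "i < j \<Longrightarrow> \<not> cemb (f i) (f j)" for i j
    by (simp_all add: minimal_bad_seq_def bad_seq_def)
  \<comment> \<open>One-point structures embed in everything, so they cannot occur in a bad
    sequence.\<close>
  have size: "2 \<le> fst (f n)" for n
  proof (rule ccontr)
    assume "\<not> ?thesis"
    then have "fst (f n) = 1" using pos[OF fC[of n]] by simp
    then have "cemb (f n) (f (Suc n))" using pos[OF fC] by (rule cemb_point)
    then show False using bad[of n "Suc n"] by simp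
  qed
  have "\<forall>n. \<exists>\<sigma> As. \<sigma> \<in> simples \<and> length As = fst \<sigma> \<and> (\<forall>A\<in>set As. fst A > 0 \<and> well_formed A) \<and> f n = infl \<sigma> As"
    using decomposition[OF fC size] unfolding inflation_of_def by fast
  then obtain \<sigma> where "\<forall>n. \<exists>As. \<sigma> n \<in> simples \<and> length As = fst (\<sigma> n) \<and> (\<forall>A\<in>set As. fst A > 0 \<and> well_formed A) \<and> f n = infl (\<sigma> n) As"
    by (rule choice[THEN exE])
  then obtain As where dec: "\<forall>n. \<sigma> n \<in> simples \<and> length (As n) = fst (\<sigma> n) \<and> (\<forall>A\<in>set (As n). fst A > 0 \<and> well_formed A) \<and> f n = infl (\<sigma> n) (As n)"
    by (rule choice[THEN exE])
  have AsC: "set (As n) \<subseteq> C" for n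
    using infl_in_C[of "\<sigma> n" "As n"] dec fC[of n] by simp
  let ?T = "\<Union>n. set (As n)"
  have wqoT: "wqo_on cemb ?T"
  proof (rule wqo_on_parts_of_minimal_bad_seq[OF f])
    fix n A assume A: "A \<in> set (As n)"
    have "fst A < sum_list (map fst (As n))"
      using dec simplesD A by (intro sum_list_pos_less) auto
    then show "A \<in> C \<and> fst A < fst (f n)" using AsC A dec by (auto simp: fst_infl)
    fix B assume BA: "cemb B A"
    obtain p where "p < length (As n)" "A = As n ! p" using A by (metis in_set_conv_nth)
    moreover have "well_formed A" using dec A by blast
    ultimately have "cemb A (f n)" using cemb_component[of "As n" p "\<sigma> n"] dec by simp
    with BA show "cemb B (f n)" by (rule cemb_trans)
  qed
  have "\<exists>\<phi> :: nat \<Rightarrow> nat. strict_mono \<phi> \<and> (\<forall>i j. i < j \<longrightarrow> \<sigma> (\<phi> i) = \<sigma> (\<phi> j))"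
    using wqo_on_monotone_subsequence[OF wqo_on_eq_finite[OF finite_simples], of \<sigma>] dec by simp
  then obtain \<phi> :: "nat \<Rightarrow> nat" where \<phi>: "strict_mono \<phi>" "\<And>i j. i < j \<Longrightarrow> \<sigma> (\<phi> i) = \<sigma> (\<phi> j)" by auto
  have same: "\<sigma> (\<phi> i) = \<sigma> (\<phi> 0)" for i using \<phi>(2)[of 0 i] by (cases i) auto
  have inL: "As (\<phi> i) \<in> {xs. set xs \<subseteq> ?T \<and> length xs = fst (\<sigma> (\<phi> 0))}" for i
    using dec same[of i] by auto
  obtain i j where ij: "i < j" "list_all2 cemb (As (\<phi> i)) (As (\<phi> j))"
    using wqo_onD[OF wqo_on_lists[OF wqoT], of "\<lambda>i. As (\<phi> i)", OF inL] by (elim exE conjE)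
  then have "cemb (f (\<phi> i)) (f (\<phi> j))"
    using cemb_infl_mono[OF ij(2), of "\<sigma> (\<phi> 0)"] dec same[of i] same[of j] by simp
  then show False using bad[of "\<phi> i" "\<phi> j"] \<phi>(1) ij(1) by (simp add: strict_monoD)
qed

text \<open>No bound on the number of colours is assumed. An infinite level would contain two
  comparable structures, and those of equal size are equal.\<close>

lemma finite_levels_C: "finite_levels fst C"
  unfolding finite_levels_def
proof (rule allI, rule ccontr)
  fix n assume "infinite {R \<in> C. fst R = n}"
  then obtain f :: "nat \<Rightarrow> 'c cstr" where f: "inj f" "range f \<subseteq> {R \<in> C. fst R = n}"
    using infinite_countable_subset by blast
  have fC: "f i \<in> C" "fst (f i) = n" for i using f(2) by auto
  obtain i j where "i < j" "cemb (f i) (f j)" using wqo_onD[OF wqo_on_cemb, of f, OF fC(1)] by (elim exE conjE)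
  then have "f i = f j" using cemb_same_size_eq fC wf by metis
  then show False using f(1) \<open>i < j\<close> by (auto dest: injD)
qed

lemma down_closed_transfer:
  "down_closed cemb C D \<Longrightarrow> down_closed cemb D E \<Longrightarrow> down_closed cemb C E"
  unfolding down_closed_def by blast

lemma gf_const_coeff: "D \<subseteq> C \<Longrightarrow> fps_nth (gf fst D) 0 = 0"
proof -
  assume "D \<subseteq> C"
  then have "fst R \<noteq> 0" if "R \<in> D" for R using pos[of R] that by auto
  then have "{R \<in> D. fst R = 0} = {}" by blast
  then show ?thesis by (simp only: gf_nth card.empty of_nat_0)
qed

abbreviation reducibles :: "'c cstr \<Rightarrow> 'c cstr set \<Rightarrow> 'c cstr set" where
  "reducibles \<sigma> D \<equiv> {R \<in> D. reducible \<sigma> R}"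

text \<open>The second clause strengthens the induction: a box for a two-point quotient needs the
  irreducible part of a side, whose series is the difference of the two series named here.\<close>

definition algebraic_set :: "'c cstr set \<Rightarrow> bool" where
  "algebraic_set D \<longleftrightarrow> alg_fps (gf fst D) \<and>
     (\<forall>\<sigma>\<in>simples. fst \<sigma> = 2 \<longrightarrow> alg_fps (gf fst (reducibles \<sigma> D)))"

section \<open>The induction step for one hereditary subclass\<close>

context
  fixes D
  assumes D: "down_closed cemb C D"
    and IH: "\<And>E. down_closed cemb C E \<Longrightarrow> E \<subset> D \<Longrightarrow> algebraic_set E"
begin

definition tuples :: "'c cstr \<Rightarrow> 'c cstr list set" where
  "tuples \<sigma> = {As. set As \<subseteq> D \<and> length As = fst \<sigma> \<and> infl \<sigma> As \<in> D}"

lemma DC: "D \<subseteq> C" using D by (simp add: down_closed_def)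

lemma levels_D: "E \<subseteq> D \<Longrightarrow> finite_levels fst E"
  using finite_levels_subset[OF finite_levels_C] DC by blast

lemma inflations_eq:
  assumes \<sigma>: "\<sigma> \<in> simples"
  shows "{R \<in> D. inflation_of \<sigma> R} = infl \<sigma> ` tuples \<sigma>"
proof (intro equalityI subsetI)
  fix R assume "R \<in> {R \<in> D. inflation_of \<sigma> R}"
  then obtain As where As: "R \<in> D" "length As = fst \<sigma>" "\<forall>A\<in>set As. fst A > 0 \<and> well_formed A" "R = infl \<sigma> As"
    by (auto simp: inflation_of_def)
  have "set As \<subseteq> C" using infl_in_C[of \<sigma> As] As DC by auto
  have "set As \<subseteq> D"
  proof
    fix A assume A: "A \<in> set As"
    then obtain p where "p < length As" "A = As ! p" by (metis in_set_conv_nth)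
    then have "cemb A R" using cemb_component[of As p \<sigma>] A As by simp
    then show "A \<in> D" using D As(1) A \<open>set As \<subseteq> C\<close> unfolding down_closed_def by blast
  qed
  then show "R \<in> infl \<sigma> ` tuples \<sigma>" using As by (auto simp: tuples_def)
next
  fix R assume "R \<in> infl \<sigma> ` tuples \<sigma>"
  then obtain As where "set As \<subseteq> D" "length As = fst \<sigma>" "infl \<sigma> As \<in> D" "R = infl \<sigma> As"
    by (auto simp: tuples_def)
  moreover have "\<forall>A\<in>set As. fst A > 0 \<and> well_formed A"
    using \<open>set As \<subseteq> D\<close> wf pos DC by blast
  ultimately show "R \<in> {R \<in> D. inflation_of \<sigma> R}"
    unfolding inflation_of_def by (intro CollectI conjI exI[of _ As]) auto
qed

text \<open>Shrinking the components shrinks the inflation, so the tuples are down-closed. The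
  inflation is checked to have points because \<open>down\<close> speaks of nonempty
  structures.\<close>

lemma tuples_boxes:
  assumes \<sigma>: "\<sigma> \<in> simples"
  shows "\<exists>G. finite G \<and> G \<subseteq> boxes {E. down_closed cemb D E} (fst \<sigma>) \<and> tuples \<sigma> = \<Union>G"
proof (rule down_closed_tuples_finite_Union_boxes)
  show "wqo_on cemb D" using wqo_on_subset[OF wqo_on_cemb DC] .
  show "down_closed (list_all2 cemb) {xs. set xs \<subseteq> D \<and> length xs = fst \<sigma>} (tuples \<sigma>)"
    unfolding down_closed_def
  proof (intro conjI ballI impI)
    fix As Bs assume As: "As \<in> tuples \<sigma>" and Bs: "Bs \<in> {xs. set xs \<subseteq> D \<and> length xs = fst \<sigma>}"
      and le: "list_all2 cemb Bs As"
    have emb: "cemb (infl \<sigma> Bs) (infl \<sigma> As)" by (rule cemb_infl_mono[OF le])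
    have len: "length Bs = fst \<sigma>" "2 \<le> fst \<sigma>" using Bs simplesD[OF \<sigma>] by auto
    have posB: "\<forall>A\<in>set Bs. fst A > 0" using Bs DC pos by auto
    obtain A where "A \<in> set Bs" using len by (cases Bs) auto
    then have "0 < fst (infl \<sigma> Bs)" using sum_list_pos_less[of Bs A] posB len by (simp add: fst_infl)
    moreover have inD: "infl \<sigma> As \<in> D" using As by (simp add: tuples_def)
    ultimately have "infl \<sigma> Bs \<in> C" using down[OF _ well_formed_infl _ emb] DC by blast
    then have "infl \<sigma> Bs \<in> D" using D inD emb unfolding down_closed_def by blast
    then show "Bs \<in> tuples \<sigma>" using Bs by (simp add: tuples_def)
  qed (auto simp: tuples_def)
qed (rule cemb_trans)

lemma gf_side:
  assumes "down_closed cemb D E"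
  shows "E = D \<or> (alg_fps (gf fst E) \<and> fps_nth (gf fst E) 0 = 0 \<and>
    (\<forall>\<sigma>\<in>simples. fst \<sigma> = 2 \<longrightarrow> alg_fps (gf fst (reducibles \<sigma> E))))"
proof (cases "E = D")
  case False
  have ED: "E \<subseteq> D" using assms by (simp add: down_closed_def)
  then have "algebraic_set E" using IH[OF down_closed_transfer[OF D assms]] False by auto
  moreover have "fps_nth (gf fst E) 0 = 0" using gf_const_coeff[of E] ED DC by simp
  ultimately show ?thesis by (simp add: algebraic_set_def)
qed simp

lemma gf_side_idealJ1:
  assumes "down_closed cemb D E"
  shows "gf fst E \<in> (\<lambda>p. poly p (gf fst D)) ` idealJ1"
  using gf_side[OF assms] idealJ1_values(1)[of "gf fst E"] idealJ1_values(2)[of "gf fst D"] by auto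

text \<open>With three points in \<sigma> the inflation determines the tuple, so tuples can be
  counted instead. The values of \<open>idealJ\<close> at the series of \<open>D\<close> form a
  subgroup, which is what inclusion-exclusion asks for.\<close>

lemma gf_big_inflations:
  assumes \<sigma>: "\<sigma> \<in> simples" "3 \<le> fst \<sigma>"
  shows "gf fst {R \<in> D. inflation_of \<sigma> R} \<in> fractions (gf fst D)"
proof -
  let ?w = "\<lambda>xs. sum_list (map fst xs)" and ?M = "(\<lambda>p. poly p (gf fst D)) ` idealJ"
  let ?F = "boxes {E. down_closed cemb D E} (fst \<sigma>)"
  have "inj_on (infl \<sigma>) (tuples \<sigma>)"
  proof (rule inj_onI)
    fix As Bs assume AB: "As \<in> tuples \<sigma>" "Bs \<in> tuples \<sigma>" "infl \<sigma> As = infl \<sigma> Bs"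
    have "\<sigma> = \<sigma> \<and> As = Bs"
      by (rule infl_unique[OF AB(3)]) (use AB \<sigma> simplesD[OF \<sigma>(1)] wf pos DC in \<open>auto simp: tuples_def\<close>)
    then show "As = Bs" by simp
  qed
  then have "gf fst (infl \<sigma> ` tuples \<sigma>) = gf ?w (tuples \<sigma>)" by (rule gf_bij) (simp add: fst_infl)
  moreover obtain G where G: "finite G" "G \<subseteq> ?F" "tuples \<sigma> = \<Union>G" using tuples_boxes[OF \<sigma>(1)] by blast
  have "gf ?w (\<Union>G) \<in> ?M"
  proof (rule gf_Union_in_subgroup[of ?F])
    show "X \<inter> Y \<in> ?F" if "X \<in> ?F" "Y \<in> ?F" for X Y
      using that by (intro boxes_Int) (auto intro: down_closed_Int)
    have box: "finite_levels ?w X \<and> gf ?w X \<in> ?M" if XF: "X \<in> ?F" for X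
    proof -
      obtain Ds where Ds: "X = listset Ds" "length Ds = fst \<sigma>" "set Ds \<subseteq> {E. down_closed cemb D E}"
        using XF unfolding boxes_def by blast
      have "finite_levels fst E" if "E \<in> set Ds" for E
        using Ds(3) that levels_D by (auto simp: down_closed_def)
      then have "gf ?w X = prod_list (map (gf fst) Ds)" "finite_levels ?w X"
        using gf_listset[of Ds fst] Ds(1) by auto
      moreover have "prod_list (map (gf fst) Ds) \<in> ?M"
        using Ds \<sigma>(2) gf_side_idealJ1 by (intro prod_list_idealJ_values) auto
      ultimately show ?thesis by simp
    qed
    show "finite_levels ?w X" "gf ?w X \<in> ?M" if "X \<in> ?F" for X using box[OF that] by auto
    show "0 \<in> ?M" using idealJ_0 by (intro image_eqI[of _ _ 0]) auto
    show "x + y \<in> ?M" if "x \<in> ?M" "y \<in> ?M" for x y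
    proof -
      obtain p q where "p \<in> idealJ" "q \<in> idealJ" "x = poly p (gf fst D)" "y = poly q (gf fst D)"
        using \<open>x \<in> ?M\<close> \<open>y \<in> ?M\<close> by auto
      then show ?thesis using idealJ_add by (intro image_eqI[of _ _ "p + q"]) auto
    qed
    show "x - y \<in> ?M" if "x \<in> ?M" "y \<in> ?M" for x y
    proof -
      obtain p q where "p \<in> idealJ" "q \<in> idealJ" "x = poly p (gf fst D)" "y = poly q (gf fst D)"
        using \<open>x \<in> ?M\<close> \<open>y \<in> ?M\<close> by auto
      then show ?thesis using idealJ_diff by (intro image_eqI[of _ _ "p - q"]) auto
    qed
  qed (use G in auto)
  ultimately have "gf fst {R \<in> D. inflation_of \<sigma> R} \<in> ?M" using inflations_eq[OF \<sigma>(1)] G(3) by simp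
  then show ?thesis using fractions_poly by auto
qed

text \<open>For a two-point quotient the first component has to be irreducible, so the series \<open>w\<close> of
  the reducible structures occurs on both sides of the equation.\<close>

lemma gf_two_inflations:
  assumes \<sigma>: "\<sigma> \<in> simples" "fst \<sigma> = 2"
  shows "gf fst (reducibles \<sigma> D) \<in> fractions (gf fst D)"
proof -
  let ?v = "\<lambda>xs. sum_list (map fst xs)" and ?Irr = "{A. \<not> reducible \<sigma> A}"
  define h where "h = gf fst D"
  define w where "w = gf fst (reducibles \<sigma> D)"
  \<comment> \<open>The shape of a box: a side equal to \<open>D\<close> contributes
    \<open>h - w\<close> in the first place and \<open>h\<close> in the second, any other side an
    algebraic series vanishing at 0. Only the coefficient of the product may have a constant
    term.\<close>
  define M where "M = {\<alpha> + \<beta> * (h - w) + \<gamma> * h + \<delta> * ((h - w) * h) | \<alpha> \<beta> \<gamma> \<delta>.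
    alg_fps \<alpha> \<and> alg_fps \<beta> \<and> alg_fps \<gamma> \<and> alg_fps \<delta> \<and> fps_nth \<alpha> 0 = 0 \<and> fps_nth \<beta> 0 = 0 \<and> fps_nth \<gamma> 0 = 0}"
  have MI: "\<alpha> + \<beta> * (h - w) + \<gamma> * h + \<delta> * ((h - w) * h) \<in> M"
    if "alg_fps \<alpha>" "alg_fps \<beta>" "alg_fps \<gamma>" "alg_fps \<delta>" "fps_nth \<alpha> 0 = 0" "fps_nth \<beta> 0 = 0" "fps_nth \<gamma> 0 = 0"
    for \<alpha> \<beta> \<gamma> \<delta> unfolding M_def using that by blast
  define F where "F = {listset [E \<inter> ?Irr, E'] | E E'. down_closed cemb D E \<and> down_closed cemb D E'}"
  \<comment> \<open>These pairs parametrize the reducible structures of \<open>D\<close>, each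
    exactly once.\<close>
  define Y where "Y = tuples \<sigma> \<inter> listset [?Irr, UNIV]"
  obtain G where G: "finite G" "G \<subseteq> boxes {E. down_closed cemb D E} (fst \<sigma>)" "tuples \<sigma> = \<Union>G"
    using tuples_boxes[OF \<sigma>(1)] by blast
  let ?G = "(\<lambda>X. X \<inter> listset [?Irr, UNIV]) ` G"
  have GF: "?G \<subseteq> F"
  proof
    fix X assume "X \<in> ?G"
    then obtain X' where X': "X' \<in> G" "X = X' \<inter> listset [?Irr, UNIV]" by blast
    then have "X' \<in> boxes {E. down_closed cemb D E} (fst \<sigma>)" using G(2) by blast
    then obtain Ds where "X' = listset Ds" "length Ds = fst \<sigma>" "set Ds \<subseteq> {E. down_closed cemb D E}"
      unfolding boxes_def by blast
    then have Ds: "X = listset Ds \<inter> listset [?Irr, UNIV]" "length Ds = 2"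
      "set Ds \<subseteq> {E. down_closed cemb D E}" using X' \<sigma>(2) by simp_all
    obtain E E' where E: "Ds = [E, E']" using Ds(2) by (cases Ds; cases "tl Ds") auto
    have "X = listset [E \<inter> ?Irr, E']" unfolding Ds(1) E by (subst listset_Int) simp_all
    then show "X \<in> F" using Ds(3) E unfolding F_def by auto
  qed
  have "infl \<sigma> ` Y = reducibles \<sigma> D"
  proof (intro equalityI subsetI)
    fix R assume "R \<in> infl \<sigma> ` Y"
    then have "R \<in> {R \<in> D. inflation_of \<sigma> R}" unfolding inflations_eq[OF \<sigma>(1)] by (auto simp: Y_def)
    then show "R \<in> reducibles \<sigma> D" by (simp add: inflation_of_two[OF \<sigma>(2)])
  next
    fix R assume R: "R \<in> reducibles \<sigma> D"
    then have "reducible \<sigma> R" by simp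
    from infl_two_exists[OF \<sigma>(2) this] obtain A B where AB: "well_formed A" "fst A > 0"
      "\<not> reducible \<sigma> A" "well_formed B" "fst B > 0" "R = infl \<sigma> [A, B]" by metis
    have "set [A, B] \<subseteq> C" by (rule infl_in_C[of \<sigma>]) (use AB R DC \<sigma> in auto)
    moreover have "cemb A R" "cemb B R"
      using cemb_component[of "[A, B]" 0 \<sigma>] cemb_component[of "[A, B]" 1 \<sigma>] AB by auto
    ultimately have "A \<in> D" "B \<in> D" using D R unfolding down_closed_def by auto
    then have "[A, B] \<in> Y" using AB R \<sigma> by (simp add: Y_def tuples_def in_listset_iff del: listset.simps)
    then show "R \<in> infl \<sigma> ` Y" using AB by blast
  qed
  moreover have "inj_on (infl \<sigma>) Y"
  proof (rule inj_onI)
    fix As Bs assume AB: "As \<in> Y" "Bs \<in> Y" "infl \<sigma> As = infl \<sigma> Bs"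
    obtain A B where As: "As = [A, B]" "\<not> reducible \<sigma> A"
      using AB(1) by (auto simp: Y_def in_listset_iff list_all2_Cons2 simp del: listset.simps)
    obtain A' B' where Bs: "Bs = [A', B']" "\<not> reducible \<sigma> A'"
      using AB(2) by (auto simp: Y_def in_listset_iff list_all2_Cons2 simp del: listset.simps)
    have "A \<in> C" "B \<in> C" "A' \<in> C" "B' \<in> C" using AB As Bs DC by (auto simp: Y_def tuples_def)
    then have "A = A' \<and> B = B'" using AB(3) As Bs wf pos by (intro infl_two_unique[OF \<sigma>(2)]) auto
    then show "As = Bs" using As Bs by simp
  qed
  then have "gf fst (infl \<sigma> ` Y) = gf ?v Y" by (rule gf_bij) (simp add: fst_infl)
  ultimately have wY: "w = gf ?v Y" by (simp add: w_def)
  have "gf ?v (\<Union>?G) \<in> M"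
  proof (rule gf_Union_in_subgroup[of F])
    show "X \<inter> X' \<in> F" if "X \<in> F" "X' \<in> F" for X X'
    proof -
      obtain E1 E2 E1' E2' where *: "X = listset [E1 \<inter> ?Irr, E2]" "X' = listset [E1' \<inter> ?Irr, E2']"
        "down_closed cemb D E1" "down_closed cemb D E2" "down_closed cemb D E1'" "down_closed cemb D E2'"
        using \<open>X \<in> F\<close> \<open>X' \<in> F\<close> unfolding F_def by auto
      have "X \<inter> X' = listset [(E1 \<inter> ?Irr) \<inter> (E1' \<inter> ?Irr), E2 \<inter> E2']"
        unfolding *(1,2) by (subst listset_Int) simp_all
      also have "(E1 \<inter> ?Irr) \<inter> (E1' \<inter> ?Irr) = (E1 \<inter> E1') \<inter> ?Irr" by auto
      finally show ?thesis using * down_closed_Int unfolding F_def by blast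
    qed
    have box: "finite_levels ?v X \<and> gf ?v X \<in> M" if XF: "X \<in> F" for X
    proof -
      obtain E E' where X: "X = listset [E \<inter> ?Irr, E']" and E: "down_closed cemb D E" "down_closed cemb D E'"
        using XF unfolding F_def by blast
      have sub: "E \<subseteq> D" "E' \<subseteq> D" using E by (auto simp: down_closed_def)
      have lev: "finite_levels fst A" if "A \<in> set [E \<inter> ?Irr, E']" for A
        using that sub by (auto intro!: levels_D)
      have *: "gf ?v X = gf fst (E \<inter> ?Irr) * gf fst E'" "finite_levels ?v X"
        using gf_listset[of "[E \<inter> ?Irr, E']" fst, OF lev] X by auto
      \<comment> \<open>The irreducible part need not be hereditary, so its series is obtained as a
        difference.\<close>
      have Esplit: "E = (E \<inter> ?Irr) \<union> reducibles \<sigma> E" by auto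
      have "gf fst ((E \<inter> ?Irr) \<union> reducibles \<sigma> E) = gf fst (E \<inter> ?Irr) + gf fst (reducibles \<sigma> E)"
        by (rule gf_Un_disjoint) (use sub in \<open>auto intro!: levels_D\<close>)
      then have irr: "gf fst (E \<inter> ?Irr) = gf fst E - gf fst (reducibles \<sigma> E)"
        using Esplit by simp
      have irr0: "fps_nth (gf fst (E \<inter> ?Irr)) 0 = 0" using gf_const_coeff[of "E \<inter> ?Irr"] sub DC by auto
      have left: "gf fst (E \<inter> ?Irr) = h - w \<or> (alg_fps (gf fst (E \<inter> ?Irr)) \<and> fps_nth (gf fst (E \<inter> ?Irr)) 0 = 0)"
        using gf_side[OF E(1)] irr irr0 \<sigma> by (auto simp: h_def w_def alg_fps_diff)
      have right: "gf fst E' = h \<or> (alg_fps (gf fst E') \<and> fps_nth (gf fst E') 0 = 0)"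
        using gf_side[OF E(2)] by (auto simp: h_def)
      have "gf fst (E \<inter> ?Irr) * gf fst E' \<in> M"
        using left right
      proof (elim disjE conjE)
        assume "gf fst (E \<inter> ?Irr) = h - w" "gf fst E' = h"
        then show ?thesis using MI[of 0 0 0 1] by simp
      next
        assume "gf fst (E \<inter> ?Irr) = h - w" "alg_fps (gf fst E')" "fps_nth (gf fst E') 0 = 0"
        then show ?thesis using MI[of 0 "gf fst E'" 0 0] by (simp add: mult.commute)
      next
        assume "gf fst E' = h" "alg_fps (gf fst (E \<inter> ?Irr))" "fps_nth (gf fst (E \<inter> ?Irr)) 0 = 0"
        then show ?thesis using MI[of 0 0 "gf fst (E \<inter> ?Irr)" 0] by simp
      next
        assume "alg_fps (gf fst (E \<inter> ?Irr))" "fps_nth (gf fst (E \<inter> ?Irr)) 0 = 0"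
          "alg_fps (gf fst E')" "fps_nth (gf fst E') 0 = 0"
        then show ?thesis using MI[of "gf fst (E \<inter> ?Irr) * gf fst E'" 0 0 0] by (simp add: alg_fps_mult)
      qed
      then show ?thesis using * by simp
    qed
    show "finite_levels ?v X" "gf ?v X \<in> M" if "X \<in> F" for X using box[OF that] by auto
    show "0 \<in> M" using MI[of 0 0 0 0] by simp
    show "x + y \<in> M" if xy: "x \<in> M" "y \<in> M" for x y
    proof -
      obtain a b c d where x: "x = a + b * (h - w) + c * h + d * ((h - w) * h)" "alg_fps a" "alg_fps b"
        "alg_fps c" "alg_fps d" "fps_nth a 0 = 0" "fps_nth b 0 = 0" "fps_nth c 0 = 0"
        using xy(1) unfolding M_def by blast
      obtain a' b' c' d' where y: "y = a' + b' * (h - w) + c' * h + d' * ((h - w) * h)" "alg_fps a'" "alg_fps b'"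
        "alg_fps c'" "alg_fps d'" "fps_nth a' 0 = 0" "fps_nth b' 0 = 0" "fps_nth c' 0 = 0"
        using xy(2) unfolding M_def by blast
      have eq: "x + y = (a + a') + (b + b') * (h - w) + (c + c') * h + (d + d') * ((h - w) * h)"
        unfolding x(1) y(1) by (simp add: distrib_right)
      show ?thesis unfolding eq by (rule MI) (use x(2-) y(2-) in \<open>simp_all add: alg_fps_add\<close>)
    qed
    show "x - y \<in> M" if xy: "x \<in> M" "y \<in> M" for x y
    proof -
      obtain a b c d where x: "x = a + b * (h - w) + c * h + d * ((h - w) * h)" "alg_fps a" "alg_fps b"
        "alg_fps c" "alg_fps d" "fps_nth a 0 = 0" "fps_nth b 0 = 0" "fps_nth c 0 = 0"
        using xy(1) unfolding M_def by blast
      obtain a' b' c' d' where y: "y = a' + b' * (h - w) + c' * h + d' * ((h - w) * h)" "alg_fps a'" "alg_fps b'"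
        "alg_fps c'" "alg_fps d'" "fps_nth a' 0 = 0" "fps_nth b' 0 = 0" "fps_nth c' 0 = 0"
        using xy(2) unfolding M_def by blast
      have eq: "x - y = (a - a') + (b - b') * (h - w) + (c - c') * h + (d - d') * ((h - w) * h)"
        unfolding x(1) y(1) by (simp add: left_diff_distrib)
      show ?thesis unfolding eq by (rule MI) (use x(2-) y(2-) in \<open>simp_all add: alg_fps_diff\<close>)
    qed
  qed (use G GF in auto)
  moreover have "\<Union>?G = Y" using G(3) by (auto simp: Y_def)
  ultimately have "w \<in> M" using wY by simp
  then obtain a b c d where w: "w = a + b * (h - w) + c * h + d * ((h - w) * h)" and alg: "alg_fps a" "alg_fps b"
    "alg_fps c" "alg_fps d" "fps_nth a 0 = 0" "fps_nth b 0 = 0" "fps_nth c 0 = 0"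
    unfolding M_def by blast
  \<comment> \<open>Moving the terms with \<open>w\<close> to the left gives the denominator. The
    rest, \<open>a + (b + c) * h + d * h^2\<close>, comes from (x, Y^2) because \<open>a\<close>,
    \<open>b\<close> and \<open>c\<close> vanish at 0.\<close>
  have "w * (1 + b + h * d) = (a + b * (h - w) + c * h + d * ((h - w) * h)) + w * (b + h * d)"
    using w by (simp add: algebra_simps)
  also have "\<dots> = a + h * (b + c + h * d)" by (simp add: algebra_simps)
  finally have "w * poly [:1 + b, d:] h = poly [:a, b + c, d:] h" by simp
  moreover have "alg_poly [:1 + b, d:]" using alg by (intro alg_poly_pCons alg_fps_add) auto
  moreover have "[:a, b + c, d:] \<in> idealJ"
    unfolding idealJ_def using alg by (auto intro!: alg_poly_pCons alg_fps_add)
  moreover have "fps_nth (coeff [:1 + b, d:] 0) 0 = 1" using alg by simp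
  ultimately show ?thesis unfolding fractions_def h_def w_def by blast
qed

lemma gf_inflations: "\<sigma> \<in> simples \<Longrightarrow> gf fst {R \<in> D. inflation_of \<sigma> R} \<in> fractions (gf fst D)"
proof (cases "fst \<sigma> = 2")
  case True
  assume "\<sigma> \<in> simples"
  from gf_two_inflations[OF this True] show ?thesis by (simp add: inflation_of_two[OF True])
next
  case False
  assume \<sigma>: "\<sigma> \<in> simples"
  then have "3 \<le> fst \<sigma>" using simplesD[OF \<sigma>] False by simp
  from gf_big_inflations[OF \<sigma> this] show ?thesis .
qed

text \<open>\<open>D\<close> is the disjoint union of its one-point structures and, for each
  \<sigma>, the inflations of \<sigma>. Every part has its series in \<open>fractions\<close>, and
  membership of the total in its own \<open>fractions\<close> is the equation sought.\<close>

lemma algebraic_step: "algebraic_set D"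
proof -
  let ?h = "gf fst D" and ?P = "{R \<in> D. fst R = 1}"
  let ?I = "\<lambda>\<sigma>. {R \<in> D. inflation_of \<sigma> R}"
  have disj: "?I \<sigma> \<inter> ?I \<tau> = {}" if st: "\<sigma> \<in> simples" "\<tau> \<in> simples" "\<sigma> \<noteq> \<tau>" for \<sigma> \<tau>
  proof (rule ccontr)
    assume "?I \<sigma> \<inter> ?I \<tau> \<noteq> {}"
    then obtain R where R: "inflation_of \<sigma> R" "inflation_of \<tau> R" by blast
    note \<sigma> = simplesD[OF st(1)] and \<tau> = simplesD[OF st(2)]
    obtain As where As: "length As = fst \<sigma>" "\<forall>A\<in>set As. fst A > 0 \<and> well_formed A" "R = infl \<sigma> As"
      using R(1) by (auto simp: inflation_of_def)
    obtain Bs where Bs: "length Bs = fst \<tau>" "\<forall>A\<in>set Bs. fst A > 0 \<and> well_formed A" "R = infl \<tau> Bs"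
      using R(2) by (auto simp: inflation_of_def)
    have "\<sigma> = \<tau>"
    proof (cases "fst \<sigma> = 2 \<and> fst \<tau> = 2")
      case True
      then show ?thesis using R \<sigma> \<tau> infl_two_quotient_unique[of \<sigma> \<tau> R] by (simp add: inflation_of_two)
    next
      case False
      \<comment> \<open>\<open>infl_unique\<close> requires three points of its first quotient and
        only two of the second, so one of the two orders applies.\<close>
      then consider "3 \<le> fst \<sigma>" | "3 \<le> fst \<tau>" using \<sigma> \<tau> by linarith
      then show ?thesis
      proof cases
        case 1
        have "\<sigma> = \<tau> \<and> As = Bs" by (rule infl_unique) (use 1 \<sigma> \<tau> As Bs in auto)
        then show ?thesis ..
      next
        case 2
        have "\<tau> = \<sigma> \<and> Bs = As" by (rule infl_unique) (use 2 \<sigma> \<tau> As Bs in auto)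
        then show ?thesis by simp
      qed
    qed
    then show False using st(3) by simp
  qed
  have big: "2 \<le> fst R" if \<sigma>: "\<sigma> \<in> simples" and R: "inflation_of \<sigma> R" for \<sigma> R
  proof -
    obtain As where As: "length As = fst \<sigma>" "\<forall>A\<in>set As. fst A > 0 \<and> well_formed A" "R = infl \<sigma> As"
      using R by (auto simp: inflation_of_def)
    have len: "2 \<le> length As" using simplesD[OF \<sigma>] As by simp
    then obtain A where A: "A \<in> set As" by (cases As) auto
    have "fst A < fst R" using sum_list_pos_less[OF len _ A] As by (simp add: fst_infl)
    moreover have "fst A > 0" using As A by simp
    ultimately show ?thesis by simp
  qed
  have split: "D = ?P \<union> (\<Union>\<sigma>\<in>simples. ?I \<sigma>)"
  proof (intro equalityI subsetI)
    fix R assume R: "R \<in> D"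
    then have RC: "R \<in> C" using DC by blast
    show "R \<in> ?P \<union> (\<Union>\<sigma>\<in>simples. ?I \<sigma>)"
    proof (cases "fst R = 1")
      case False
      then have "2 \<le> fst R" using pos[OF RC] by simp
      from decomposition[OF RC this] show ?thesis using R by blast
    qed (use R in auto)
  qed auto
  have "gf fst (?P \<union> (\<Union>\<sigma>\<in>simples. ?I \<sigma>)) = gf fst ?P + gf fst (\<Union>\<sigma>\<in>simples. ?I \<sigma>)"
  proof (rule gf_Un_disjoint)
    show "?P \<inter> (\<Union>\<sigma>\<in>simples. ?I \<sigma>) = {}" using big by fastforce
  qed (auto intro!: levels_D)
  also have "gf fst (\<Union>\<sigma>\<in>simples. ?I \<sigma>) = (\<Sum>\<sigma>\<in>simples. gf fst (?I \<sigma>))"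
    by (rule gf_UN_disjoint[OF finite_simples levels_D[OF order_refl] _ disj]) auto
  finally have h: "?h = gf fst ?P + (\<Sum>\<sigma>\<in>simples. gf fst (?I \<sigma>))" using split by simp
  have "gf fst ?P = fps_of_poly (monom (of_nat (card ?P)) 1)"
  proof (rule fps_ext)
    fix n
    have "{R \<in> ?P. fst R = n} = (if n = 1 then ?P else {})" by auto
    then show "fps_nth (gf fst ?P) n = fps_nth (fps_of_poly (monom (of_nat (card ?P)) 1)) n"
      by (simp add: gf_nth)
  qed
  then have "alg_fps (gf fst ?P)" by (simp only: alg_fps_of_poly)
  moreover have "fps_nth (gf fst ?P) 0 = 0" by (rule gf_const_coeff) (use DC in auto)
  ultimately have "[:gf fst ?P:] \<in> idealJ" by (simp add: idealJ_def alg_poly_pCons)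
  from fractions_poly[OF this, of ?h] have "gf fst ?P \<in> fractions ?h" by simp
  moreover have "(\<Sum>\<sigma>\<in>simples. gf fst (?I \<sigma>)) \<in> fractions ?h" by (rule fractions_sum) (rule gf_inflations)
  ultimately have "gf fst ?P + (\<Sum>\<sigma>\<in>simples. gf fst (?I \<sigma>)) \<in> fractions ?h" by (rule fractions_add)
  then have "?h \<in> fractions ?h" unfolding h[symmetric] .
  then have alg: "alg_fps ?h" by (rule alg_fps_of_fractions_self)
  show ?thesis unfolding algebraic_set_def
  proof (intro conjI ballI impI)
    fix \<sigma> assume "\<sigma> \<in> simples" "fst \<sigma> = 2"
    then have "gf fst (reducibles \<sigma> D) \<in> fractions ?h" by (rule gf_two_inflations)
    then show "alg_fps (gf fst (reducibles \<sigma> D))"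
      using alg gf_const_coeff[OF DC] by (rule alg_fps_fractions)
  qed (rule alg)
qed

end

theorem alg_fps_gf: "alg_fps (gf fst C)"
proof -
  have "algebraic_set D" if "down_closed cemb C D" for D
    using wf_down_closed_psubset[OF wqo_on_cemb] that
  proof (induction D rule: wf_induct_rule)
    case (less D)
    show ?case
    proof (rule algebraic_step[OF less.prems])
      fix E assume "down_closed cemb C E" "E \<subset> D"
      then show "algebraic_set E" using less.IH[of E] less.prems by simp
    qed
  qed
  from this[OF down_closed_self] show ?thesis by (simp add: algebraic_set_def)
qed

end

section \<open>Ordered binary structures\<close>

text \<open>Both directions are recorded because only pairs with \<open>x\<close> before
  \<open>y\<close> get a colour. The diagonal carries no information in \<open>Gamma k\<close>,
  where all relations are reflexive.\<close>

definition col :: "'a obs \<Rightarrow> 'a \<Rightarrow> 'a \<Rightarrow> (bool \<times> bool) list" where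
  "col R x y = map (\<lambda>\<rho>. ((x, y) \<in> \<rho>, (y, x) \<in> \<rho>)) (rels R)"

definition presents :: "'a obs \<Rightarrow> (bool \<times> bool) list cstr \<Rightarrow> (nat \<Rightarrow> 'a) \<Rightarrow> bool" where
  "presents R A e \<longleftrightarrow> well_formed A \<and> bij_betw e {..<fst A} (elems R) \<and>
     (\<forall>i j. i < j \<and> j < fst A \<longrightarrow> (e i, e j) \<in> ord R \<and> snd A i j = col R (e i) (e j))"

lemma GammaD:
  assumes "R \<in> Gamma k"
  shows "finite (elems R)" "length (rels R) = k"
    "\<And>\<rho> x. \<rho> \<in> set (rels R) \<Longrightarrow> x \<in> elems R \<Longrightarrow> (x, x) \<in> \<rho>"
    "\<And>x. x \<in> elems R \<Longrightarrow> (x, x) \<in> ord R"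
    "\<And>x y z. (x, y) \<in> ord R \<Longrightarrow> (y, z) \<in> ord R \<Longrightarrow> (x, z) \<in> ord R"
    "\<And>x y. (x, y) \<in> ord R \<Longrightarrow> (y, x) \<in> ord R \<Longrightarrow> x = y"
    "\<And>x y. x \<in> elems R \<Longrightarrow> y \<in> elems R \<Longrightarrow> (x, y) \<in> ord R \<or> (y, x) \<in> ord R"
    "ord R \<subseteq> elems R \<times> elems R"
proof -
  have lin: "linear_order_on (elems R) (ord R)" and ref: "\<forall>\<rho>\<in>set (rels R). refl_on (elems R) \<rho>"
    using assms by (auto simp: Gamma_def ordered_binary_structure_def)
  show "finite (elems R)" "length (rels R) = k"
    using assms by (auto simp: Gamma_def ordered_binary_structure_def)
  show "(x, x) \<in> \<rho>" if "\<rho> \<in> set (rels R)" "x \<in> elems R" for \<rho> x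
    using ref that by (auto dest: refl_onD)
  have parts: "refl_on (elems R) (ord R)" "trans (ord R)" "antisym (ord R)" "total_on (elems R) (ord R)"
    using lin by (auto simp: linear_order_on_def partial_order_on_def preorder_on_def)
  show r: "(x, x) \<in> ord R" if "x \<in> elems R" for x using parts(1) that by (rule refl_onD)
  show "(x, z) \<in> ord R" if "(x, y) \<in> ord R" "(y, z) \<in> ord R" for x y z using parts(2) that by (rule transD)
  show "x = y" if "(x, y) \<in> ord R" "(y, x) \<in> ord R" for x y using parts(3) that by (rule antisymD)
  show "(x, y) \<in> ord R \<or> (y, x) \<in> ord R" if "x \<in> elems R" "y \<in> elems R" for x y
    using parts(4) that r unfolding total_on_def by (cases "x = y") auto
  show "ord R \<subseteq> elems R \<times> elems R"
    using lin by (auto simp: linear_order_on_def partial_order_on_def preorder_on_def)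
qed

lemma presents_exists:
  assumes R: "R \<in> Gamma k"
  shows "\<exists>A e. presents R A e"
proof -
  note G = GammaD[OF R]
  let ?E = "elems R"
  define below where "below x = {y \<in> ?E. (y, x) \<in> ord R \<and> y \<noteq> x}" for x
  \<comment> \<open>Counting strict predecessors gives the position of a point; the inverse of
    \<open>rank\<close> is the presentation.\<close>
  define rank where "rank x = card (below x)" for x
  have fin: "finite (below x)" for x using G(1) by (simp add: below_def)
  have less: "rank x < rank y" if xy: "x \<in> ?E" "(x, y) \<in> ord R" "x \<noteq> y" for x y
    unfolding rank_def
  proof (rule psubset_card_mono[OF fin])
    have "below x \<subseteq> below y"
    proof
      fix z assume z: "z \<in> below x"
      have "(z, y) \<in> ord R" using G(5) z xy by (auto simp: below_def)
      moreover have "z \<noteq> y" using G(6)[of x y] z xy by (auto simp: below_def)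
      ultimately show "z \<in> below y" using z by (simp add: below_def)
    qed
    moreover have "x \<in> below y" "x \<notin> below x" using xy by (auto simp: below_def)
    ultimately show "below x \<subset> below y" by blast
  qed
  have inj: "inj_on rank ?E"
  proof (rule inj_onI, rule ccontr)
    fix x y assume "x \<in> ?E" "y \<in> ?E" "rank x = rank y" "x \<noteq> y"
    then show False using G(7)[of x y] less[of x y] less[of y x] by auto
  qed
  have "rank x < card ?E" if "x \<in> ?E" for x
    unfolding rank_def by (rule psubset_card_mono[OF G(1)]) (use that in \<open>auto simp: below_def\<close>)
  then have sub: "rank ` ?E \<subseteq> {..<card ?E}" by auto
  have "rank ` ?E = {..<card ?E}"
    by (rule card_subset_eq) (use sub inj in \<open>auto simp: card_image\<close>)
  then have bij: "bij_betw rank ?E {..<card ?E}" using inj by (simp add: bij_betw_def)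
  let ?e = "inv_into ?E rank"
  let ?A = "canon {..<card ?E} (\<lambda>i j. col R (?e i) (?e j))"
  have e: "bij_betw ?e {..<card ?E} ?E" by (rule bij_betw_inv_into[OF bij])
  have "(?e i, ?e j) \<in> ord R" if ij: "i < j" "j < card ?E" for i j
  proof (rule ccontr)
    have E: "?e i \<in> ?E" "?e j \<in> ?E" using e ij by (auto dest: bij_betwE)
    have r: "rank (?e i) = i" "rank (?e j) = j"
      using bij_betw_inv_into_right[OF bij, of i] bij_betw_inv_into_right[OF bij, of j] ij by auto
    assume "(?e i, ?e j) \<notin> ord R"
    then have "(?e j, ?e i) \<in> ord R" using G(7)[OF E] by blast
    moreover have "?e j \<noteq> ?e i" using r ij by auto
    ultimately have "rank (?e j) < rank (?e i)" using less[OF E(2)] by blast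
    then show False using r ij by simp
  qed
  then have "presents R ?A ?e" unfolding presents_def using e by (simp add: snd_canon_lessThan)
  then show ?thesis by (intro exI)
qed

lemma presents_in: "presents R A e \<Longrightarrow> i < fst A \<Longrightarrow> e i \<in> elems R"
  unfolding presents_def by (auto dest: bij_betwE)

lemma presents_surj: "presents R A e \<Longrightarrow> x \<in> elems R \<Longrightarrow> \<exists>i<fst A. e i = x"
proof -
  assume "presents R A e" "x \<in> elems R"
  then have "x \<in> e ` {..<fst A}" by (auto simp: presents_def bij_betw_def)
  then show ?thesis by auto
qed

lemma presents_inj: "presents R A e \<Longrightarrow> i < fst A \<Longrightarrow> j < fst A \<Longrightarrow> e i = e j \<Longrightarrow> i = j"
  unfolding presents_def bij_betw_def inj_on_def by auto

lemma presents_card: "presents R A e \<Longrightarrow> card (elems R) = fst A"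
  unfolding presents_def by (auto dest: bij_betw_same_card)

lemma presents_col: "presents R A e \<Longrightarrow> i < j \<Longrightarrow> j < fst A \<Longrightarrow> snd A i j = col R (e i) (e j)"
  by (simp add: presents_def)

lemma presents_ord:
  assumes R: "R \<in> Gamma k" and p: "presents R A e" and ij: "i < fst A" "j < fst A"
  shows "(e i, e j) \<in> ord R \<longleftrightarrow> i \<le> j"
proof
  assume "i \<le> j"
  then show "(e i, e j) \<in> ord R"
    using p ij GammaD(4)[OF R presents_in[OF p ij(1)]] by (cases "i = j") (auto simp: presents_def)
next
  assume o: "(e i, e j) \<in> ord R"
  show "i \<le> j"
  proof (rule ccontr)
    assume "\<not> i \<le> j"
    then have "(e j, e i) \<in> ord R" using p ij by (auto simp: presents_def)
    then have "e i = e j" using GammaD(6)[OF R o] by simp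
    then show False using presents_inj[OF p ij] \<open>\<not> i \<le> j\<close> by simp
  qed
qed

lemma col_eq_iff:
  assumes "length (rels R) = length (rels S)"
  shows "col R x y = col S x' y' \<longleftrightarrow>
    (\<forall>p<length (rels R). ((x, y) \<in> rels R ! p \<longleftrightarrow> (x', y') \<in> rels S ! p) \<and>
      ((y, x) \<in> rels R ! p \<longleftrightarrow> (y', x') \<in> rels S ! p))"
  using assms by (auto simp: col_def list_eq_iff_nth_eq)

text \<open>Since the order is linear, the presentation is unique, so isomorphism becomes equality.\<close>

lemma isomorphic_iff_same_presentation:
  assumes R: "R \<in> Gamma k" and S: "S \<in> Gamma k" and pR: "presents R A e" and pS: "presents S B d"
  shows "isomorphic R S \<longleftrightarrow> A = B"
proof
  assume "isomorphic R S"
  then obtain f where f: "bij_betw f (elems R) (elems S)"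
    "list_all2 (\<lambda>\<rho> \<sigma>. \<forall>x\<in>elems R. \<forall>y\<in>elems R. (x, y) \<in> \<rho> \<longleftrightarrow> (f x, f y) \<in> \<sigma>)
            (ord R # rels R) (ord S # rels S)" unfolding isomorphic_def all_rels_def by blast
  have ford: "(x, y) \<in> ord R \<longleftrightarrow> (f x, f y) \<in> ord S" if "x \<in> elems R" "y \<in> elems R" for x y
    using f(2) that by simp
  have len: "length (rels R) = length (rels S)" using GammaD(2)[OF R] GammaD(2)[OF S] by simp
  have frel: "(x, y) \<in> rels R ! p \<longleftrightarrow> (f x, f y) \<in> rels S ! p"
    if "x \<in> elems R" "y \<in> elems R" "p < length (rels R)" for x y p
    using list_all2_nthD[OF f(2)[unfolded list_all2_Cons, THEN conjunct2] that(3)] that(1,2) by simp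
  have "\<forall>i. \<exists>j. i < fst A \<longrightarrow> j < fst B \<and> d j = f (e i)"
  proof
    fix i show "\<exists>j. i < fst A \<longrightarrow> j < fst B \<and> d j = f (e i)"
    proof (cases "i < fst A")
      case True
      then have "f (e i) \<in> elems S" using presents_in[OF pR] f(1) by (auto dest: bij_betwE)
      then show ?thesis using presents_surj[OF pS] by blast
    qed simp
  qed
  \<comment> \<open>\<open>g\<close> is \<open>f\<close> read on positions. It will be an embedding
    of canonical structures of equal size, which forces them to be equal.\<close>
  then obtain g where g: "\<forall>i. i < fst A \<longrightarrow> g i < fst B \<and> d (g i) = f (e i)" by (rule choice[THEN exE])
  have mono: "g i < g j" if ij: "i < j" "j < fst A" for i j
  proof -
    have E: "e i \<in> elems R" "e j \<in> elems R" using presents_in[OF pR] ij by auto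
    have "(e i, e j) \<in> ord R" using presents_ord[OF R pR, of i j] ij by simp
    then have "(d (g i), d (g j)) \<in> ord S" using ford[OF E] g ij by simp
    then have "g i \<le> g j" using presents_ord[OF S pS, of "g i" "g j"] g ij by simp
    moreover have "g i \<noteq> g j"
    proof
      assume "g i = g j"
      then have "f (e i) = f (e j)" using g ij by (metis less_trans)
      then have "e i = e j" using f(1) E by (auto simp: bij_betw_def inj_on_def)
      then show False using presents_inj[OF pR, of i j] ij by simp
    qed
    ultimately show ?thesis by simp
  qed
  have "snd A i j = snd B (g i) (g j)" if ij: "i < j" "j < fst A" for i j
  proof -
    have E: "e i \<in> elems R" "e j \<in> elems R" using presents_in[OF pR] ij by auto
    have dg: "d (g i) = f (e i)" "d (g j) = f (e j)" "g j < fst B" using g ij by auto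
    have "snd A i j = col R (e i) (e j)" by (rule presents_col[OF pR ij])
    also have "\<dots> = col S (f (e i)) (f (e j))"
      unfolding col_eq_iff[OF len] using frel E by blast
    also have "\<dots> = snd B (g i) (g j)" using presents_col[OF pS mono[OF ij] dg(3)] dg by simp
    finally show ?thesis .
  qed
  then have "cemb A B"
    unfolding cemb_def using mono g by (intro exI[of _ g]) (auto simp: strict_mono_on_def)
  moreover have "fst A = fst B"
    using presents_card[OF pR] presents_card[OF pS] bij_betw_same_card[OF f(1)] by simp
  ultimately show "A = B" using pR pS by (intro cemb_same_size_eq) (auto simp: presents_def)
next
  assume AB: "A = B"
  let ?n = "fst A"
  let ?f = "\<lambda>x. d (inv_into {..<?n} e x)"
  have be: "bij_betw e {..<?n} (elems R)" and bd: "bij_betw d {..<?n} (elems S)"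
    using pR pS AB by (auto simp: presents_def)
  have f: "?f (e i) = d i" if "i < ?n" for i using bij_betw_inv_into_left[OF be] that by simp
  have len: "length (rels R) = length (rels S)" using GammaD(2)[OF R] GammaD(2)[OF S] by simp
  have "bij_betw (d \<circ> inv_into {..<?n} e) (elems R) (elems S)"
    using bij_betw_trans[OF bij_betw_inv_into[OF be] bd] .
  then have bij: "bij_betw ?f (elems R) (elems S)" by (simp add: comp_def)
  have rel: "(e i, e j) \<in> rels R ! p \<longleftrightarrow> (d i, d j) \<in> rels S ! p"
    if ij: "i < ?n" "j < ?n" and p: "p < length (rels R)" for i j p
  proof -
    have lt: "col R (e i) (e j) = col S (d i) (d j)" if "i < j" "j < ?n" for i j
      using presents_col[OF pR that] presents_col[OF pS] that AB by simp
    consider "i < j" | "i = j" | "j < i" by linarith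
    then show ?thesis
    proof cases
      case 1
      then show ?thesis using lt[of i j] ij p unfolding col_eq_iff[OF len] by blast
    next
      \<comment> \<open>Colours say nothing about loops; reflexivity of all relations settles the
        diagonal.\<close>
      case 2
      then show ?thesis
        using GammaD(3)[OF R] GammaD(3)[OF S] presents_in[OF pR] presents_in[OF pS] ij p len AB by simp
    next
      case 3
      then show ?thesis using lt[of j i] ij p unfolding col_eq_iff[OF len] by blast
    qed
  qed
  have E: "\<exists>i<?n. x = e i" if "x \<in> elems R" for x using presents_surj[OF pR that] by blast
  have "list_all2 (\<lambda>\<rho> \<sigma>. \<forall>x\<in>elems R. \<forall>y\<in>elems R. (x, y) \<in> \<rho> \<longleftrightarrow> (?f x, ?f y) \<in> \<sigma>)
            (all_rels R) (all_rels S)"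
    unfolding all_rels_def list.rel_inject(2)
  proof (intro conjI ballI)
    fix x y assume "x \<in> elems R" "y \<in> elems R"
    then obtain i j where "i < ?n" "j < ?n" "x = e i" "y = e j" using E by blast
    then show "(x, y) \<in> ord R \<longleftrightarrow> (?f x, ?f y) \<in> ord S"
      using presents_ord[OF R pR] presents_ord[OF S pS] AB f by simp
  next
    show "list_all2 (\<lambda>\<rho> \<sigma>. \<forall>x\<in>elems R. \<forall>y\<in>elems R. (x, y) \<in> \<rho> \<longleftrightarrow> (?f x, ?f y) \<in> \<sigma>) (rels R) (rels S)"
      unfolding list_all2_conv_all_nth
    proof (intro conjI allI impI ballI)
      fix p x y assume p: "p < length (rels R)" and "x \<in> elems R" "y \<in> elems R"
      then obtain i j where "i < ?n" "j < ?n" "x = e i" "y = e j" using E by blast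
      then show "(x, y) \<in> rels R ! p \<longleftrightarrow> (?f x, ?f y) \<in> rels S ! p" using rel p f by simp
    qed (rule len)
  qed
  with bij show "isomorphic R S" unfolding isomorphic_def by (intro exI[of _ ?f] conjI)
qed

lemma isomorphic_refl: "isomorphic R R"
  unfolding isomorphic_def by (rule exI[of _ "\<lambda>x. x"]) (auto simp: list_all2_same bij_betw_def inj_on_def)

text \<open>The choice is harmless, since only one canonical structure presents a given member of
  \<open>Gamma k\<close>.\<close>

definition canonize :: "'a obs \<Rightarrow> (bool \<times> bool) list cstr" where
  "canonize R = (SOME A. \<exists>e. presents R A e)"

lemma canonize_presents:
  assumes "R \<in> Gamma k" obtains e where "presents R (canonize R) e"
proof -
  have "\<exists>e. presents R (canonize R) e"
    unfolding canonize_def using presents_exists[OF assms] by (rule someI_ex)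
  then show ?thesis using that by (elim exE)
qed

lemma canonize_eqI:
  assumes R: "R \<in> Gamma k" and p: "presents R A e"
  shows "canonize R = A"
proof -
  obtain d where d: "presents R (canonize R) d" using canonize_presents[OF R] .
  show ?thesis using isomorphic_iff_same_presentation[OF R R d p] isomorphic_refl[of R] by simp
qed

lemma isomorphic_iff_canonize:
  assumes R: "R \<in> Gamma k" and S: "S \<in> Gamma k"
  shows "isomorphic R S \<longleftrightarrow> canonize R = canonize S"
proof -
  obtain e where e: "presents R (canonize R) e" using canonize_presents[OF R] .
  obtain d where d: "presents S (canonize S) d" using canonize_presents[OF S] .
  show ?thesis by (rule isomorphic_iff_same_presentation[OF R S e d])
qed

lemma fst_canonize: assumes "R \<in> Gamma k" shows "fst (canonize R) = card (elems R)"
proof -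
  obtain e where "presents R (canonize R) e" using canonize_presents[OF assms] .
  from presents_card[OF this] show ?thesis by simp
qed

section \<open>Restrictions and indecomposability of ordered structures\<close>

lemma restriction_structure:
  assumes R: "R \<in> Gamma k" and T: "T \<subseteq> elems R"
  shows "ordered_binary_structure k (restriction R T)"
proof -
  note G = GammaD[OF R]
  have "linear_order_on T (Restr (ord R) T)"
    unfolding linear_order_on_def partial_order_on_def preorder_on_def
  proof (intro conjI)
    show "refl_on T (Restr (ord R) T)" using G(4) T by (auto simp: refl_on_def)
    show "trans (Restr (ord R) T)" using G(5) unfolding trans_def by blast
    show "antisym (Restr (ord R) T)" using G(6) unfolding antisym_def by blast
    show "total_on T (Restr (ord R) T)" using G(7) T unfolding total_on_def by blast
  qed auto
  then show ?thesis using G(2) by (auto simp: ordered_binary_structure_def restriction_def)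
qed

text \<open>Realizes an embedding of canonical structures as a genuine restriction, so that heredity
  of the class becomes closure under \<open>cemb\<close>.\<close>

lemma presents_restriction:
  assumes p: "presents R B e" and A: "well_formed A"
    and f: "strict_mono_on {..<fst A} f" "f ` {..<fst A} \<subseteq> {..<fst B}"
      "\<And>i j. i < j \<and> j < fst A \<Longrightarrow> snd A i j = snd B (f i) (f j)"
  shows "presents (restriction R ((\<lambda>i. e (f i)) ` {..<fst A})) A (\<lambda>i. e (f i))"
proof -
  let ?T = "(\<lambda>i. e (f i)) ` {..<fst A}"
  have fB: "f i < fst B" if "i < fst A" for i using f(2) that by auto
  have finj: "inj_on f {..<fst A}" using f(1) strict_mono_on_imp_inj_on by blast
  have "inj_on (\<lambda>i. e (f i)) {..<fst A}"
  proof (rule inj_onI)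
    fix i j assume ij: "i \<in> {..<fst A}" "j \<in> {..<fst A}" "e (f i) = e (f j)"
    then have "f i = f j" using presents_inj[OF p] fB by simp
    then show "i = j" using finj ij by (auto simp: inj_on_def)
  qed
  then have "bij_betw (\<lambda>i. e (f i)) {..<fst A} (elems (restriction R ?T))"
    by (simp add: bij_betw_def restriction_def)
  moreover have "(e (f i), e (f j)) \<in> ord (restriction R ?T) \<and>
      snd A i j = col (restriction R ?T) (e (f i)) (e (f j))" if ij: "i < j \<and> j < fst A" for i j
  proof -
    have "f i < f j" using f(1) ij by (auto simp: strict_mono_on_def)
    then have o: "(e (f i), e (f j)) \<in> ord R" and c: "snd B (f i) (f j) = col R (e (f i)) (e (f j))"
      using p fB ij by (auto simp: presents_def)
    have T: "e (f i) \<in> ?T" "e (f j) \<in> ?T" using ij by auto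
    then have "col (restriction R ?T) (e (f i)) (e (f j)) = col R (e (f i)) (e (f j))"
      by (simp add: col_def restriction_def)
    then show ?thesis using o c T f(3)[OF ij] by (simp add: restriction_def)
  qed
  ultimately show ?thesis unfolding presents_def using A by blast
qed

text \<open>Transfers the finiteness hypothesis. The order is one of the relations, so an interval
  contains everything between two of its points and becomes a segment of positions.\<close>

lemma indecomposable_if_cindec:
  assumes R: "R \<in> Gamma k" and p: "presents R A e" and A: "cindec A"
  shows "indecomposable R"
  unfolding indecomposable_def
proof (intro allI impI)
  fix X assume X: "interval_of R X"
  have XE: "X \<subseteq> elems R" using X by (simp add: interval_of_def)
  have int: "((x, a) \<in> \<rho> \<longleftrightarrow> (x, a') \<in> \<rho>) \<and> ((a, x) \<in> \<rho> \<longleftrightarrow> (a', x) \<in> \<rho>)"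
    if "\<rho> \<in> set (all_rels R)" "a \<in> X" "a' \<in> X" "x \<in> elems R" "x \<notin> X" for \<rho> a a' x
    using X that unfolding interval_of_def by blast
  define I where "I = {i. i < fst A \<and> e i \<in> X}"
  have fin: "finite I" by (simp add: I_def)
  show "X = {} \<or> (\<exists>x. X = {x}) \<or> X = elems R"
  proof (cases "\<exists>x y. x \<in> X \<and> y \<in> X \<and> x \<noteq> y")
    case False
    then show ?thesis by blast
  next
    case True
    then obtain x y where xy: "x \<in> X" "y \<in> X" "x \<noteq> y" by blast
    obtain i where i: "i < fst A" "e i = x" using presents_surj[OF p, of x] xy XE by blast
    obtain j where j: "j < fst A" "e j = y" using presents_surj[OF p, of y] xy XE by blast
    have ij: "i \<in> I" "j \<in> I" "i \<noteq> j" using i j xy by (auto simp: I_def)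
    define a where "a = Min I"
    define b where "b = Max I"
    have "I \<noteq> {}" using ij by blast
    then have ab: "a \<in> I" "b \<in> I" using fin by (auto simp: a_def b_def)
    have bounds: "a \<le> z \<and> z \<le> b" if "z \<in> I" for z using fin that by (auto simp: a_def b_def)
    have "a < b" using bounds[OF ij(1)] bounds[OF ij(2)] ij(3) by linarith
    have abA: "a < fst A" "b < fst A" "e a \<in> X" "e b \<in> X" using ab by (auto simp: I_def)
    have convex: "e z \<in> X" if z: "a \<le> z" "z \<le> b" for z
    proof (rule ccontr)
      assume nz: "e z \<notin> X"
      have zA: "z < fst A" using z abA by simp
      \<comment> \<open>A point outside \<open>X\<close> compares alike with \<open>e a\<close> and
        \<open>e b\<close>, which is impossible strictly between them.\<close>
      have "(e z, e a) \<in> ord R \<longleftrightarrow> (e z, e b) \<in> ord R"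
        using int[of "ord R" "e a" "e b" "e z"] abA nz presents_in[OF p zA] by (simp add: all_rels_def)
      then have "z \<le> a" using presents_ord[OF R p zA] abA z by simp
      then have "z = a" using z by simp
      then show False using nz abA by simp
    qed
    have outside: "e z \<in> elems R" "e z \<notin> X" if "z < fst A" "z < a \<or> b < z" for z
      using presents_in[OF p that(1)] bounds[of z] that by (auto simp: I_def)
    have cols: "col R (e z) (e u) = col R (e z) (e a)" "col R (e u) (e z) = col R (e a) (e z)"
      if z: "z < fst A" "z < a \<or> b < z" and u: "a \<le> u" "u \<le> b" for z u
      using int[OF _ convex[OF u] abA(3) outside[OF z]] unfolding col_def all_rels_def by auto
    have "segment_interval A a b" unfolding segment_interval_def
    proof (intro conjI allI impI)
      fix z u assume zu: "z < a \<and> a \<le> u \<and> u \<le> b"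
      then have "snd A z u = col R (e z) (e u)" "snd A z a = col R (e z) (e a)"
        using abA by (auto intro!: presents_col[OF p])
      then show "snd A z u = snd A z a" using cols(1)[of z u] zu abA by simp
    next
      fix z u assume zu: "b < z \<and> z < fst A \<and> a \<le> u \<and> u \<le> b"
      then have "snd A u z = col R (e u) (e z)" "snd A a z = col R (e a) (e z)"
        using abA by (auto intro!: presents_col[OF p])
      then show "snd A u z = snd A a z" using cols(2)[of z u] zu abA by simp
    qed
    from cindecD[OF A \<open>a < b\<close> abA(2) this] have full: "a = 0" "Suc b = fst A" by auto
    have "elems R \<subseteq> X"
    proof
      fix x assume "x \<in> elems R"
      then obtain z where "z < fst A" "e z = x" using presents_surj[OF p] by blast
      then show "x \<in> X" using convex[of z] full by simp
    qed
    then show ?thesis using XE by blast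
  qed
qed

text \<open>Isomorphism is equality of canonical structures, so the classes are the fibres of
  \<open>canonize\<close>. Counting them becomes counting canonical structures.\<close>

lemma iso_classes_eq:
  assumes "K \<subseteq> Gamma k"
  shows "iso_classes K = (\<lambda>A. {S \<in> K. canonize S = A}) ` canonize ` K"
proof -
  let ?r = "{(R, S). R \<in> K \<and> S \<in> K \<and> isomorphic R S}"
  have fibre: "?r `` {R} = {S \<in> K. canonize S = canonize R}" if R: "R \<in> K" for R
  proof (rule set_eqI)
    fix S show "S \<in> ?r `` {R} \<longleftrightarrow> S \<in> {S \<in> K. canonize S = canonize R}"
    proof (cases "S \<in> K")
      case True
      have "isomorphic R S \<longleftrightarrow> canonize R = canonize S"
        by (rule isomorphic_iff_canonize) (use R True assms in auto)
      then show ?thesis using R True by auto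
    qed simp
  qed
  have "K // ?r = (\<lambda>R. ?r `` {R}) ` K" unfolding quotient_def by blast
  also have "\<dots> = (\<lambda>R. {S \<in> K. canonize S = canonize R}) ` K" by (rule image_cong[OF refl fibre])
  finally show ?thesis unfolding iso_classes_def by (simp add: image_image)
qed

lemma inj_on_fibres: "inj_on (\<lambda>A. {S \<in> K. canonize S = A}) (canonize ` K)"
proof (rule inj_onI)
  fix A B assume "A \<in> canonize ` K" and eq: "{S \<in> K. canonize S = A} = {S \<in> K. canonize S = B}"
  then obtain S where "S \<in> {S \<in> K. canonize S = A}" by blast
  then show "A = B" using eq by auto
qed

theorem theorem3p33:
  fixes k :: nat and C :: "nat obs set"
  assumes "C \<subseteq> Gamma k"
    and "hereditary k C"
    and "finite (iso_classes {R \<in> C. indecomposable R})"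
  shows "algebraic_series (generating_series C)"
proof -
  \<comment> \<open>The empty structure is removed here and returns in the constant term
    \<open>profile C 0\<close>.\<close>
  define D where "D = canonize ` {R \<in> C. elems R \<noteq> {}}"
  have G: "R \<in> Gamma k" if "R \<in> C" for R using assms(1) that by blast
  have size: "fst (canonize R) = card (elems R)" if "R \<in> C" for R using fst_canonize[OF G[OF that]] .
  have nonempty: "0 < card (elems R) \<longleftrightarrow> elems R \<noteq> {}" if "R \<in> C" for R
    using GammaD(1)[OF G[OF that]] by (simp add: card_gt_0_iff)
  interpret finite_indecomposables D
  proof
    fix A assume "A \<in> D"
    then obtain R where R: "R \<in> C" "elems R \<noteq> {}" "A = canonize R" by (auto simp: D_def)
    obtain e where e: "presents R A e" using canonize_presents[OF G[OF R(1)]] R(3) by metis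
    then show "well_formed A" by (simp add: presents_def)
    show "fst A > 0" using size nonempty R by simp
    fix B assume B: "well_formed B" "fst B > 0" "cemb B A"
    obtain f where f: "strict_mono_on {..<fst B} f" "f ` {..<fst B} \<subseteq> {..<fst A}"
      "\<And>i j. i < j \<and> j < fst B \<Longrightarrow> snd B i j = snd A (f i) (f j)"
      using B(3) unfolding cemb_def by blast
    let ?T = "(\<lambda>i. e (f i)) ` {..<fst B}"
    let ?S = "restriction R ?T"
    have T: "?T \<subseteq> elems R" using presents_in[OF e] f(2) by auto
    have "ordered_binary_structure k ?S" by (rule restriction_structure[OF G[OF R(1)] T])
    moreover have "embeds ?S R" unfolding embeds_def using T isomorphic_refl by blast
    ultimately have S: "?S \<in> C" using assms(2) R(1) unfolding hereditary_def by blast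
    have "canonize ?S = B"
      by (rule canonize_eqI[OF G[OF S] presents_restriction[OF e B(1) f]])
    moreover have "elems ?S \<noteq> {}" using B(2) by (auto simp: restriction_def)
    ultimately show "B \<in> D" using S unfolding D_def by (intro image_eqI[of _ _ ?S]) auto
  next
    let ?K = "{R \<in> C. indecomposable R}"
    have "?K \<subseteq> Gamma k" using assms(1) by blast
    then have "finite (canonize ` ?K)"
      using assms(3) inj_on_fibres[of ?K] by (simp add: iso_classes_eq finite_image_iff)
    moreover have "{\<sigma> \<in> D. cindec \<sigma>} \<subseteq> canonize ` ?K"
    proof
      fix \<sigma> assume "\<sigma> \<in> {\<sigma> \<in> D. cindec \<sigma>}"
      then obtain R where R: "R \<in> C" "\<sigma> = canonize R" "cindec \<sigma>" by (auto simp: D_def)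
      obtain e where "presents R \<sigma> e" using canonize_presents[OF G[OF R(1)]] R(2) by metis
      then have "indecomposable R" using indecomposable_if_cindec[OF G[OF R(1)]] R(3) by blast
      then show "\<sigma> \<in> canonize ` ?K" using R by blast
    qed
    ultimately show "finite {\<sigma> \<in> D. cindec \<sigma>}" by (rule finite_subset[rotated])
  qed
  have prof: "profile C n = card (canonize ` {R \<in> C. card (elems R) = n})" for n
  proof -
    let ?K = "{R \<in> C. card (elems R) = n}"
    have "?K \<subseteq> Gamma k" using assms(1) by blast
    then show ?thesis unfolding profile_def
      by (simp only: iso_classes_eq card_image[OF inj_on_fibres])
  qed
  \<comment> \<open>Stated for \<open>n \<noteq> 0\<close> because \<open>D\<close> omits the empty
    structure; the coefficient at 0 is compared separately.\<close>
  have level: "canonize ` {R \<in> C. card (elems R) = n} = {A \<in> D. fst A = n}" if "n \<noteq> 0" for n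
    using that size nonempty by (auto simp: D_def)
  have "Abs_fps (\<lambda>n. rat_of_int (fps_nth (generating_series C) n)) =
      fps_of_poly [:of_nat (profile C 0):] + gf fst D"
  proof (rule fps_ext)
    fix n
    show "fps_nth (Abs_fps (\<lambda>n. rat_of_int (fps_nth (generating_series C) n))) n =
        fps_nth (fps_of_poly [:of_nat (profile C 0):] + gf fst D) n"
    proof (cases "n = 0")
      case True
      then show ?thesis using gf_const_coeff[of D] by (simp add: generating_series_def)
    next
      case False
      then show ?thesis
        by (simp add: generating_series_def gf_nth prof[of n] level coeff_pCons split: nat.splits)
    qed
  qed
  moreover have "alg_fps (fps_of_poly [:of_nat (profile C 0):] + gf fst D)"
    by (intro alg_fps_add alg_fps_of_poly alg_fps_gf)
  ultimately show ?thesis unfolding algebraic_series_def alg_fps_def by simp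
qed

end
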